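(* There is an absolute (numeric) constant $C>0$ such that the following holds. Let $\mu$ be a probability measure on $\mathbb{R}^n$ with a bounded density $f$. Then for each integer $1\le k\le n-1$ there exists $\mathcal{A}\subseteq G_{n,k}$ with $\mu_{n,k}(\mathcal{A})\ge 1-2e^{-kn}$ such that for every $E\in\mathcal{A}$, $$ f_{\pi_E(\mu)}(x)^{1/k}\le C\|f\|_\infty^{1/n} $$ for all $x\in E$, except possibly on a set of $\pi_E(\mu)$-measure less than $e^{-kn}$.
   Context: $G_{n,k}$ is the Grassmannian of $k$-dimensional linear subspaces of $\mathbb{R}^n$, with its Haar (rotation-invariant) probability measure $\mu_{n,k}$. For $E\in G_{n,k}$, $\pi_E(\mu)$ is the marginal of $\mu$ on $E$, i.e. the push-forward of $\mu$ under the orthogonal projection onto $E$; its density on $E$ is $f_{\pi_E(\mu)}(x)=\int_{E^\perp+x}f(y)\,dy$ for $x\in E$ (integration with respect to $(n-k)$-dimensional Lebesgue measure). $\|\cdot\|_\infty$ is the $L^\infty$-norm. The constant $C$ does not depend on $n,k,\mu$. *)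

theory Defs
  imports "HOL-Probability.Probability" "HOL-Library.Function_Algebras"
begin

text \<open>
  The dimension n has to be quantified inside the statement (the constant C must not depend
  on it), so it cannot be a type.  The space R^n is the subspace of the real sequences that
  vanish from index n on.  Functions carry the pointwise vector space structure and the product
  topology; on R^n the latter is the Euclidean topology.
\<close>

instantiation "fun" :: (type, real_vector) real_vector
begin

definition scaleR_fun_def: "scaleR r f = (\<lambda>x. r *\<^sub>R f x)"

instance
  by standard
    (auto simp: scaleR_fun_def fun_eq_iff plus_fun_def scaleR_add_left scaleR_add_right)

end

definition Rn :: "nat \<Rightarrow> (nat \<Rightarrow> real) set" where
  "Rn n = {x. \<forall>i\<ge>n. x i = 0}"

definition ip :: "nat \<Rightarrow> (nat \<Rightarrow> real) \<Rightarrow> (nat \<Rightarrow> real) \<Rightarrow> real" where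
  "ip n x y = (\<Sum>i<n. x i * y i)"

text \<open>
  The product measure lives on functions that are undefined outside of {..<n};
  it is transported to sequences padded with zeros.
\<close>

definition lebesgue_Rn :: "nat \<Rightarrow> (nat \<Rightarrow> real) measure" where
  "lebesgue_Rn n = distr (Pi\<^sub>M {..<n} (\<lambda>_. lborel)) (restrict_space borel (Rn n))
     (\<lambda>x i. if i < n then x i else 0)"

definition Linf_norm :: "'a measure \<Rightarrow> ('a \<Rightarrow> real) \<Rightarrow> ereal" where
  "Linf_norm M f = esssup M (\<lambda>x. ereal \<bar>f x\<bar>)"

definition orth_complement :: "nat \<Rightarrow> (nat \<Rightarrow> real) set \<Rightarrow> (nat \<Rightarrow> real) set" where
  "orth_complement n E = {y \<in> Rn n. \<forall>z\<in>E. ip n y z = 0}"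

definition orth_proj :: "nat \<Rightarrow> (nat \<Rightarrow> real) set \<Rightarrow> (nat \<Rightarrow> real) \<Rightarrow> (nat \<Rightarrow> real)" where
  "orth_proj n E x = (THE y. y \<in> E \<and> (\<forall>z\<in>E. ip n (x - y) z = 0))"

definition orthonormal_basis ::
  "nat \<Rightarrow> (nat \<Rightarrow> real) set \<Rightarrow> (nat \<Rightarrow> (nat \<Rightarrow> real)) \<Rightarrow> bool" where
  "orthonormal_basis n W w \<longleftrightarrow>
     (\<forall>i<dim W. \<forall>j<dim W. ip n (w i) (w j) = (if i = j then 1 else 0)) \<and>
     span (w ` {..<dim W}) = W"

text \<open>
  Lebesgue measure of dimension dim W on a linear subspace W of R^n, as a measure on R^n:
  the image of Lebesgue measure on R^(dim W) under the isometry given by an orthonormal basis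
  of W.  It does not depend on the basis that is chosen.
\<close>

definition lebesgue_subspace :: "nat \<Rightarrow> (nat \<Rightarrow> real) set \<Rightarrow> (nat \<Rightarrow> real) measure" where
  "lebesgue_subspace n W =
     (let w = (SOME w. orthonormal_basis n W w)
      in distr (lebesgue_Rn (dim W)) (restrict_space borel (Rn n))
           (\<lambda>c. \<Sum>j<dim W. c j *\<^sub>R w j))"

definition marginal :: "nat \<Rightarrow> (nat \<Rightarrow> real) set \<Rightarrow> (nat \<Rightarrow> real) measure \<Rightarrow> (nat \<Rightarrow> real) measure" where
  "marginal n E \<mu> = distr \<mu> (restrict_space borel E) (orth_proj n E)"

text \<open>
  The integral of f over x + W, where W is the orthogonal complement of E; it may be infinite
  at some x, since f is only assumed to be integrable over R^n.
\<close>

definition marginal_density ::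
  "nat \<Rightarrow> (nat \<Rightarrow> real) set \<Rightarrow> ((nat \<Rightarrow> real) \<Rightarrow> real) \<Rightarrow> (nat \<Rightarrow> real) \<Rightarrow> ennreal" where
  "marginal_density n E f x =
     (\<integral>\<^sup>+ y. ennreal (f (x + y)) \<partial>lebesgue_subspace n (orth_complement n E))"

definition grassmannian :: "nat \<Rightarrow> nat \<Rightarrow> (nat \<Rightarrow> real) set set" where
  "grassmannian n k = {E. subspace E \<and> E \<subseteq> Rn n \<and> dim E = k}"

text \<open>
  The usual topology of the Grassmannian is the one that makes the map sending E to the matrix
  of the orthogonal projection onto E an embedding.  This is its Borel sigma-algebra; the
  entry (j, i) of the matrix is the i-th coordinate of the projection of the j-th unit vector,
  and all entries with i or j at least n are zero.
\<close>

definition grassmannian_borel :: "nat \<Rightarrow> nat \<Rightarrow> (nat \<Rightarrow> real) set measure" where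
  "grassmannian_borel n k =
     vimage_algebra (grassmannian n k)
       (\<lambda>E j i. orth_proj n E (indicator {j}) i)
       (borel :: (nat \<Rightarrow> nat \<Rightarrow> real) measure)"

definition orthogonal_map :: "nat \<Rightarrow> ((nat \<Rightarrow> real) \<Rightarrow> (nat \<Rightarrow> real)) \<Rightarrow> bool" where
  "orthogonal_map n U \<longleftrightarrow> linear U \<and> U ` Rn n = Rn n \<and>
     (\<forall>x\<in>Rn n. \<forall>y\<in>Rn n. ip n (U x) (U y) = ip n x y)"

text \<open>
  The Haar measure of the Grassmannian is the unique measure with this property.
\<close>

definition haar_grassmannian :: "nat \<Rightarrow> nat \<Rightarrow> (nat \<Rightarrow> real) set measure \<Rightarrow> bool" where
  "haar_grassmannian n k \<nu> \<longleftrightarrow>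
     prob_space \<nu> \<and> space \<nu> = grassmannian n k \<and> sets \<nu> = sets (grassmannian_borel n k) \<and>
     (\<forall>U. orthogonal_map n U \<longrightarrow> distr \<nu> \<nu> ((`) U) = \<nu>)"

end

theory Submission
  imports "HOL-Probability.Probability" "Jordan_Normal_Form.Char_Poly" Defs
begin

text \<open>
  Let m = n - k. By Markov's inequality it suffices to bound the mean, over E and over x distributed
  according to mu, of the n-th power of the marginal density at x by (20 e)^(kn) M^k, where M is the
  supremum norm of f. An inequality of Blaschke--Petkantschin type bounds the mean over F, the orthogonal
  complement of E, of the integral over tuples z in F^m of the product of all f(x + z_j), times
  |det z|^k, by a constant times the same integral over (R^n)^m without the determinant, which is 1.
  So one needs a lower bound for the integral of h(z_1) ... h(z_m) |det z|^k over (R^m)^m that is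
  a multiple of L^n / M^k, for every h with 0 <= h <= M and integral L; here h is f on the fibre x + F.
  By convexity the case k = 1 suffices. The integral is invariant under matrices of determinant 1; in the
  position that minimises the integral of h(y) |y|, the matrix of the integrals of
  h(y) y_i y_j / |y| is a multiple of the identity, and Hadamard's inequality reduces the claim to
  an expected squared determinant, which is computed exactly.

  The Haar measure enters through its invariance only: random subspaces are compared with spans of
  Gaussian vectors by averaging over the orthogonal matrices obtained by the Gram--Schmidt process
  from Gaussian ones.
\<close>

hide_const (open) Finite_Cartesian_Product.vec Finite_Cartesian_Product.mat Finite_Cartesian_Product.row Determinants.det Order.top
hide_type (open) Finite_Cartesian_Product.vec
no_notation Finite_Cartesian_Product.vec_nth (infixl \<open>$\<close> 90)

section \<open>Linear changes of variables\<close>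

text \<open>The power n is forced. If a basis of F is changed by a matrix of determinant D, the
  fibre integral is divided by |D|, while the weight of a basis in the Blaschke--Petkantschin
  inequality is multiplied by |D|^n; and the determinant bound on a fibre produces the mass of the
  fibre to the power m + k. For n = m + k the exponents match, so that the averaged quantity depends
  on F alone. The bound is free of dimensional factors because the growth sqrt(n)^(km) of the
  Gaussian determinant moment meets m! / sqrt(m)^m in the lower bound, and n^m / m! is at most e^n.
  Markov's inequality is used twice, in x and in E, each time at the price e^(kn); this turns 20 e
  into the final constant 20 e^3. The obstacle is that a subspace comes without a measurable choice
  of a basis. Hence functions of a subspace are represented by functions of tuples that do not
  change with the basis. Since n is a variable and not a type, the change of variables formulas are
  proved for matrices of variable size, by Gaussian elimination.\<close>

abbreviation elem_mat :: "nat \<Rightarrow> real vec \<Rightarrow> nat \<Rightarrow> real mat" where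
  "elem_mat m v r \<equiv> replace_col (1\<^sub>m m) v r"

lemma elem_mat_carrier [simp]: "elem_mat m v r \<in> carrier_mat m m"
  by (simp add: replace_col_def)

lemma elem_mat_mult_vec:
  assumes "v \<in> carrier_vec m" "x \<in> carrier_vec m" "r < m"
  shows "elem_mat m v r *\<^sub>v x = vec m (\<lambda>i. (if i = r then 0 else x $ i) + x $ r * v $ i)"
proof (rule eq_vecI)
  fix i assume i: "i < dim_vec (vec m (\<lambda>i. (if i = r then 0 else x $ i) + x $ r * v $ i))"
  have "(elem_mat m v r *\<^sub>v x) $ i = (\<Sum>j\<in>{0..<m}. (if j = r then v $ i else if i = j then 1 else 0) * x $ j)"
    using i assms by (auto simp: replace_col_def scalar_prod_def intro!: sum.cong)
  also have "\<dots> = v $ i * x $ r + (\<Sum>j\<in>{0..<m} - {r}. (if i = j then 1 else 0) * x $ j)"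
    using assms by (subst sum.remove[of _ r]) (auto intro!: sum.cong)
  also have "(\<Sum>j\<in>{0..<m} - {r}. (if i = j then 1 else 0) * x $ j) = (if i = r then 0 else x $ i)"
    using i assms by (simp add: if_distrib[of "\<lambda>c. c * _"] sum.delta' cong: if_cong)
  finally show "(elem_mat m v r *\<^sub>v x) $ i = vec m (\<lambda>i. (if i = r then 0 else x $ i) + x $ r * v $ i) $ i"
    using i by simp
qed (use assms in \<open>auto simp: replace_col_def\<close>)

text \<open>Cramer's rule for the identity matrix.\<close>

lemma det_elem_mat:
  assumes "v \<in> carrier_vec m" "r < m"
  shows "det (elem_mat m v r) = v $ r"
  using cramer_lemma_mat[of "1\<^sub>m m" m v r] assms by simp

lemma elem_mat_unit:
  assumes "v \<in> carrier_vec m" "r < m" "j < m"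
  shows "elem_mat m v r *\<^sub>v unit_vec m j = (if j = r then v else unit_vec m j)"
  using assms by (subst elem_mat_mult_vec) (auto intro!: eq_vecI)

section \<open>Gaussian elimination as an induction principle\<close>

lemma mat_eq_by_cols:
  assumes "A \<in> carrier_mat n m" "B \<in> carrier_mat n m" "\<And>j. j < m \<Longrightarrow> col A j = col B j"
  shows "A = B"
proof (rule eq_matI)
  fix i j assume "i < dim_row B" "j < dim_col B"
  hence ij: "i < n" "j < m" using assms by auto
  have "A $$ (i,j) = col A j $ i" using ij assms(1) by simp
  also have "\<dots> = B $$ (i,j)" unfolding assms(3)[OF ij(2)] using ij assms(2) by simp
  finally show "A $$ (i,j) = B $$ (i,j)" .
qed (use assms in auto)

lemma mult_unit_vec_col:
  assumes "A \<in> carrier_mat n m" "j < m"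
  shows "A *\<^sub>v unit_vec m j = col (A :: real mat) j"
  using assms by (auto intro!: eq_vecI)

lemma inverse_mat_exists:
  assumes "A \<in> carrier_mat m m" "det (A :: real mat) \<noteq> 0"
  obtains B where "B \<in> carrier_mat m m" "B * A = 1\<^sub>m m" "A * B = 1\<^sub>m m" "det B * det A = 1"
proof -
  let ?B = "(1 / det A) \<cdot>\<^sub>m adj_mat A"
  have *: "adj_mat A \<in> carrier_mat m m" "A * adj_mat A = det A \<cdot>\<^sub>m 1\<^sub>m m" "adj_mat A * A = det A \<cdot>\<^sub>m 1\<^sub>m m"
    using adj_mat[OF assms(1)] by auto
  have B: "?B \<in> carrier_mat m m" using * by simp
  have 1: "?B * A = 1\<^sub>m m"
    using * assms by (subst mult_smult_assoc_mat[of _ m m _ m]) (auto intro!: eq_matI)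
  have 2: "A * ?B = 1\<^sub>m m"
    using * assms by (subst mult_smult_distrib[of _ m m _ m]) (auto intro!: eq_matI)
  have "det (?B * A) = 1" using 1 by simp
  hence "det ?B * det A = 1" using det_mult[OF B assms(1)] by simp
  thus ?thesis using that B 1 2 by blast
qed

text \<open>The inner induction runs downwards over the number \<open>r\<close> of leading columns
  that are already unit vectors; at \<open>r = m\<close> the matrix is the identity. Replacing one
  column of the identity gives a single kind of factor that clears a whole column at once, so that
  one step case suffices.\<close>

lemma invertible_mat_induct [consumes 2, case_names one elem]:
  fixes S :: "real mat"
  assumes "S \<in> carrier_mat m m" "det S \<noteq> 0"
    and one: "P (1\<^sub>m m)"
    and elem: "\<And>r v S. r < m \<Longrightarrow> v \<in> carrier_vec m \<Longrightarrow> v $ r \<noteq> 0 \<Longrightarrow>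
      S \<in> carrier_mat m m \<Longrightarrow> det S \<noteq> 0 \<Longrightarrow> P S \<Longrightarrow> P (elem_mat m v r * S)"
  shows "P S"
proof -
  have "P S" if "S \<in> carrier_mat m m" "det S \<noteq> 0" "\<And>j. j < r \<Longrightarrow> col S j = unit_vec m j" "r \<le> m" for r S
    using that(4,1-3)
  proof (induction r arbitrary: S rule: inc_induct)
    case base
    have "S = 1\<^sub>m m" by (rule mat_eq_by_cols[OF base(1)]) (use base in auto)
    then show ?case using one by simp
  next
    case (step r)
    \<comment> \<open>With a nonzero pivot, column \<open>r\<close> of \<open>S\<close> itself is
      the column to insert: the inverse of \<open>?E\<close> sends it to a unit vector and fixes the
      earlier unit vectors.\<close>
    have main: "P S" if S: "S \<in> carrier_mat m m" "det S \<noteq> 0" "\<And>j. j < r \<Longrightarrow> col S j = unit_vec m j"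
      and nz: "col S r $ r \<noteq> 0" for S
    proof -
      let ?s = "col S r" and ?E = "elem_mat m (col S r) r"
      have s: "?s \<in> carrier_vec m" using S by auto
      have dE: "det ?E = ?s $ r" by (rule det_elem_mat) (use s step in auto)
      obtain B where B: "B \<in> carrier_mat m m" "B * ?E = 1\<^sub>m m" "?E * B = 1\<^sub>m m" "det B * det ?E = 1"
        by (rule inverse_mat_exists[of ?E m]) (use dE nz in auto)
      have BS: "B * S \<in> carrier_mat m m" using B S by simp
      have "det (B * S) \<noteq> 0" using det_mult[OF B(1) S(1)] S(2) B(4) by auto
      moreover have "col (B * S) j = unit_vec m j" if "j < Suc r" for j
      proof -
        have j: "j < m" using that step by simp
        have "col (B * S) j = B *\<^sub>v col S j" using B S j by (simp)
        also have "col S j = ?E *\<^sub>v unit_vec m j"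
          using elem_mat_unit[OF s _ j, of r] S(3)[of j] that step(2) by (cases "j = r") auto
        also have "B *\<^sub>v (?E *\<^sub>v unit_vec m j) = (B * ?E) *\<^sub>v unit_vec m j"
          using B by (subst assoc_mult_mat_vec[of _ m m _ m]) auto
        finally show ?thesis using B j by simp
      qed
      ultimately have "P (B * S)" using step.IH[OF BS] by blast
      hence "P (?E * (B * S))"
        using elem[of r ?s "B * S"] s nz BS \<open>det (B * S) \<noteq> 0\<close> step(2) by blast
      moreover have "?E * (B * S) = S"
        using assoc_mult_mat[of ?E m m B m S m] B S by simp
      ultimately show ?thesis by simp
    qed
    show ?case
    proof (cases "col S r $ r = 0")
      case False then show ?thesis using main step.prems by blast
    next
      case True
      let ?s = "col S r"
      have s: "?s \<in> carrier_vec m" using step.prems by auto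
      \<comment> \<open>Otherwise column \<open>r\<close> would be a combination of the earlier
        columns, which are unit vectors, and \<open>?x\<close> would be a kernel vector.\<close>
      have "\<exists>i>r. i < m \<and> ?s $ i \<noteq> 0"
      proof (rule ccontr)
        assume "\<not> ?thesis"
        hence z: "?s $ i = 0" if "i \<ge> r" "i < m" for i using that True by (cases "i = r") auto
        let ?x = "vec m (\<lambda>j. if j < r then ?s $ j else if j = r then -1 else 0)"
        have "S *\<^sub>v ?x = 0\<^sub>v m"
        proof (rule eq_vecI)
          fix i assume "i < dim_vec (0\<^sub>v m)" hence i: "i < m" by simp
          have "(S *\<^sub>v ?x) $ i = (\<Sum>j\<in>{0..<m}. S $$ (i,j) * (if j < r then ?s $ j else if j = r then -1 else 0))"
            using i step.prems by (auto simp: scalar_prod_def intro!: sum.cong)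
          also have "\<dots> = (\<Sum>j\<in>{0..<m}. (if i = j then (if j < r then ?s $ j else 0) else 0) + (if j = r then - ?s $ i else 0))"
          proof (rule sum.cong)
            fix j assume j: "j \<in> {0..<m}"
            show "S $$ (i,j) * (if j < r then ?s $ j else if j = r then -1 else 0) = (if i = j then (if j < r then ?s $ j else 0) else 0) + (if j = r then - ?s $ i else 0)"
            proof (cases "j < r")
              case True
              have "S $$ (i,j) = col S j $ i" using i j step.prems by auto
              also have "col S j = unit_vec m j" using step.prems True by auto
              finally show ?thesis using True i j by auto
            next
              case False then show ?thesis using i j step.prems by auto
            qed
          qed auto
          also have "\<dots> = (if i < r then ?s $ i else 0) - ?s $ i"
            using i step(2) by (simp add: sum.distrib)
          also have "\<dots> = 0" using z[of i] i by auto
          finally show "(S *\<^sub>v ?x) $ i = 0\<^sub>v m $ i" using i by simp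
        qed (use step.prems in auto)
        moreover have "?x \<noteq> 0\<^sub>v m"
        proof
          assume "?x = 0\<^sub>v m"
          hence "?x $ r = 0\<^sub>v m $ r" by simp
          thus False using step(2) by simp
        qed
        ultimately have "det S = 0"
          using det_0_iff_vec_prod_zero_field[OF step.prems(1)] vec_carrier by blast
        thus False using step.prems by simp
      qed
      then obtain i where i: "i > r" "i < m" "?s $ i \<noteq> 0" by auto
      \<comment> \<open>\<open>?E\<close> adds row \<open>i\<close> to row \<open>r\<close> and so
        creates a nonzero pivot; \<open>?F\<close> is its inverse and again an elementary factor.
        This shear takes the place of an exchange of rows.\<close>
      let ?u = "unit_vec m i + unit_vec m r :: real vec" and ?w = "unit_vec m i - unit_vec m r :: real vec"
      let ?E = "elem_mat m ?u i" and ?F = "elem_mat m ?w i"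
      have uw: "?u \<in> carrier_vec m" "?w \<in> carrier_vec m" by auto
      have r: "r < m" using step by simp
      have ES: "?E * S \<in> carrier_mat m m" by (rule mult_carrier_mat[OF elem_mat_carrier step.prems(1)])
      have dE: "det ?E = 1" using det_elem_mat[OF uw(1) i(2)] i r by simp
      have colE: "col (?E * S) j = ?E *\<^sub>v col S j" if "j < m" for j
        by (rule col_mult2[OF elem_mat_carrier step.prems(1) that])
      have "P (?E * S)"
      proof (rule main[OF ES])
        show "det (?E * S) \<noteq> 0" using det_mult[of ?E m S] dE step.prems by simp
        show "col (?E * S) j = unit_vec m j" if "j < r" for j
          using colE[of j] that r i step.prems(3)[of j] elem_mat_unit[OF uw(1) i(2), of j] by auto
        have "col (?E * S) r $ r = (?E *\<^sub>v ?s) $ r" using colE[OF r] by simp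
        also have "\<dots> = ?s $ r + ?s $ i" 
          using elem_mat_mult_vec[OF uw(1) s i(2)] r i by simp
        finally show "col (?E * S) r $ r \<noteq> 0" using i True by simp
      qed
      hence "P (?F * (?E * S))"
        using elem[of i ?w "?E * S"] i r ES det_mult[of ?E m S] dE step.prems by auto
      moreover have "?F * (?E * S) = S"
      proof -
        have "?F * ?E = 1\<^sub>m m"
        proof (rule mat_eq_by_cols[of _ m m])
          fix j assume j: "j < m"
          have "col (?F * ?E) j = ?F *\<^sub>v (?E *\<^sub>v unit_vec m j)"
            unfolding mult_unit_vec_col[OF elem_mat_carrier j]
            by (rule col_mult2[OF elem_mat_carrier elem_mat_carrier j])
          also have "\<dots> = unit_vec m j"
            using j i r elem_mat_unit[OF uw(1) i(2) j]
            by (subst elem_mat_mult_vec[OF uw(2) _ i(2)]) (auto intro!: eq_vecI)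
          finally show "col (?F * ?E) j = col (1\<^sub>m m) j" using j by simp
        qed (auto intro!: mult_carrier_mat[of _ m m])
        thus ?thesis using assoc_mult_mat[of ?F m m ?E m S m] step.prems by simp
      qed
      ultimately show ?thesis by simp
    qed
  qed
  from this[of S 0] assms show ?thesis by auto
qed

section \<open>Linear changes of variables for translation-invariant homogeneous measures\<close>

locale vector_measure =
  fixes N :: "'v::real_vector measure" and d :: nat
  assumes sigma_finite_N: "sigma_finite_measure N"
    and zero_space: "0 \<in> space N"
    and add_measurable: "(\<lambda>p. fst p + snd p) \<in> N \<Otimes>\<^sub>M N \<rightarrow>\<^sub>M N"
    and scaleR_measurable: "(\<lambda>x. r *\<^sub>R x) \<in> N \<rightarrow>\<^sub>M N"
    and shift: "a \<in> space N \<Longrightarrow> g \<in> borel_measurable N \<Longrightarrow> (\<integral>\<^sup>+ x. g (x + a) \<partial>N) = (\<integral>\<^sup>+ x. g x \<partial>N)"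
    and scale: "r \<noteq> 0 \<Longrightarrow> g \<in> borel_measurable N \<Longrightarrow>
      (\<integral>\<^sup>+ x. g (r *\<^sub>R x) \<partial>N) = ennreal (1 / \<bar>r\<bar> ^ d) * (\<integral>\<^sup>+ x. g x \<partial>N)"
begin

lemma add_measurable' [measurable (raw)]:
  "f \<in> M \<rightarrow>\<^sub>M N \<Longrightarrow> g \<in> M \<rightarrow>\<^sub>M N \<Longrightarrow> (\<lambda>x. f x + g x) \<in> M \<rightarrow>\<^sub>M N"
  using measurable_compose[OF measurable_Pair add_measurable, of f M g] by simp

lemma scaleR_measurable' [measurable (raw)]:
  "f \<in> M \<rightarrow>\<^sub>M N \<Longrightarrow> (\<lambda>x. r *\<^sub>R f x) \<in> M \<rightarrow>\<^sub>M N"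
  using measurable_compose[OF _ scaleR_measurable, of f M r] by simp

lemma sum_measurable' [measurable (raw)]:
  "(\<And>i. i \<in> I \<Longrightarrow> f i \<in> M \<rightarrow>\<^sub>M N) \<Longrightarrow> (\<lambda>x. \<Sum>i\<in>I. f i x) \<in> M \<rightarrow>\<^sub>M N"
  by (induction I rule: infinite_finite_induct) (auto simp: zero_space)

lemma product_sigma_finite: "product_sigma_finite (\<lambda>_. N)"
  using sigma_finite_N by (simp add: product_sigma_finite_def)

text \<open>The row of vectors \<open>Y\<close> times the matrix \<open>S\<close>. The entries of
  \<open>Y\<close> lie in an arbitrary vector space, so that the same formula serves for rows of
  real numbers and for the columns of an n x m matrix.\<close>

definition right_mult :: "nat \<Rightarrow> real mat \<Rightarrow> (nat \<Rightarrow> 'v) \<Rightarrow> nat \<Rightarrow> 'v" where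
  "right_mult m S Y = (\<lambda>j\<in>{..<m}. \<Sum>i<m. S $$ (i,j) *\<^sub>R Y i)"

lemma right_mult_measurable [measurable]: "right_mult m S \<in> Pi\<^sub>M {..<m} (\<lambda>_. N) \<rightarrow>\<^sub>M Pi\<^sub>M {..<m} (\<lambda>_. N)"
  unfolding right_mult_def by measurable

lemma right_mult_mult:
  assumes "S \<in> carrier_mat m m" "T \<in> carrier_mat m m"
  shows "right_mult m (S * T) Y = right_mult m T (right_mult m S Y)"
proof (rule ext)
  fix j show "right_mult m (S * T) Y j = right_mult m T (right_mult m S Y) j"
  proof (cases "j < m")
    case True
    have "right_mult m (S * T) Y j = (\<Sum>i<m. (\<Sum>l<m. S $$ (i,l) * T $$ (l,j)) *\<^sub>R Y i)"
      using True assms by (auto simp: right_mult_def scalar_prod_def atLeast0LessThan intro!: sum.cong)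
    also have "\<dots> = (\<Sum>l<m. \<Sum>i<m. (S $$ (i,l) * T $$ (l,j)) *\<^sub>R Y i)"
      by (subst sum.swap) (simp add: scaleR_sum_left)
    also have "\<dots> = right_mult m T (right_mult m S Y) j"
      using True by (auto simp: right_mult_def scaleR_sum_right mult.commute intro!: sum.cong)
    finally show ?thesis .
  qed (simp add: right_mult_def)
qed

lemma right_mult_elem_mat:
  assumes "v \<in> carrier_vec m" "r < m" "Y \<in> extensional {..<m}"
  shows "right_mult m (elem_mat m v r) Y = Y(r := \<Sum>i<m. v $ i *\<^sub>R Y i)"
proof (rule ext)
  fix j
  have *: "(\<Sum>i<m. (if i = j then 1 else 0 :: real) *\<^sub>R Y i) = Y j" if "j < m"
    using that by (simp add: if_distrib[of "\<lambda>c. c *\<^sub>R _"] cong: if_cong)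
  show "right_mult m (elem_mat m v r) Y j = (Y(r := \<Sum>i<m. v $ i *\<^sub>R Y i)) j"
    using assms * by (auto simp: right_mult_def replace_col_def extensional_def cong: sum.cong_simp)
qed

text \<open>Only component \<open>r\<close> changes. Fubini isolates it, and with the other
  components fixed it undergoes \<open>v $ r *\<^sub>R y + a\<close>, to which \<open>scale\<close>
  and \<open>shift\<close> apply.\<close>

lemma nn_integral_right_mult_elem:
  assumes "v \<in> carrier_vec m" "r < m" "v $ r \<noteq> 0"
    and g [measurable]: "g \<in> borel_measurable (Pi\<^sub>M {..<m} (\<lambda>_. N))"
  shows "(\<integral>\<^sup>+ Y. g (right_mult m (elem_mat m v r) Y) \<partial>Pi\<^sub>M {..<m} (\<lambda>_. N)) =
    ennreal (1 / \<bar>v $ r\<bar> ^ d) * (\<integral>\<^sup>+ Y. g Y \<partial>Pi\<^sub>M {..<m} (\<lambda>_. N))"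
proof -
  interpret product_sigma_finite "\<lambda>_. N" by (rule product_sigma_finite)
  define I where "I = {..<m} - {r}"
  have I: "{..<m} = insert r I" "finite I" "r \<notin> I" using assms by (auto simp: I_def)
  have gI [measurable]: "g \<in> borel_measurable (Pi\<^sub>M (insert r I) (\<lambda>_. N))" using g I by simp
  have gu: "(\<lambda>p. g ((fst p)(r := snd p))) \<in> borel_measurable (Pi\<^sub>M I (\<lambda>_. N) \<Otimes>\<^sub>M N)"
    using measurable_compose[OF measurable_add_dim gI] by (simp add: case_prod_beta')
  have gx: "(\<lambda>y. g (x(r := y))) \<in> borel_measurable N" if "x \<in> space (Pi\<^sub>M I (\<lambda>_. N))" for x
    by (rule measurable_compose[OF measurable_component_update[OF that I(3)] gI])
  let ?E = "elem_mat m v r"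
  have "(\<integral>\<^sup>+ Y. g (right_mult m ?E Y) \<partial>Pi\<^sub>M {..<m} (\<lambda>_. N)) =
     (\<integral>\<^sup>+ x. \<integral>\<^sup>+ y. g (right_mult m ?E (x(r := y))) \<partial>N \<partial>Pi\<^sub>M I (\<lambda>_. N))"
    unfolding I(1) by (rule product_nn_integral_insert[OF I(2,3)])
      (use measurable_compose[OF right_mult_measurable[of m ?E] g] in \<open>simp only: I(1)\<close>)
  also have "\<dots> = (\<integral>\<^sup>+ x. ennreal (1 / \<bar>v $ r\<bar> ^ d) * (\<integral>\<^sup>+ y. g (x(r := y)) \<partial>N) \<partial>Pi\<^sub>M I (\<lambda>_. N))"
  proof (rule nn_integral_cong)
    fix x assume x: "x \<in> space (Pi\<^sub>M I (\<lambda>_. N))"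
    define a where "a = (\<Sum>i\<in>I. v $ i *\<^sub>R x i)"
    have xs: "x i \<in> space N" if "i \<in> I" for i using x that by (auto simp: space_PiM)
    have a: "a \<in> space N"
      using measurable_space[of "\<lambda>x. \<Sum>i\<in>I. v $ i *\<^sub>R x i" "Pi\<^sub>M I (\<lambda>_. N)" N x] x by (simp add: a_def)
    have "right_mult m ?E (x(r := y)) = x(r := v $ r *\<^sub>R y + a)" for y
    proof -
      have "x(r := y) \<in> extensional {..<m}" using x assms(2) unfolding space_PiM PiE_def extensional_def I_def by auto
      moreover have "(\<Sum>i<m. v $ i *\<^sub>R (x(r := y)) i) = v $ r *\<^sub>R (x(r := y)) r + (\<Sum>i\<in>I. v $ i *\<^sub>R (x(r := y)) i)"
        unfolding I(1) by (rule sum.insert[OF I(2,3)])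
      moreover have "(\<Sum>i\<in>I. v $ i *\<^sub>R (x(r := y)) i) = a"
        unfolding a_def by (rule sum.cong) (use I(3) in auto)
      ultimately show ?thesis using assms by (simp add: right_mult_elem_mat)
    qed
    hence "(\<integral>\<^sup>+ y. g (right_mult m ?E (x(r := y))) \<partial>N) = (\<integral>\<^sup>+ y. g (x(r := v $ r *\<^sub>R y + a)) \<partial>N)" by simp
    also have "\<dots> = ennreal (1 / \<bar>v $ r\<bar> ^ d) * (\<integral>\<^sup>+ y. g (x(r := y + a)) \<partial>N)"
      by (intro scale[of _ "\<lambda>y. g (x(r := y + a))"] assms measurable_compose[OF _ gx[OF x]])
         (use a in measurable)
    also have "(\<integral>\<^sup>+ y. g (x(r := y + a)) \<partial>N) = (\<integral>\<^sup>+ y. g (x(r := y)) \<partial>N)"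
      using x by (intro shift[of a "\<lambda>y. g (x(r := y))"] a) (measurable, simp add: I)
    finally show "(\<integral>\<^sup>+ y. g (right_mult m ?E (x(r := y))) \<partial>N) =
       ennreal (1 / \<bar>v $ r\<bar> ^ d) * (\<integral>\<^sup>+ y. g (x(r := y)) \<partial>N)" .
  qed
  also have "\<dots> = ennreal (1 / \<bar>v $ r\<bar> ^ d) * (\<integral>\<^sup>+ x. (\<integral>\<^sup>+ y. g (x(r := y)) \<partial>N) \<partial>Pi\<^sub>M I (\<lambda>_. N))"
    by (rule nn_integral_cmult) (use sigma_finite_measure.borel_measurable_nn_integral_fst[OF sigma_finite_N gu] in simp)
  also have "(\<integral>\<^sup>+ x. (\<integral>\<^sup>+ y. g (x(r := y)) \<partial>N) \<partial>Pi\<^sub>M I (\<lambda>_. N)) = (\<integral>\<^sup>+ Y. g Y \<partial>Pi\<^sub>M {..<m} (\<lambda>_. N))"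
    unfolding I(1) by (rule product_nn_integral_insert[OF I(2,3) gI, symmetric])
  finally show ?thesis .
qed

text \<open>Both sides are multiplicative in \<open>S\<close>, so elementary factors suffice. For
  columns in R^n one has \<open>d = n\<close>: the matrix acts on each of the n rows separately,
  hence the n-th power of the determinant.\<close>

theorem nn_integral_right_mult:
  assumes "S \<in> carrier_mat m m" "det S \<noteq> 0"
    and "g \<in> borel_measurable (Pi\<^sub>M {..<m} (\<lambda>_. N))"
  shows "(\<integral>\<^sup>+ Y. g (right_mult m S Y) \<partial>Pi\<^sub>M {..<m} (\<lambda>_. N)) =
    ennreal (1 / \<bar>det S\<bar> ^ d) * (\<integral>\<^sup>+ Y. g Y \<partial>Pi\<^sub>M {..<m} (\<lambda>_. N))"
  using assms
proof (induction S arbitrary: g rule: invertible_mat_induct)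
  case one
  have "right_mult m (1\<^sub>m m) Y = Y" if "Y \<in> space (Pi\<^sub>M {..<m} (\<lambda>_. N))" for Y
    using that by (auto simp: right_mult_def space_PiM PiE_def extensional_def if_distrib[of "\<lambda>c. c *\<^sub>R _"] fun_eq_iff
       cong: if_cong sum.cong_simp)
  then show ?case by (simp cong: nn_integral_cong)
next
  case (elem r v S)
  note [measurable] = elem.prems
  have "(\<integral>\<^sup>+ Y. g (right_mult m (elem_mat m v r * S) Y) \<partial>Pi\<^sub>M {..<m} (\<lambda>_. N)) =
     (\<integral>\<^sup>+ Y. g (right_mult m S (right_mult m (elem_mat m v r) Y)) \<partial>Pi\<^sub>M {..<m} (\<lambda>_. N))"
    using elem by (simp add: right_mult_mult)
  also have "\<dots> = ennreal (1 / \<bar>v $ r\<bar> ^ d) * (\<integral>\<^sup>+ Y. g (right_mult m S Y) \<partial>Pi\<^sub>M {..<m} (\<lambda>_. N))"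
    by (rule nn_integral_right_mult_elem) (use elem in auto)
  also have "\<dots> = ennreal (1 / \<bar>v $ r\<bar> ^ d) * (ennreal (1 / \<bar>det S\<bar> ^ d) * (\<integral>\<^sup>+ Y. g Y \<partial>Pi\<^sub>M {..<m} (\<lambda>_. N)))"
    using elem by simp
  also have "\<dots> = ennreal (1 / \<bar>det (elem_mat m v r * S)\<bar> ^ d) * (\<integral>\<^sup>+ Y. g Y \<partial>Pi\<^sub>M {..<m} (\<lambda>_. N))"
    using elem by (simp add: det_mult[of _ m] det_elem_mat abs_mult power_mult_distrib
        mult.assoc[symmetric] ennreal_mult[symmetric])
  finally show ?case .
qed

end

text \<open>Fubini in one component at a time. It lifts translations, dilations and linear maps from
  one factor to the product.\<close>

lemma nn_integral_PiM_componentwise: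
  fixes N :: "'b measure" and c :: "'a \<Rightarrow> ennreal"
  assumes "sigma_finite_measure N" "finite I"
    and "\<And>i. i \<in> I \<Longrightarrow> T i \<in> N \<rightarrow>\<^sub>M N"
    and "\<And>i g. i \<in> I \<Longrightarrow> g \<in> borel_measurable N \<Longrightarrow> (\<integral>\<^sup>+ x. g (T i x) \<partial>N) = c i * (\<integral>\<^sup>+ x. g x \<partial>N)"
    and "G \<in> borel_measurable (Pi\<^sub>M I (\<lambda>_. N))"
  shows "(\<integral>\<^sup>+ x. G (\<lambda>i\<in>I. T i (x i)) \<partial>Pi\<^sub>M I (\<lambda>_. N)) = (\<Prod>i\<in>I. c i) * (\<integral>\<^sup>+ x. G x \<partial>Pi\<^sub>M I (\<lambda>_. N))"
  using assms(2-5)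
proof (induction I arbitrary: G rule: finite_induct)
  case empty
  show ?case by (simp add: PiM_empty restrict_def nn_integral_count_space_finite)
next
  case (insert i I)
  interpret product_sigma_finite "\<lambda>_. N" by (simp add: product_sigma_finite_def assms(1))
  define P where "P J = Pi\<^sub>M J (\<lambda>_. N)" for J :: "'a set"
  note TG = insert.prems(1)
  have Tm: "(\<lambda>x. \<lambda>j\<in>J. T j (x j)) \<in> P J \<rightarrow>\<^sub>M P J" if "J \<subseteq> insert i I" for J
    unfolding P_def using that
    by (intro measurable_restrict measurable_compose[OF measurable_component_singleton]) (auto intro: TG)
  have Gu: "(\<lambda>p. G ((fst p)(i := snd p))) \<in> borel_measurable (P I \<Otimes>\<^sub>M N)"
    using measurable_compose[where g = G and f = "\<lambda>p. (fst p)(i := snd p)" and M = "P I \<Otimes>\<^sub>M N", OF _ insert.prems(3)]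
      measurable_add_dim[of i I "\<lambda>_. N"] by (simp only: P_def case_prod_beta')
  have Gx: "(\<lambda>y. G (x(i := y))) \<in> borel_measurable N" if "x \<in> space (P I)" for x
    by (rule measurable_compose[where g = G, OF measurable_component_update[OF that[unfolded P_def] insert.hyps(2)] insert.prems(3)])
  have "(\<integral>\<^sup>+ x. G (\<lambda>j\<in>insert i I. T j (x j)) \<partial>P (insert i I)) =
     (\<integral>\<^sup>+ x. \<integral>\<^sup>+ y. G (\<lambda>j\<in>insert i I. T j ((x(i := y)) j)) \<partial>N \<partial>P I)"
    unfolding P_def
    by (rule product_nn_integral_insert[OF insert.hyps])
       (rule measurable_compose[where g = G, OF Tm[unfolded P_def, OF order_refl] insert.prems(3)])
  also have "\<dots> = (\<integral>\<^sup>+ x. c i * (\<integral>\<^sup>+ y. G ((\<lambda>j\<in>I. T j (x j))(i := y)) \<partial>N) \<partial>P I)"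
  proof (rule nn_integral_cong)
    fix x assume x: "x \<in> space (P I)"
    have eq: "(\<lambda>j\<in>insert i I. T j ((x(i := y)) j)) = (\<lambda>j\<in>I. T j (x j))(i := T i y)" for y
      using insert.hyps(2) by (auto simp: restrict_def fun_eq_iff)
    have "(\<lambda>j\<in>I. T j (x j)) \<in> space (P I)"
      using measurable_space[OF Tm x] by auto
    from insert.prems(2)[of i, OF _ Gx[OF this]]
    show "(\<integral>\<^sup>+ y. G (\<lambda>j\<in>insert i I. T j ((x(i := y)) j)) \<partial>N) =
      c i * (\<integral>\<^sup>+ y. G ((\<lambda>j\<in>I. T j (x j))(i := y)) \<partial>N)" unfolding eq by simp
  qed
  also have "\<dots> = c i * (\<integral>\<^sup>+ x. (\<integral>\<^sup>+ y. G ((\<lambda>j\<in>I. T j (x j))(i := y)) \<partial>N) \<partial>P I)"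
  proof (rule nn_integral_cmult)
    show "(\<lambda>x. \<integral>\<^sup>+ y. G ((\<lambda>j\<in>I. T j (x j))(i := y)) \<partial>N) \<in> borel_measurable (P I)"
      using measurable_compose[OF Tm sigma_finite_measure.borel_measurable_nn_integral_fst[OF assms(1) Gu]]
      by auto
  qed
  also have "(\<integral>\<^sup>+ x. (\<integral>\<^sup>+ y. G ((\<lambda>j\<in>I. T j (x j))(i := y)) \<partial>N) \<partial>P I) =
     (\<Prod>i\<in>I. c i) * (\<integral>\<^sup>+ x. (\<integral>\<^sup>+ y. G (x(i := y)) \<partial>N) \<partial>P I)"
    unfolding P_def
    by (rule insert.IH[of "\<lambda>x. \<integral>\<^sup>+ y. G (x(i := y)) \<partial>N"])
       (use insert.prems sigma_finite_measure.borel_measurable_nn_integral_fst[OF assms(1) Gu[unfolded P_def]] in auto)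
  also have "(\<integral>\<^sup>+ x. (\<integral>\<^sup>+ y. G (x(i := y)) \<partial>N) \<partial>P I) = (\<integral>\<^sup>+ x. G x \<partial>P (insert i I))"
    unfolding P_def by (rule product_nn_integral_insert[symmetric, OF insert.hyps insert.prems(3)])
  finally show ?case using insert.hyps by (simp add: P_def mult.assoc)
qed

section \<open>Lebesgue measure on zero-padded sequences\<close>

abbreviation leb :: "nat \<Rightarrow> (nat \<Rightarrow> real) measure" where "leb \<equiv> lebesgue_Rn"

definition pad :: "nat \<Rightarrow> (nat \<Rightarrow> real) \<Rightarrow> nat \<Rightarrow> real" where
  "pad n x = (\<lambda>i. if i < n then x i else 0)"

abbreviation Lb :: "nat \<Rightarrow> (nat \<Rightarrow> real) measure" where "Lb n \<equiv> Pi\<^sub>M {..<n} (\<lambda>_. lborel)"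

lemma space_leb [simp]: "space (leb n) = Rn n"
  by (simp add: lebesgue_Rn_def space_restrict_space)

lemma sets_leb: "sets (leb n) = sets (restrict_space borel (Rn n))"
  by (simp add: lebesgue_Rn_def)

lemma measurable_into_leb:
  assumes "\<And>x. x \<in> space M \<Longrightarrow> f x \<in> Rn n" "\<And>i. i < n \<Longrightarrow> (\<lambda>x. f x i) \<in> borel_measurable M"
  shows "f \<in> M \<rightarrow>\<^sub>M leb n"
proof -
  have "(\<lambda>x. f x i) \<in> borel_measurable M" for i
  proof (cases "i < n")
    case False
    hence "f x i = 0" if "x \<in> space M" for x using assms(1)[OF that] by (auto simp: Rn_def)
    thus ?thesis by (simp cong: measurable_cong)
  qed (use assms in auto)
  hence "f \<in> borel_measurable M" by (rule measurable_coordinatewise_then_product)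
  hence "f \<in> M \<rightarrow>\<^sub>M restrict_space borel (Rn n)"
    using assms(1) by (intro measurable_restrict_space2) auto
  thus ?thesis by (simp cong: measurable_cong_sets[OF refl sets_leb])
qed

lemma leb_coord_measurable:
  assumes "f \<in> M \<rightarrow>\<^sub>M leb n"
  shows "(\<lambda>x. f x i) \<in> borel_measurable M"
proof -
  have "(\<lambda>y::nat\<Rightarrow>real. y i) \<in> borel_measurable (restrict_space borel (Rn n))"
    by (rule measurable_restrict_space1) measurable
  hence "(\<lambda>y::nat\<Rightarrow>real. y i) \<in> borel_measurable (leb n)"
    using measurable_cong_sets[OF sets_leb refl] by blast
  from measurable_compose[OF assms this] show ?thesis .
qed

lemma leb_coord_measurable' [measurable_dest]:
  "f \<in> N \<rightarrow>\<^sub>M leb n \<Longrightarrow> g \<in> L \<rightarrow>\<^sub>M N \<Longrightarrow> (\<lambda>x. f (g x) i) \<in> borel_measurable L"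
  by (rule measurable_compose[OF _ leb_coord_measurable])

lemma leb_coord_measurable_id [measurable]: "(\<lambda>x. x i) \<in> borel_measurable (leb n)"
  by (rule leb_coord_measurable[of _ _ n]) simp

lemma pad_measurable [measurable]: "pad n \<in> Lb n \<rightarrow>\<^sub>M leb n"
proof (rule measurable_into_leb)
  fix i assume "i < n"
  hence "(\<lambda>x. x i) \<in> Lb n \<rightarrow>\<^sub>M lborel" by (intro measurable_component_singleton) auto
  thus "(\<lambda>x. pad n x i) \<in> borel_measurable (Lb n)" using \<open>i < n\<close> by (simp add: pad_def)
qed (simp add: pad_def Rn_def)

lemma leb_eq_distr: "leb n = distr (Lb n) (leb n) (pad n)"
  unfolding lebesgue_Rn_def pad_def[abs_def] by (rule distr_cong) auto

lemma nn_integral_leb: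
  assumes "g \<in> borel_measurable (leb n)"
  shows "(\<integral>\<^sup>+ x. g x \<partial>leb n) = (\<integral>\<^sup>+ x. g (pad n x) \<partial>Lb n)"
  by (subst leb_eq_distr, rule nn_integral_distr) (use assms in auto)

interpretation lborel_prod: product_sigma_finite "\<lambda>_::nat. lborel :: real measure"
  by standard

lemma sigma_finite_leb: "sigma_finite_measure (leb n)"
proof
  let ?A = "\<lambda>r::nat. {x \<in> space (leb n). \<forall>i<n. \<bar>x i\<bar> \<le> real r}"
  have m: "?A r \<in> sets (leb n)" for r by measurable
  have fin: "emeasure (leb n) (?A r) < \<infinity>" for r
  proof -
    have "emeasure (leb n) (?A r) = (\<integral>\<^sup>+ x. indicator (?A r) x \<partial>leb n)"
      by (rule nn_integral_indicator[OF m, symmetric])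
    also have "\<dots> = (\<integral>\<^sup>+ x. indicator (?A r) (pad n x) \<partial>Lb n)"
      by (rule nn_integral_leb[OF borel_measurable_indicator[OF m]])
    also have "\<dots> = (\<integral>\<^sup>+ x. (\<Prod>i\<in>{..<n}. indicator {- real r..real r} (x i)) \<partial>Lb n)"
    proof (rule nn_integral_cong)
      fix x assume "x \<in> space (Lb n)"
      show "indicator (?A r) (pad n x) = (\<Prod>i\<in>{..<n}. indicator {- real r..real r} (x i) :: ennreal)"
      proof (cases "\<forall>i<n. \<bar>x i\<bar> \<le> real r")
        case True
        hence "x i \<in> {- real r..real r}" if "i < n" for i using that by (force simp: abs_le_iff)
        moreover have "pad n x \<in> ?A r" using True by (auto simp: pad_def Rn_def)
        ultimately show ?thesis by simp
      next
        case False
        then obtain i where "i < n" "\<not> \<bar>x i\<bar> \<le> real r" by auto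
        hence "(\<Prod>i\<in>{..<n}. indicator {- real r..real r} (x i) :: ennreal) = 0"
          by (intro prod_zero bexI[of _ i]) (auto simp: indicator_def)
        moreover have "pad n x \<notin> ?A r" using False by (auto simp: pad_def)
        ultimately show ?thesis by simp
      qed
    qed
    also have "\<dots> = (\<Prod>i\<in>{..<n}. \<integral>\<^sup>+ x. indicator {- real r..real r} x \<partial>lborel)"
      by (rule lborel_prod.product_nn_integral_prod) auto
    also have "\<dots> < \<infinity>" by (auto simp: ennreal_power ennreal_less_top)
    finally show ?thesis .
  qed
  have "(\<Union>r. ?A r) = space (leb n)"
  proof -
    have "x \<in> (\<Union>r. ?A r)" if "x \<in> Rn n" for x
    proof -
      obtain r :: nat where r: "(\<Sum>i<n. \<bar>x i\<bar>) \<le> real r" using real_arch_simple by blast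
      have "\<bar>x i\<bar> \<le> real r" if "i < n" for i
        using member_le_sum[of i "{..<n}" "\<lambda>i. \<bar>x i\<bar>"] that r by simp
      thus ?thesis using that by auto
    qed
    thus ?thesis by auto
  qed
  moreover have "countable (range ?A)" "range ?A \<subseteq> sets (leb n)" using m by blast+
  moreover have "emeasure (leb n) a \<noteq> \<infinity>" if a: "a \<in> range ?A" for a
  proof -
    obtain r where "a = ?A r" by (rule rangeE[OF a])
    thus ?thesis using less_imp_neq[OF fin[of r]] by simp
  qed
  ultimately show "\<exists>A. countable A \<and> A \<subseteq> sets (leb n) \<and> \<Union>A = space (leb n) \<and> (\<forall>a\<in>A. emeasure (leb n) a \<noteq> \<infinity>)"
    by (intro exI[of _ "range ?A"] conjI ballI) blast+
qed

lemma Rn_simps: "0 \<in> Rn n" "x \<in> Rn n \<Longrightarrow> y \<in> Rn n \<Longrightarrow> x + y \<in> Rn n" "x \<in> Rn n \<Longrightarrow> r *\<^sub>R x \<in> Rn n"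
  "x \<in> Rn n \<Longrightarrow> y \<in> Rn n \<Longrightarrow> x - y \<in> Rn n"
  by (auto simp: Rn_def scaleR_fun_def)

interpretation lborel_vec: vector_measure "lborel :: real measure" 1
proof (rule vector_measure.intro)
  show "sigma_finite_measure (lborel :: real measure)" by (rule sigma_finite_lborel)
  show "(\<integral>\<^sup>+ x. g (x + a) \<partial>lborel) = (\<integral>\<^sup>+ x. g x \<partial>lborel)"
    if "g \<in> borel_measurable lborel" for g :: "real \<Rightarrow> ennreal" and a :: real
    using nn_integral_real_affine[of g 1 a] that by (simp add: add.commute)
  show "(\<integral>\<^sup>+ x. g (r *\<^sub>R x) \<partial>lborel) = ennreal (1 / \<bar>r\<bar> ^ 1) * (\<integral>\<^sup>+ x. g x \<partial>lborel)"
    if "r \<noteq> 0" "g \<in> borel_measurable lborel" for g :: "real \<Rightarrow> ennreal" and r :: real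
    using nn_integral_real_affine[of g r 0] that
    by (simp add: mult.assoc[symmetric] ennreal_mult[symmetric])
qed auto

interpretation leb: vector_measure "leb n" n for n
proof (rule vector_measure.intro)
  show "sigma_finite_measure (leb n)" by (rule sigma_finite_leb)
  show "0 \<in> space (leb n)" by (simp add: Rn_simps)
  show "(\<lambda>p. fst p + snd p) \<in> leb n \<Otimes>\<^sub>M leb n \<rightarrow>\<^sub>M leb n"
    by (rule measurable_into_leb) (auto simp: space_pair_measure Rn_simps)
  show sc: "(\<lambda>x. r *\<^sub>R x) \<in> leb n \<rightarrow>\<^sub>M leb n" for r
    by (rule measurable_into_leb) (auto simp: Rn_simps, simp add: scaleR_fun_def)
  show "(\<integral>\<^sup>+ x. g (x + a) \<partial>leb n) = (\<integral>\<^sup>+ x. g x \<partial>leb n)"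
    if a: "a \<in> space (leb n)" and g [measurable]: "g \<in> borel_measurable (leb n)" for g a
  proof -
    have am: "(\<lambda>x. x + a) \<in> leb n \<rightarrow>\<^sub>M leb n"
      by (rule measurable_into_leb) (use a in \<open>auto simp: Rn_simps\<close>)
    have "(\<integral>\<^sup>+ x. g (x + a) \<partial>leb n) = (\<integral>\<^sup>+ x. g (pad n x + a) \<partial>Lb n)"
      using measurable_compose[OF am g] by (rule nn_integral_leb)
    also have "\<dots> = (\<integral>\<^sup>+ x. g (pad n (\<lambda>i\<in>{..<n}. x i + a i)) \<partial>Lb n)"
      using a by (intro nn_integral_cong arg_cong[of _ _ g]) (auto simp: pad_def fun_eq_iff Rn_def)
    also have "\<dots> = (\<Prod>i\<in>{..<n}. 1) * (\<integral>\<^sup>+ x. g (pad n x) \<partial>Lb n)"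
      by (rule nn_integral_PiM_componentwise[where T = "\<lambda>i x. x + a i" and G = "\<lambda>x. g (pad n x)"])
         (use lborel_vec.shift in \<open>auto intro: sigma_finite_lborel\<close>)
    also have "\<dots> = (\<integral>\<^sup>+ x. g x \<partial>leb n)" by (simp add: nn_integral_leb g)
    finally show ?thesis .
  qed
  show "(\<integral>\<^sup>+ x. g (r *\<^sub>R x) \<partial>leb n) = ennreal (1 / \<bar>r\<bar> ^ n) * (\<integral>\<^sup>+ x. g x \<partial>leb n)"
    if r: "r \<noteq> 0" and g [measurable]: "g \<in> borel_measurable (leb n)" for g r
  proof -
    have "(\<integral>\<^sup>+ x. g (r *\<^sub>R x) \<partial>leb n) = (\<integral>\<^sup>+ x. g (r *\<^sub>R pad n x) \<partial>Lb n)"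
      using measurable_compose[OF sc g] by (rule nn_integral_leb)
    also have "\<dots> = (\<integral>\<^sup>+ x. g (pad n (\<lambda>i\<in>{..<n}. r *\<^sub>R x i)) \<partial>Lb n)"
      by (intro nn_integral_cong arg_cong[of _ _ g]) (auto simp: pad_def fun_eq_iff scaleR_fun_def)
    also have "\<dots> = (\<Prod>i\<in>{..<n}. ennreal (1 / \<bar>r\<bar>)) * (\<integral>\<^sup>+ x. g (pad n x) \<partial>Lb n)"
      by (rule nn_integral_PiM_componentwise[where T = "\<lambda>i x. r *\<^sub>R x" and G = "\<lambda>x. g (pad n x)"])
         (use lborel_vec.scale[OF r] in \<open>auto intro: sigma_finite_lborel\<close>)
    also have "\<dots> = ennreal (1 / \<bar>r\<bar> ^ n) * (\<integral>\<^sup>+ x. g x \<partial>leb n)"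
      by (simp add: nn_integral_leb g ennreal_power power_one_over)
    finally show ?thesis .
  qed
qed

section \<open>Linear maps and Gaussian integrals on R^n\<close>

definition mat_app :: "nat \<Rightarrow> real mat \<Rightarrow> (nat \<Rightarrow> real) \<Rightarrow> nat \<Rightarrow> real" where
  "mat_app n T x = (\<lambda>i. if i < n then \<Sum>j<n. T $$ (i,j) * x j else 0)"

lemma mat_app_Rn [simp]: "mat_app n T x \<in> Rn n"
  by (simp add: mat_app_def Rn_def)

lemma mat_app_measurable [measurable (raw)]:
  "f \<in> M \<rightarrow>\<^sub>M leb n \<Longrightarrow> (\<lambda>x. mat_app n T (f x)) \<in> M \<rightarrow>\<^sub>M leb n"
  by (rule measurable_into_leb) (simp, simp add: mat_app_def)

text \<open>Applying \<open>T\<close> to a column of coordinates is the same as multiplying the row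
  of coordinates by the transpose from the right; real entries have degree 1, which gives the first
  power of the determinant.\<close>

lemma nn_integral_mat_app:
  assumes T: "T \<in> carrier_mat n n" "det T \<noteq> 0" and g [measurable]: "g \<in> borel_measurable (leb n)"
  shows "(\<integral>\<^sup>+ x. g (mat_app n T x) \<partial>leb n) = ennreal (1 / \<bar>det T\<bar>) * (\<integral>\<^sup>+ x. g x \<partial>leb n)"
proof -
  have "(\<integral>\<^sup>+ x. g (mat_app n T x) \<partial>leb n) = (\<integral>\<^sup>+ x. g (mat_app n T (pad n x)) \<partial>Lb n)"
    by (rule nn_integral_leb) measurable
  also have "\<dots> = (\<integral>\<^sup>+ x. g (pad n (lborel_vec.right_mult n (transpose_mat T) x)) \<partial>Lb n)"
    using T by (intro nn_integral_cong arg_cong[of _ _ g])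
      (auto simp: pad_def mat_app_def fun_eq_iff lborel_vec.right_mult_def intro!: sum.cong)
  also have "\<dots> = ennreal (1 / \<bar>det (transpose_mat T)\<bar> ^ 1) * (\<integral>\<^sup>+ x. g (pad n x) \<partial>Lb n)"
    by (rule lborel_vec.nn_integral_right_mult) (use T Determinant.det_transpose[OF T(1)] in auto)
  finally show ?thesis using T by (simp add: nn_integral_leb Determinant.det_transpose[OF T(1)])
qed

lemma nn_integral_gauss_lborel:
  assumes "a > 0"
  shows "(\<integral>\<^sup>+ x. ennreal (exp (- a * (x * x))) \<partial>lborel) = ennreal (sqrt (pi / a))"
proof -
  define s where "s = 1 / sqrt (2 * a)"
  have s: "s > 0" "s\<^sup>2 = 1 / (2 * a)" using assms by (auto simp: s_def power_divide)
  interpret prob_space "density lborel (normal_density 0 s)" using s by (intro prob_space_normal_density) auto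
  have "exp (- a * (x * x)) = sqrt (pi / a) * normal_density 0 s x" for x
  proof -
    have "2 * pi * s\<^sup>2 = pi / a" "(x - 0)\<^sup>2 / (2 * s\<^sup>2) = a * (x * x)" unfolding s(2) using assms
      by (auto simp: power2_eq_square)
    thus ?thesis using assms by (simp add: normal_density_def)
  qed
  hence "(\<integral>\<^sup>+ x. ennreal (exp (- a * (x * x))) \<partial>lborel) =
     (\<integral>\<^sup>+ x. ennreal (sqrt (pi / a)) * ennreal (normal_density 0 s x) \<partial>lborel)"
    using assms by (simp add: ennreal_mult)
  also have "\<dots> = ennreal (sqrt (pi / a)) * (\<integral>\<^sup>+ x. ennreal (normal_density 0 s x) \<partial>lborel)"
    by (rule nn_integral_cmult) auto
  also have "(\<integral>\<^sup>+ x. ennreal (normal_density 0 s x) \<partial>lborel) = 1"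
    using emeasure_space_1 by (simp add: emeasure_density)
  finally show ?thesis by simp
qed

lemma ip_measurable [measurable (raw)]:
  "f \<in> M \<rightarrow>\<^sub>M leb n \<Longrightarrow> g \<in> M \<rightarrow>\<^sub>M leb n \<Longrightarrow> (\<lambda>x. ip n (f x) (g x)) \<in> borel_measurable M"
  unfolding ip_def
  by (intro borel_measurable_sum borel_measurable_times leb_coord_measurable[of _ _ n])

lemma nn_integral_gauss_leb:
  assumes "a > 0"
  shows "(\<integral>\<^sup>+ x. ennreal (exp (- a * ip n x x)) \<partial>leb n) = ennreal (sqrt (pi / a) ^ n)"
proof -
  have "(\<integral>\<^sup>+ x. ennreal (exp (- a * ip n x x)) \<partial>leb n) = (\<integral>\<^sup>+ x. ennreal (exp (- a * ip n (pad n x) (pad n x))) \<partial>Lb n)"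
    by (rule nn_integral_leb) measurable
  also have "\<dots> = (\<integral>\<^sup>+ x. (\<Prod>i\<in>{..<n}. ennreal (exp (- a * (x i * x i)))) \<partial>Lb n)"
    by (intro nn_integral_cong)
       (simp add: ip_def pad_def sum_distrib_left exp_sum prod_ennreal flip: sum_negf)
  also have "\<dots> = (\<Prod>i\<in>{..<n}. \<integral>\<^sup>+ x. ennreal (exp (- a * (x * x))) \<partial>lborel)"
    by (rule lborel_prod.product_nn_integral_prod) auto
  finally show ?thesis unfolding nn_integral_gauss_lborel[OF assms] using assms by (simp add: ennreal_power)
qed

section \<open>Orthonormalisation and Hadamard's inequality\<close>

lemma ip_linear:
  "ip n (x + y) z = ip n x z + ip n y z" "ip n z (x + y) = ip n z x + ip n z y"
  "ip n (x - y) z = ip n x z - ip n y z" "ip n z (x - y) = ip n z x - ip n z y"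
  "ip n (c *\<^sub>R x) z = c * ip n x z" "ip n z (c *\<^sub>R x) = c * ip n z x"
  "ip n 0 z = 0" "ip n z 0 = 0"
  by (simp_all add: ip_def scaleR_fun_def sum.distrib sum_subtractf sum_distrib_left algebra_simps)

lemma ip_sum:
  "ip n (\<Sum>i\<in>I. f i) z = (\<Sum>i\<in>I. ip n (f i) z)" "ip n z (\<Sum>i\<in>I. f i) = (\<Sum>i\<in>I. ip n z (f i))"
  by (induction I rule: infinite_finite_induct) (simp_all add: ip_linear)

lemma ip_commute: "ip n x y = ip n y x"
  by (simp add: ip_def mult.commute)

lemma ip_self_nonneg [simp]: "0 \<le> ip n x x"
  by (auto simp: ip_def intro!: sum_nonneg)

lemma ip_self_eq_0_iff:
  assumes "x \<in> Rn n"
  shows "ip n x x = 0 \<longleftrightarrow> x = 0"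
proof
  assume "ip n x x = 0"
  hence *: "x i = 0" if "i < n" for i using that by (simp add: ip_def sum_nonneg_eq_0_iff)
  show "x = 0"
  proof
    fix i show "x i = 0 i" using * assms by (cases "i < n") (auto simp: Rn_def)
  qed
qed (simp add: ip_def)

lemma fun_sum_apply: "(\<Sum>i\<in>I. f i) x = (\<Sum>i\<in>I. f i (x::'b) :: real)"
  by (induction I rule: infinite_finite_induct) auto

lemma Rn_sum: "(\<And>i. i \<in> I \<Longrightarrow> f i \<in> Rn n) \<Longrightarrow> (\<Sum>i\<in>I. f i) \<in> Rn n"
  by (induction I rule: infinite_finite_induct) (auto simp: Rn_simps)

lemma subspace_Rn: "subspace (Rn n)"
  by (auto simp: subspace_def Rn_simps)

section \<open>Orthonormal families and the Gram--Schmidt process\<close>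

definition orthonormal :: "nat \<Rightarrow> nat \<Rightarrow> (nat \<Rightarrow> nat \<Rightarrow> real) \<Rightarrow> bool" where
  "orthonormal n m w \<longleftrightarrow> (\<forall>i<m. w i \<in> Rn n) \<and> (\<forall>i<m. \<forall>j<m. ip n (w i) (w j) = (if i = j then 1 else 0))"

lemma orthonormalD:
  "orthonormal n m w \<Longrightarrow> i < m \<Longrightarrow> w i \<in> Rn n"
  "orthonormal n m w \<Longrightarrow> i < m \<Longrightarrow> j < m \<Longrightarrow> ip n (w i) (w j) = (if i = j then 1 else 0)"
  by (auto simp: orthonormal_def)

lemma orthonormal_coeff:
  assumes "orthonormal n m w" "i < m" "r \<le> m" "i < r \<or> i \<ge> r"
  shows "ip n (\<Sum>j<r. c j *\<^sub>R w j) (w i) = (if i < r then c i else 0)"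
    "ip n (w i) (\<Sum>j<r. c j *\<^sub>R w j) = (if i < r then c i else 0)"
proof -
  have "ip n (\<Sum>j<r. c j *\<^sub>R w j) (w i) = (\<Sum>j<r. c j * ip n (w j) (w i))"
    by (simp add: ip_sum ip_linear)
  also have "\<dots> = (\<Sum>j<r. if j = i then c i else 0)"
    using assms by (intro sum.cong) (auto simp: orthonormalD)
  also have "\<dots> = (if i < r then c i else 0)" by simp
  finally show "ip n (\<Sum>j<r. c j *\<^sub>R w j) (w i) = (if i < r then c i else 0)" .
  thus "ip n (w i) (\<Sum>j<r. c j *\<^sub>R w j) = (if i < r then c i else 0)" by (simp add: ip_commute)
qed

text \<open>A vanishing residual yields the zero vector, since \<open>1 / sqrt 0\<close> is 0; thus
  the process is defined, and later shown to be measurable, on all tuples.\<close>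

fun gs_vec :: "nat \<Rightarrow> (nat \<Rightarrow> nat \<Rightarrow> real) \<Rightarrow> nat \<Rightarrow> nat \<Rightarrow> real" where
  "gs_vec n a i = (let v = a i - (\<Sum>j<i. ip n (a i) (gs_vec n a j) *\<^sub>R gs_vec n a j) in (1 / sqrt (ip n v v)) *\<^sub>R v)"

declare gs_vec.simps [simp del]

definition gs_residual :: "nat \<Rightarrow> (nat \<Rightarrow> nat \<Rightarrow> real) \<Rightarrow> nat \<Rightarrow> nat \<Rightarrow> real" where
  "gs_residual n a i = a i - (\<Sum>j<i. ip n (a i) (gs_vec n a j) *\<^sub>R gs_vec n a j)"

lemma gs_vec_eq: "gs_vec n a i = (1 / sqrt (ip n (gs_residual n a i) (gs_residual n a i))) *\<^sub>R gs_residual n a i"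
  by (subst gs_vec.simps) (simp add: gs_residual_def Let_def)

text \<open>The equality of spans is carried along in the induction because it keeps the next
  residual from vanishing: a zero residual would put \<open>a r\<close> into the span of its
  predecessors.\<close>

lemma gs_vec_properties:
  assumes a: "\<And>i. i < m \<Longrightarrow> a i \<in> Rn n" and ind: "\<And>i. i < m \<Longrightarrow> a i \<notin> span (a ` {..<i})" and "r \<le> m"
  shows "orthonormal n r (gs_vec n a) \<and> span (gs_vec n a ` {..<r}) = span (a ` {..<r}) \<and>
    (\<forall>i<r. ip n (gs_residual n a i) (gs_residual n a i) > 0)"
  using assms(3)
proof (induction r)
  case 0
  then show ?case by (simp add: orthonormal_def)
next
  case (Suc r)
  let ?q = "gs_vec n a" and ?v = "gs_residual n a r"
  from Suc have IH: "orthonormal n r ?q" "span (?q ` {..<r}) = span (a ` {..<r})" 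
    "\<forall>i<r. ip n (gs_residual n a i) (gs_residual n a i) > 0" by auto
  have r: "r < m" using Suc by simp
  have sumspan: "(\<Sum>j<r. ip n (a r) (?q j) *\<^sub>R ?q j) \<in> span (?q ` {..<r})"
    by (intro span_sum span_scale span_base) auto
  have vR: "?v \<in> Rn n" unfolding gs_residual_def
    by (intro Rn_simps Rn_sum a r) (use IH(1) in \<open>auto simp: orthonormalD\<close>)
  have "?v \<noteq> 0"
  proof
    assume "?v = 0"
    hence "a r = (\<Sum>j<r. ip n (a r) (?q j) *\<^sub>R ?q j)" by (simp add: gs_residual_def)
    with sumspan IH(2) ind[OF r] show False by simp
  qed
  hence vpos: "ip n ?v ?v > 0" using ip_self_eq_0_iff[OF vR] ip_self_nonneg[of n ?v] by linarith
  have vq: "ip n ?v (?q i) = 0" if "i < r" for i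
    using that orthonormal_coeff[OF IH(1) that order_refl] by (simp add: gs_residual_def ip_linear)
  let ?c = "1 / sqrt (ip n ?v ?v)"
  have qr: "?q r = ?c *\<^sub>R ?v" by (rule gs_vec_eq)
  have cpos: "?c > 0" using vpos by simp
  have on: "orthonormal n (Suc r) ?q"
  proof -
    have 1: "ip n (?q r) (?q r) = 1" unfolding qr using vpos by (simp add: ip_linear)
    have 2: "ip n (?q r) (?q i) = 0" if "i < r" for i unfolding qr using vq[OF that] by (simp add: ip_linear)
    have 3: "?q r \<in> Rn n" unfolding qr by (rule Rn_simps(3)[OF vR])
    have 4: "ip n (?q i) (?q r) = 0" if "i < r" for i using 2[OF that] by (simp add: ip_commute)
    have "ip n (?q i) (?q j) = (if i = j then 1 else 0)" if "i < Suc r" "j < Suc r" for i j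
      using that orthonormalD(2)[OF IH(1), of i j] 1 2[of j] 4[of i]
      by (cases "i = r"; cases "j = r") auto
    moreover have "?q i \<in> Rn n" if "i < Suc r" for i
      using that orthonormalD(1)[OF IH(1), of i] 3 by (cases "i = r") auto
    ultimately show ?thesis unfolding orthonormal_def by blast
  qed
  have vspan: "?v \<in> span (?q ` {..<Suc r})"
  proof -
    have "?v = sqrt (ip n ?v ?v) *\<^sub>R ?q r" unfolding qr using vpos by simp
    thus ?thesis by (metis lessThan_iff less_Suc_eq imageI span_base span_scale)
  qed
  have mono: "span (?q ` {..<r}) \<subseteq> span (?q ` {..<Suc r})" "span (a ` {..<r}) \<subseteq> span (a ` {..<Suc r})"
    by (intro span_mono; auto)+
  have ar: "a r \<in> span (?q ` {..<Suc r})"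
  proof -
    have "a r = ?v + (\<Sum>j<r. ip n (a r) (?q j) *\<^sub>R ?q j)" by (simp add: gs_residual_def)
    thus ?thesis using span_add[OF vspan subsetD[OF mono(1) sumspan]] by simp
  qed
  have "?v \<in> span (a ` {..<Suc r})" unfolding gs_residual_def
  proof (rule span_diff)
    show "a r \<in> span (a ` {..<Suc r})" by (rule span_base) auto
    show "(\<Sum>j<r. ip n (a r) (?q j) *\<^sub>R ?q j) \<in> span (a ` {..<Suc r})"
      using sumspan IH(2) mono(2) by blast
  qed
  hence q: "?q r \<in> span (a ` {..<Suc r})" unfolding qr by (rule span_scale)
  have "span (?q ` {..<Suc r}) = span (a ` {..<Suc r})"
  proof (rule antisym; rule span_minimal)
    show "?q ` {..<Suc r} \<subseteq> span (a ` {..<Suc r})"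
      using q mono(2) IH(2) by (auto simp: less_Suc_eq intro: span_base)
         (metis imageI lessThan_iff span_base subsetD)
    show "a ` {..<Suc r} \<subseteq> span (?q ` {..<Suc r})"
      using ar mono(1) IH(2) by (auto simp: less_Suc_eq intro: span_base)
         (metis imageI lessThan_iff span_base subsetD)
  qed auto
  then show ?case using on IH(3) vpos by (auto simp: less_Suc_eq)
qed

section \<open>Gram matrices, QR decomposition and Hadamard's inequality\<close>

definition gram_mat :: "nat \<Rightarrow> nat \<Rightarrow> (nat \<Rightarrow> nat \<Rightarrow> real) \<Rightarrow> (nat \<Rightarrow> nat \<Rightarrow> real) \<Rightarrow> real mat" where
  "gram_mat n m v w = mat m m (\<lambda>(i,j). ip n (v i) (w j))"

definition tuple_mat :: "nat \<Rightarrow> (nat \<Rightarrow> nat \<Rightarrow> real) \<Rightarrow> real mat" where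
  "tuple_mat m Z = mat m m (\<lambda>(i,j). Z j i)"

definition tuple_det :: "nat \<Rightarrow> (nat \<Rightarrow> nat \<Rightarrow> real) \<Rightarrow> real" where
  "tuple_det m Z = det (tuple_mat m Z)"

definition unitv :: "nat \<Rightarrow> nat \<Rightarrow> real" where
  "unitv i = (\<lambda>j. if j = i then 1 else 0)"

lemma gram_mat_carrier [simp]: "gram_mat n m v w \<in> carrier_mat m m" by (simp add: gram_mat_def)
lemma tuple_mat_carrier [simp]: "tuple_mat m Z \<in> carrier_mat m m" by (simp add: tuple_mat_def)
lemma tuple_mat_index [simp]: "i < m \<Longrightarrow> j < m \<Longrightarrow> tuple_mat m Z $$ (i,j) = Z j i" by (simp add: tuple_mat_def)
lemma gram_mat_index [simp]: "i < m \<Longrightarrow> j < m \<Longrightarrow> gram_mat n m v w $$ (i,j) = ip n (v i) (w j)" by (simp add: gram_mat_def)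

lemma orthonormal_unitv: "m \<le> n \<Longrightarrow> orthonormal n m unitv"
  by (auto simp: orthonormal_def unitv_def Rn_def ip_def if_distrib[of "\<lambda>c. c * _"] cong: if_cong)

lemma tuple_mat_eq_gram_mat: "tuple_mat m Z = gram_mat m m unitv Z"
  by (rule eq_matI) (auto simp: tuple_mat_def gram_mat_def ip_def unitv_def if_distrib[of "\<lambda>c. c * _"] cong: if_cong)

text \<open>Row \<open>i\<close> of the inverse Gram matrix gives a vector \<open>b\<close> that is
  orthogonal to every \<open>a j\<close> except \<open>a i\<close>. It annihilates the span of the
  earlier vectors but not \<open>a i\<close>.\<close>

lemma gram_mat_independent:
  assumes "det (gram_mat n m w a) \<noteq> 0" "i < m"
  shows "a i \<notin> span (a ` {..<i})"
proof
  assume in_span: "a i \<in> span (a ` {..<i})"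
  obtain B where B: "B \<in> carrier_mat m m" "B * gram_mat n m w a = 1\<^sub>m m"
    by (rule inverse_mat_exists[OF gram_mat_carrier assms(1)])
  define b where "b = (\<Sum>l<m. B $$ (i,l) *\<^sub>R w l)"
  have b: "ip n b (a j) = (if i = j then 1 else 0)" if "j < m" for j
  proof -
    have "ip n b (a j) = (\<Sum>l<m. B $$ (i,l) * ip n (w l) (a j))" by (simp add: b_def ip_sum ip_linear)
    also have "\<dots> = (B * gram_mat n m w a) $$ (i,j)"
      using B(1) assms(2) that
      by (subst index_mult_mat) (auto simp: scalar_prod_def atLeast0LessThan gram_mat_def intro!: sum.cong)
    finally show ?thesis using B(2) assms(2) that by simp
  qed
  have "ip n b x = 0" if "x \<in> span (a ` {..<i})" for x
    using that
  proof (induction rule: span_induct_alt)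
    case base
    show ?case by (simp only: ip_linear)
  next
    case (step c x y)
    then obtain j where j: "x = a j" "j < i" by blast
    have "ip n b x = 0" using b[of j] j assms(2) by simp
    thus ?case using step by (simp only: ip_linear)
  qed
  from this[OF in_span] b[OF assms(2)] show False by simp
qed

lemma tuple_mat_mult_gram_mat:
  assumes "\<And>j. j < m \<Longrightarrow> Z j = (\<Sum>i<m. S $$ (i,j) *\<^sub>R Q i)" "S \<in> carrier_mat m m"
  shows "tuple_mat m Z = tuple_mat m Q * S"
  using assms by (intro eq_matI)
    (auto simp: tuple_mat_def scalar_prod_def fun_sum_apply scaleR_fun_def atLeast0LessThan mult.commute intro!: sum.cong)

text \<open>The QR decomposition: \<open>gram_mat n m q a\<close> is the upper triangular factor,
  with the norms of the residuals on its diagonal.\<close>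

lemma gs_vec_expansion:
  assumes a: "\<And>i. i < m \<Longrightarrow> a i \<in> Rn n" and ind: "\<And>i. i < m \<Longrightarrow> a i \<notin> span (a ` {..<i})"
  defines "q \<equiv> gs_vec n a"
  shows "orthonormal n m q"
    and "\<And>j. j < m \<Longrightarrow> a j = (\<Sum>i<m. gram_mat n m q a $$ (i,j) *\<^sub>R q i)"
    and "det (gram_mat n m q a) = (\<Prod>i<m. ip n (q i) (a i))"
    and "det (gram_mat n m q a) \<noteq> 0"
proof -
  have on: "orthonormal n m q" and pos: "\<forall>i<m. ip n (gs_residual n a i) (gs_residual n a i) > 0"
    using gs_vec_properties[OF a ind order_refl] by (auto simp: q_def)
  show "orthonormal n m q" by fact
  define \<rho> where "\<rho> j = sqrt (ip n (gs_residual n a j) (gs_residual n a j))" for j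
  have \<rho>: "\<rho> j > 0" if "j < m" for j using pos that by (simp add: \<rho>_def)
  define c where "c j i = (if i < j then ip n (a j) (q i) else if i = j then \<rho> j else 0)" for i j
  have aj: "a j = (\<Sum>i<m. c j i *\<^sub>R q i)" if "j < m" for j
  proof -
    have "gs_residual n a j = \<rho> j *\<^sub>R q j"
      using \<rho>[OF that] unfolding q_def gs_vec_eq[of n a j] by (simp add: \<rho>_def)
    hence "a j = (\<Sum>i<j. ip n (a j) (q i) *\<^sub>R q i) + \<rho> j *\<^sub>R q j"
      by (simp add: gs_residual_def q_def algebra_simps)
    also have "\<dots> = (\<Sum>i<Suc j. c j i *\<^sub>R q i)" by (simp add: c_def)
    also have "\<dots> = (\<Sum>i<m. c j i *\<^sub>R q i)"
      by (rule sum.mono_neutral_left) (use that in \<open>auto simp: c_def\<close>)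
    finally show ?thesis .
  qed
  have qa: "ip n (q i) (a j) = c j i" if "i < m" "j < m" for i j
    using aj[OF that(2)] orthonormal_coeff[OF on that(1) order_refl] that by simp
  show "a j = (\<Sum>i<m. gram_mat n m q a $$ (i,j) *\<^sub>R q i)" if "j < m" for j
  proof -
    have "(\<Sum>i<m. gram_mat n m q a $$ (i,j) *\<^sub>R q i) = (\<Sum>i<m. c j i *\<^sub>R q i)"
      using that by (intro sum.cong) (auto simp: qa)
    thus ?thesis using aj[OF that] by simp
  qed
  have *: "ip n (q i) (a j) = 0" if "j < i" "i < m" for i j
    using qa[of i j] that by (auto simp: c_def)
  have ut: "upper_triangular (gram_mat n m q a)"
    by (rule upper_triangularI) (use * in \<open>auto simp: gram_mat_def\<close>)
  have "det (gram_mat n m q a) = prod_list (diag_mat (gram_mat n m q a))"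
    by (rule det_upper_triangular[OF ut gram_mat_carrier])
  also have "\<dots> = (\<Prod>i<m. ip n (q i) (a i))"
    by (simp add: prod_list_diag_prod atLeast0LessThan gram_mat_def)
  finally show dd: "det (gram_mat n m q a) = (\<Prod>i<m. ip n (q i) (a i))" .
  have "ip n (q i) (a i) > 0" if "i < m" for i using qa[of i i] \<rho>[OF that] that by (simp add: c_def)
  thus "det (gram_mat n m q a) \<noteq> 0" unfolding dd using less_imp_neq by (metis (no_types, lifting) finite_lessThan lessThan_iff less_irrefl prod_zero_iff)
qed

lemma ip_bound_unit:
  assumes "ip n q q = 1"
  shows "\<bar>ip n q z\<bar> \<le> sqrt (ip n z z)"
proof -
  let ?c = "ip n q z"
  have "0 \<le> ip n (z - ?c *\<^sub>R q) (z - ?c *\<^sub>R q)" by simp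
  also have "\<dots> = ip n z z - ?c\<^sup>2" using assms by (simp add: ip_linear ip_commute[of n z q] power2_eq_square)
  finally show ?thesis by (simp add: real_le_rsqrt)
qed

lemma abs_tuple_det_orthonormal:
  assumes "orthonormal m m q"
  shows "\<bar>tuple_det m q\<bar> = 1"
proof -
  have "transpose_mat (tuple_mat m q) * tuple_mat m q = 1\<^sub>m m"
    by (rule eq_matI) (use assms in \<open>auto simp: tuple_mat_def scalar_prod_def orthonormal_def ip_def atLeast0LessThan\<close>)
  hence "det (transpose_mat (tuple_mat m q)) * det (tuple_mat m q) = 1"
    using det_mult[of "transpose_mat (tuple_mat m q)" m "tuple_mat m q"] by simp
  hence "tuple_det m q * tuple_det m q = 1" by (simp add: Determinant.det_transpose[OF tuple_mat_carrier] tuple_det_def)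
  thus ?thesis by (metis abs_mult_self_eq abs_1 abs_ge_zero abs_mult mult_cancel_right1 mult_cancel_left1 power2_eq_square power2_eq_1_iff abs_minus)
qed

text \<open>In the QR decomposition of \<open>Z\<close> the determinant is, up to sign, the product
  of the diagonal of the triangular factor, and each diagonal entry is the inner product of
  \<open>Z j\<close> with a unit vector.\<close>

theorem hadamard:
  assumes Z: "\<And>j. j < m \<Longrightarrow> Z j \<in> Rn m"
  shows "\<bar>tuple_det m Z\<bar> \<le> (\<Prod>j<m. sqrt (ip m (Z j) (Z j)))"
proof (cases "tuple_det m Z = 0")
  case True
  then show ?thesis by (simp add: prod_nonneg)
next
  case False
  hence ind: "Z i \<notin> span (Z ` {..<i})" if "i < m" for i
    using gram_mat_independent[of m m unitv Z i] that by (simp add: tuple_det_def tuple_mat_eq_gram_mat)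
  let ?q = "gs_vec m Z"
  note G = gs_vec_expansion[OF Z ind]
  have "tuple_mat m Z = tuple_mat m ?q * gram_mat m m ?q Z"
    by (rule tuple_mat_mult_gram_mat[OF G(2)]) auto
  hence "tuple_det m Z = tuple_det m ?q * (\<Prod>i<m. ip m (?q i) (Z i))"
    using G(3) by (simp add: tuple_det_def det_mult[of _ m])
  hence "\<bar>tuple_det m Z\<bar> = (\<Prod>i<m. \<bar>ip m (?q i) (Z i)\<bar>)"
    using abs_tuple_det_orthonormal[OF G(1)] by (simp add: abs_mult abs_prod)
  also have "\<dots> \<le> (\<Prod>j<m. sqrt (ip m (Z j) (Z j)))"
    using G(1) by (intro prod_mono conjI ip_bound_unit) (auto simp: orthonormal_def)
  finally show ?thesis .
qed

section \<open>Tuples of vectors as matrices, multiplied from either side\<close>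

abbreviation tuples :: "nat \<Rightarrow> nat \<Rightarrow> (nat \<Rightarrow> nat \<Rightarrow> real) measure" where
  "tuples n m \<equiv> Pi\<^sub>M {..<m} (\<lambda>_. leb n)"

text \<open>
  A tuple stands for the matrix with the given columns: an element of tuples n m is an n x m matrix, and
  this is the matrix product G Z.
\<close>

definition tuple_mult :: "nat \<Rightarrow> (nat \<Rightarrow> nat \<Rightarrow> real) \<Rightarrow> (nat \<Rightarrow> nat \<Rightarrow> real) \<Rightarrow> nat \<Rightarrow> nat \<Rightarrow> real" where
  "tuple_mult m G Z = (\<lambda>j\<in>{..<m}. \<Sum>i<m. Z j i *\<^sub>R G i)"

lemma sigma_finite_tuples: "sigma_finite_measure (tuples n m)"
proof -
  interpret product_sigma_finite "\<lambda>_::nat. leb n" by (rule leb.product_sigma_finite)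
  show ?thesis by (rule sigma_finite) simp
qed

lemma nn_integral_swap:
  assumes "sigma_finite_measure M" "sigma_finite_measure N" "(\<lambda>p. f (fst p) (snd p)) \<in> borel_measurable (M \<Otimes>\<^sub>M N)"
  shows "(\<integral>\<^sup>+ x. \<integral>\<^sup>+ y. f x y \<partial>N \<partial>M) = (\<integral>\<^sup>+ y. \<integral>\<^sup>+ x. f x y \<partial>M \<partial>N)"
  using pair_sigma_finite.Fubini'[of M N f] assms
  by (simp add: pair_sigma_finite_def case_prod_beta')

lemma tuples_coord:
  assumes "f \<in> M \<rightarrow>\<^sub>M tuples n m" "j < m"
  shows "(\<lambda>x. f x j) \<in> M \<rightarrow>\<^sub>M leb n"
  by (rule measurable_compose[OF assms(1) measurable_component_singleton]) (use assms in auto)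

lemma tuples_entry:
  assumes "f \<in> M \<rightarrow>\<^sub>M tuples n m" "j < m"
  shows "(\<lambda>x. f x j i) \<in> borel_measurable M"
  by (rule leb_coord_measurable[OF tuples_coord[OF assms]])

lemma space_tuples: "G \<in> space (tuples n m) \<longleftrightarrow> (\<forall>j<m. G j \<in> Rn n) \<and> G \<in> extensional {..<m}"
  by (auto simp: space_PiM PiE_def)

lemma tuples_Rn: "G \<in> space (tuples n m) \<Longrightarrow> j < m \<Longrightarrow> G j \<in> Rn n"
  by (simp add: space_tuples)

lemma tuple_mult_measurable [measurable (raw)]:
  assumes f: "f \<in> M \<rightarrow>\<^sub>M tuples n m" and g: "g \<in> M \<rightarrow>\<^sub>M tuples m m"
  shows "(\<lambda>x. tuple_mult m (f x) (g x)) \<in> M \<rightarrow>\<^sub>M tuples n m"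
  unfolding tuple_mult_def
proof (rule measurable_restrict)
  fix j assume j: "j \<in> {..<m}"
  show "(\<lambda>x. \<Sum>i<m. g x j i *\<^sub>R f x i) \<in> M \<rightarrow>\<^sub>M leb n"
  proof (rule measurable_into_leb)
    fix x assume "x \<in> space M"
    hence "f x \<in> space (tuples n m)" using measurable_space[OF f] by blast
    thus "(\<Sum>i<m. g x j i *\<^sub>R f x i) \<in> Rn n" by (intro Rn_sum Rn_simps tuples_Rn) auto
  next
    fix a assume "a < n"
    have "(\<lambda>x. \<Sum>i<m. g x j i * f x i a) \<in> borel_measurable M"
      using j by (intro borel_measurable_sum borel_measurable_times tuples_entry[OF f] tuples_entry[OF g]) auto
    thus "(\<lambda>x. (\<Sum>i<m. g x j i *\<^sub>R f x i) a) \<in> borel_measurable M"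
      by (simp add: fun_sum_apply scaleR_fun_def)
  qed
qed

lemma tuple_mult_space: "G \<in> space (tuples n m) \<Longrightarrow> tuple_mult m G Z \<in> space (tuples n m)"
  unfolding space_tuples tuple_mult_def by (auto intro!: Rn_sum Rn_simps)

lemma det_mat_measurable:
  fixes A :: "'a \<Rightarrow> nat \<Rightarrow> nat \<Rightarrow> real"
  assumes "\<And>i j. i < m \<Longrightarrow> j < m \<Longrightarrow> (\<lambda>x. A x i j) \<in> borel_measurable M"
  shows "(\<lambda>x. det (mat m m (\<lambda>(i,j). A x i j))) \<in> borel_measurable M"
proof -
  have "det (mat m m (\<lambda>(i,j). A x i j)) =
      (\<Sum>p\<in>{p. p permutes {0..<m}}. signof p * (\<Prod>i = 0..<m. A x i (p i)))" for x
    by (subst det_def'[of _ m]) (auto intro!: sum.cong prod.cong dest: permutes_in_image)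
  moreover have "(\<lambda>x. \<Sum>p\<in>{p. p permutes {0..<m}}. signof p * (\<Prod>i = 0..<m. A x i (p i))) \<in> borel_measurable M"
    using assms by (intro borel_measurable_sum borel_measurable_times borel_measurable_prod borel_measurable_const) auto
  ultimately show ?thesis by simp
qed

lemma tuple_det_measurable [measurable (raw)]:
  assumes "f \<in> M \<rightarrow>\<^sub>M tuples m m"
  shows "(\<lambda>x. tuple_det m (f x)) \<in> borel_measurable M"
  unfolding tuple_det_def tuple_mat_def by (rule det_mat_measurable) (rule tuples_entry[OF assms])

lemma tuple_mat_tuple_mult: "tuple_mat m (tuple_mult m X Z) = tuple_mat m X * tuple_mat m Z"
  by (rule tuple_mat_mult_gram_mat) (auto simp: tuple_mult_def)

lemma tuple_det_tuple_mult: "tuple_det m (tuple_mult m X Z) = tuple_det m X * tuple_det m Z"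
  by (simp add: tuple_det_def tuple_mat_tuple_mult det_mult[of _ m])

lemma tuple_mult_right_mult: "tuple_mult m G Z = leb.right_mult m (tuple_mat m Z) G"
  by (auto simp: tuple_mult_def leb.right_mult_def fun_eq_iff intro!: sum.cong)

lemma tuple_mult_assoc: "tuple_mult m (tuple_mult m G X) Z = tuple_mult m G (tuple_mult m X Z)"
proof -
  have "tuple_mult m (tuple_mult m G X) Z = leb.right_mult m (tuple_mat m Z) (leb.right_mult m (tuple_mat m X) G)" by (simp add: tuple_mult_right_mult)
  also have "\<dots> = leb.right_mult m (tuple_mat m (tuple_mult m X Z)) G" by (simp add: leb.right_mult_mult[symmetric] tuple_mat_tuple_mult)
  finally show ?thesis by (simp add: tuple_mult_right_mult)
qed

lemma nn_integral_right_mult: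
  assumes "tuple_det m Z \<noteq> 0" "g \<in> borel_measurable (tuples n m)"
  shows "(\<integral>\<^sup>+ G. g (tuple_mult m G Z) \<partial>tuples n m) = ennreal (1 / \<bar>tuple_det m Z\<bar> ^ n) * (\<integral>\<^sup>+ G. g G \<partial>tuples n m)"
  unfolding tuple_mult_right_mult tuple_det_def
  by (rule leb.nn_integral_right_mult) (use assms in \<open>auto simp: tuple_det_def\<close>)

lemma tuple_mult_mat_app:
  assumes X: "X \<in> space (tuples m m)"
  shows "tuple_mult m X Z = (\<lambda>j\<in>{..<m}. mat_app m (tuple_mat m X) (Z j))"
proof (rule ext)
  fix j show "tuple_mult m X Z j = (\<lambda>j\<in>{..<m}. mat_app m (tuple_mat m X) (Z j)) j"
  proof (cases "j < m")
    case True
    have "(\<Sum>i<m. Z j i *\<^sub>R X i) a = mat_app m (tuple_mat m X) (Z j) a" for a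
    proof (cases "a < m")
      case False
      hence "X i a = 0" if "i < m" for i using tuples_Rn[OF X that] by (auto simp: Rn_def)
      thus ?thesis using False by (simp add: fun_sum_apply scaleR_fun_def mat_app_def)
    qed (auto simp: fun_sum_apply scaleR_fun_def mat_app_def mult.commute intro!: sum.cong)
    thus ?thesis using True by (auto simp: tuple_mult_def)
  qed (simp add: tuple_mult_def)
qed

text \<open>From the left a matrix acts on each of the \<open>m\<close> columns, whence the exponent
  \<open>m\<close>; from the right it acts on the rows of an n x m matrix, whence the exponent
  \<open>n\<close> in the previous formula.\<close>

lemma nn_integral_left_mult:
  assumes X: "X \<in> space (tuples m m)" "tuple_det m X \<noteq> 0" and g: "g \<in> borel_measurable (tuples m m)"
  shows "(\<integral>\<^sup>+ Z. g (tuple_mult m X Z) \<partial>tuples m m) = ennreal (1 / \<bar>tuple_det m X\<bar> ^ m) * (\<integral>\<^sup>+ Z. g Z \<partial>tuples m m)"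
proof -
  have "(\<integral>\<^sup>+ Z. g (\<lambda>j\<in>{..<m}. mat_app m (tuple_mat m X) (Z j)) \<partial>tuples m m) =
     (\<Prod>j\<in>{..<m}. ennreal (1 / \<bar>det (tuple_mat m X)\<bar>)) * (\<integral>\<^sup>+ Z. g Z \<partial>tuples m m)"
    by (rule nn_integral_PiM_componentwise[where T = "\<lambda>j. mat_app m (tuple_mat m X)"])
       (use X nn_integral_mat_app[of "tuple_mat m X" m] sigma_finite_leb g mat_app_measurable[OF measurable_ident] in \<open>auto simp: tuple_det_def\<close>)
  thus ?thesis by (simp add: tuple_mult_mat_app[OF X(1)] tuple_det_def ennreal_power power_one_over)
qed

section \<open>Gaussian weights and the null set of singular tuples\<close>

definition tuple_sqnorm :: "nat \<Rightarrow> nat \<Rightarrow> (nat \<Rightarrow> nat \<Rightarrow> real) \<Rightarrow> real" where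
  "tuple_sqnorm n m G = (\<Sum>j<m. ip n (G j) (G j))"

definition gauss :: "nat \<Rightarrow> nat \<Rightarrow> (nat \<Rightarrow> nat \<Rightarrow> real) \<Rightarrow> ennreal" where
  "gauss n m G = ennreal (exp (- tuple_sqnorm n m G / 2))"

lemma gauss_measurable [measurable (raw)]:
  assumes "f \<in> M \<rightarrow>\<^sub>M tuples n m"
  shows "(\<lambda>x. gauss n m (f x)) \<in> borel_measurable M"
proof -
  have "(\<lambda>x. tuple_sqnorm n m (f x)) \<in> borel_measurable M"
    unfolding tuple_sqnorm_def by (intro borel_measurable_sum ip_measurable tuples_coord[OF assms]) auto
  thus ?thesis unfolding gauss_def by measurable
qed

lemma nn_integral_tuples_prod:
  assumes "\<And>j. j < m \<Longrightarrow> f j \<in> borel_measurable (leb n)"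
  shows "(\<integral>\<^sup>+ G. (\<Prod>j<m. f j (G j)) \<partial>tuples n m) = (\<Prod>j<m. \<integral>\<^sup>+ x. f j x \<partial>leb n)"
proof -
  interpret product_sigma_finite "\<lambda>_::nat. leb n" by (rule leb.product_sigma_finite)
  show ?thesis by (rule product_nn_integral_prod) (use assms in auto)
qed

lemma gauss_prod: "gauss n m G = (\<Prod>j<m. ennreal (exp (- (1/2) * ip n (G j) (G j))))"
  by (simp add: gauss_def tuple_sqnorm_def sum_divide_distrib sum_negf[symmetric] exp_sum prod_ennreal)

lemma nn_integral_gauss: "(\<integral>\<^sup>+ G. gauss n m G \<partial>tuples n m) = ennreal (sqrt (2 * pi) ^ (n * m))"
proof -
  have "(\<integral>\<^sup>+ G. gauss n m G \<partial>tuples n m) = (\<Prod>j<m. \<integral>\<^sup>+ x. ennreal (exp (- (1/2) * ip n x x)) \<partial>leb n)"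
    unfolding gauss_prod by (rule nn_integral_tuples_prod) measurable
  also have "\<dots> = (\<Prod>j<m. ennreal (sqrt (2 * pi) ^ n))"
    by (subst nn_integral_gauss_leb) (auto simp: mult.commute)
  finally show ?thesis by (simp add: ennreal_power power_mult)
qed

text \<open>As a function of \<open>t\<close> this is the characteristic polynomial of
  \<open>- S\<close>, which is monic and hence not zero.\<close>

lemma det_shift_identity_finite:
  fixes S :: "real mat"
  assumes "S \<in> carrier_mat m m"
  shows "finite {t. det (S + t \<cdot>\<^sub>m 1\<^sub>m m) = 0}"
proof -
  let ?p = "char_poly (- S)"
  have "monic ?p" using degree_monic_char_poly[of "- S" m] assms by auto
  hence "?p \<noteq> 0" by auto
  moreover have "poly ?p t = det (S + t \<cdot>\<^sub>m 1\<^sub>m m)" for t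
  proof -
    have "poly ?p t = det (- char_matrix (- S) t)" by (rule char_poly_matrix[of _ m]) (use assms in auto)
    also have "- char_matrix (- S) t = S + t \<cdot>\<^sub>m 1\<^sub>m m"
      by (rule eq_matI) (use assms in \<open>auto simp: char_matrix_def\<close>)
    finally show ?thesis .
  qed
  ultimately show ?thesis using poly_roots_finite[of ?p] by simp
qed

lemma gram_mat_det_measurable:
  assumes "\<And>i. i < m \<Longrightarrow> w i \<in> Rn n" "f \<in> M \<rightarrow>\<^sub>M tuples n m"
  shows "(\<lambda>x. det (gram_mat n m w (f x))) \<in> borel_measurable M"
  unfolding gram_mat_def
  by (rule det_mat_measurable, intro ip_measurable tuples_coord[OF assms(2)] measurable_const) (use assms in auto)

text \<open>
  The translate G + t w has Gram matrix S + t I, which is singular for finitely many t only.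
\<close>

lemma AE_gram_mat_nonsingular:
  assumes w: "orthonormal n m w"
  shows "AE G in tuples n m. det (gram_mat n m w G) \<noteq> 0"
proof -
  let ?A = "{G \<in> space (tuples n m). det (gram_mat n m w G) = 0}"
  define s :: "_ \<Rightarrow> real \<Rightarrow> _" where "s = (\<lambda>G t. \<lambda>j\<in>{..<m}. G j + t *\<^sub>R w j)"
  have wR: "w i \<in> Rn n" if "i < m" for i using w that by (auto simp: orthonormal_def)
  have A: "?A \<in> sets (tuples n m)"
    using gram_mat_det_measurable[OF wR measurable_ident] by (auto intro!: borel_measurable_eq)
  have sm: "(\<lambda>p. s (fst p) (snd p)) \<in> tuples n m \<Otimes>\<^sub>M (lborel :: real measure) \<rightarrow>\<^sub>M tuples n m"
    unfolding s_def
  proof (intro measurable_restrict measurable_into_leb)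
    fix j p assume j: "j \<in> {..<m}" and p: "p \<in> space (tuples n m \<Otimes>\<^sub>M (lborel :: real measure))"
    show "fst p j + snd p *\<^sub>R w j \<in> Rn n"
      using p j wR by (auto simp: space_pair_measure space_tuples intro!: Rn_simps)
  next
    fix i j assume j: "j \<in> {..<m}"
    have "(\<lambda>p. fst p j i + snd p * w j i) \<in> borel_measurable (tuples n m \<Otimes>\<^sub>M (lborel :: real measure))"
      using j by (intro borel_measurable_add borel_measurable_times tuples_entry[OF measurable_fst]) auto
    thus "(\<lambda>p. (fst p j + snd p *\<^sub>R w j) i) \<in> borel_measurable (tuples n m \<Otimes>\<^sub>M (lborel :: real measure))"
      by (simp add: scaleR_fun_def)
  qed
  have shift: "(\<integral>\<^sup>+ G. indicator ?A (s G t) \<partial>tuples n m) = emeasure (tuples n m) ?A" for t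
  proof -
    have tw: "t *\<^sub>R w j \<in> space (leb n)" if "j < m" for j using wR[OF that] Rn_simps by simp
    have am: "(\<lambda>x. x + t *\<^sub>R w j) \<in> leb n \<rightarrow>\<^sub>M leb n" if "j < m" for j
      by (intro leb.add_measurable' measurable_ident_sets[OF refl] measurable_const tw that)
    have "(\<integral>\<^sup>+ G. indicator ?A (\<lambda>j\<in>{..<m}. G j + t *\<^sub>R w j) \<partial>tuples n m) =
       (\<Prod>j\<in>{..<m}. 1) * (\<integral>\<^sup>+ G. indicator ?A G \<partial>tuples n m)"
      by (rule nn_integral_PiM_componentwise[where T = "\<lambda>j x. x + t *\<^sub>R w j"])
         (use am A sigma_finite_leb leb.shift[OF tw] in auto)
    thus ?thesis using A by (simp add: s_def)
  qed
  have inner: "(\<integral>\<^sup>+ t. indicator ?A (s G t) \<partial>lborel) = 0" if G: "G \<in> space (tuples n m)" for G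
  proof -
    let ?S = "gram_mat n m w G"
    have "gram_mat n m w (s G t) = ?S + t \<cdot>\<^sub>m 1\<^sub>m m" for t
      using w by (intro eq_matI) (auto simp: gram_mat_def s_def ip_linear orthonormal_def)
    hence sub: "{t. s G t \<in> ?A} \<subseteq> {t. det (?S + t \<cdot>\<^sub>m 1\<^sub>m m) = 0}" by auto
    have fin: "finite {t. s G t \<in> ?A}"
      by (rule finite_subset[OF sub det_shift_identity_finite]) simp
    have "(\<integral>\<^sup>+ t. indicator ?A (s G t) \<partial>lborel) = (\<integral>\<^sup>+ t. indicator {t. s G t \<in> ?A} t \<partial>lborel)"
      by (intro nn_integral_cong) (auto simp: indicator_def)
    also have "\<dots> = emeasure lborel {t. s G t \<in> ?A}"
      by (rule nn_integral_indicator) (use borel_closed[OF finite_imp_closed[OF fin]] in \<open>simp only: sets_lborel\<close>)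
    also have "\<dots> = 0" using fin by (simp add: finite_imp_null_set_lborel null_setsD1)
    finally show ?thesis .
  qed
  have m: "(\<lambda>p. indicator ?A (s (fst p) (snd p)) :: ennreal) \<in> borel_measurable (tuples n m \<Otimes>\<^sub>M (lborel :: real measure))"
    by (rule measurable_compose[OF sm borel_measurable_indicator[OF A]])
  \<comment> \<open>Fubini for the translates: by \<open>shift\<close> the integral over
    \<open>G\<close> is the same for all \<open>t\<close>, and by \<open>inner\<close> the integral
    over \<open>t\<close> vanishes for every \<open>G\<close>. Since the line has infinite length,
    the constant must be 0.\<close>
  have "(\<integral>\<^sup>+ t. emeasure (tuples n m) ?A \<partial>(lborel :: real measure)) = (\<integral>\<^sup>+ t. \<integral>\<^sup>+ G. indicator ?A (s G t) \<partial>tuples n m \<partial>lborel)"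
    by (simp only: shift)
  also have "\<dots> = (\<integral>\<^sup>+ G. \<integral>\<^sup>+ t. indicator ?A (s G t) \<partial>lborel \<partial>tuples n m)"
    by (rule nn_integral_swap[symmetric, OF sigma_finite_tuples sigma_finite_lborel m])
  also have "\<dots> = (\<integral>\<^sup>+ G. 0 \<partial>tuples n m)" by (rule nn_integral_cong) (rule inner)
  finally have "emeasure (tuples n m) ?A * \<infinity> = 0" by simp
  hence "emeasure (tuples n m) ?A = 0" by (simp add: ennreal_mult_eq_top_iff split: if_splits)
  hence "?A \<in> null_sets (tuples n m)" using A by (auto simp: null_sets_def)
  from AE_not_in[OF this] show ?thesis by (auto elim!: AE_mp)
qed

lemma AE_tuple_det_nonzero: "AE Z in tuples m m. tuple_det m Z \<noteq> 0"
  using AE_gram_mat_nonsingular[OF orthonormal_unitv[of m m]] by (simp add: tuple_det_def tuple_mat_eq_gram_mat)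

section \<open>Determinants of vectors with bounded density\<close>

definition enorm :: "nat \<Rightarrow> (nat \<Rightarrow> real) \<Rightarrow> real" where
  "enorm n x = sqrt (ip n x x)"

lemma enorm_nonneg [simp]: "0 \<le> enorm n x" by (simp add: enorm_def)

lemma enorm_sq: "(enorm n x)\<^sup>2 = ip n x x" by (simp add: enorm_def)

lemma enorm_measurable [measurable (raw)]: "f \<in> M \<rightarrow>\<^sub>M leb n \<Longrightarrow> (\<lambda>x. enorm n (f x)) \<in> borel_measurable M"
proof -
  assume "f \<in> M \<rightarrow>\<^sub>M leb n"
  hence [measurable]: "(\<lambda>x. ip n (f x) (f x)) \<in> borel_measurable M" by (intro ip_measurable)
  show ?thesis unfolding enorm_def by measurable
qed

lemma abs_coord_le_enorm: "i < n \<Longrightarrow> \<bar>x i\<bar> \<le> enorm n x"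
proof -
  assume "i < n"
  hence "(x i)\<^sup>2 \<le> ip n x x"
    unfolding ip_def power2_eq_square by (intro member_le_sum) auto
  thus ?thesis unfolding enorm_def by (metis real_sqrt_abs real_sqrt_le_mono)
qed

text \<open>The square root lies below its tangent at \<open>a\<^sup>2\<close>. The last hypothesis
  settles \<open>a = 0\<close>, where the quotient is 0 by convention.\<close>

lemma enorm_le_of_sq:
  assumes "0 \<le> a" "(enorm n x)\<^sup>2 = a\<^sup>2 + b" "a = 0 \<Longrightarrow> enorm n x = 0"
  shows "enorm n x \<le> a + b / (2 * a)"
proof (cases "a = 0")
  case False
  hence a: "a > 0" using assms by simp
  have "0 \<le> (enorm n x - a)\<^sup>2" by simp
  also have "\<dots> = 2 * a\<^sup>2 + b - 2 * a * enorm n x" using assms(2) by (simp add: power2_eq_square algebra_simps)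
  finally have "enorm n x * (2 * a) \<le> 2 * a\<^sup>2 + b" by (simp add: algebra_simps)
  hence "enorm n x \<le> (2 * a\<^sup>2 + b) / (2 * a)" using a by (simp add: pos_le_divide_eq)
  also have "\<dots> = a + b / (2 * a)" using a by (simp add: field_simps power2_eq_square)
  finally show ?thesis .
qed (use assms in simp)

text \<open>Leibniz's formula for the transpose, so that the factor with index \<open>j\<close>
  involves the column \<open>Z j\<close> only; over independent columns the products then integrate
  factor by factor.\<close>

lemma tuple_det_expand: "tuple_det m Z = (\<Sum>p\<in>{p. p permutes {..<m}}. signof p * (\<Prod>j<m. Z j (p j)))"
proof -
  have "tuple_det m Z = det (transpose_mat (tuple_mat m Z))" by (simp add: tuple_det_def Determinant.det_transpose[OF tuple_mat_carrier])
  also have "\<dots> = (\<Sum>p\<in>{p. p permutes {..<m}}. signof p * (\<Prod>j<m. Z j (p j)))"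
    by (subst det_def'[of _ m])
       (auto simp: atLeast0LessThan tuple_mat_def intro!: sum.cong prod.cong dest: permutes_in_image)
  finally show ?thesis .
qed

text \<open>
  The matrix S of determinant 1 is chosen to make J S almost minimal (Lewis position). Perturbing S by
  elementary row operations then shows that the matrix moment S is almost a multiple of the identity.
\<close>

locale bounded_density =
  fixes m :: nat and h :: "(nat \<Rightarrow> real) \<Rightarrow> real" and M R :: real
  assumes m: "m \<ge> 1" and h_meas: "h \<in> borel_measurable (leb m)"
    and h_nonneg: "\<And>y. 0 \<le> h y" and h_le: "\<And>y. h y \<le> M" and M_pos: "M > 0"
    and supp: "\<And>y i. h y \<noteq> 0 \<Longrightarrow> i < m \<Longrightarrow> \<bar>y i\<bar> \<le> R"
    and L_pos: "(\<integral>y. h y \<partial>leb m) > 0"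
begin

definition L :: real where "L = (\<integral>y. h y \<partial>leb m)"

definition J :: "real mat \<Rightarrow> real" where "J S = (\<integral>y. h y * enorm m (mat_app m S y) \<partial>leb m)"

text \<open>Second moments weighted by the inverse norm. They describe the first-order change of
  \<open>J\<close> under row operations on \<open>S\<close>, and their trace is \<open>J S\<close>.
  Where the norm vanishes, the quotient is 0.\<close>

definition moment :: "real mat \<Rightarrow> nat \<Rightarrow> nat \<Rightarrow> real" where
  "moment S i j = (\<integral>y. h y * (mat_app m S y i * mat_app m S y j / enorm m (mat_app m S y)) \<partial>leb m)"

definition SL :: "real mat set" where "SL = {S \<in> carrier_mat m m. det S = 1}"

text \<open>A function that is not integrable has integral 0, so the positivity of the mass is
  enough.\<close>

lemma h_integrable: "integrable (leb m) h"
  using L_pos not_integrable_integral_eq by force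

lemma coord_bound: "\<exists>C. \<forall>y. h y \<noteq> 0 \<longrightarrow> (\<forall>i<m. \<bar>mat_app m S y i\<bar> \<le> C)"
proof -
  define C where "C = (\<Sum>i<m. \<Sum>j<m. \<bar>S $$ (i,j)\<bar> * \<bar>R\<bar>)"
  have "\<bar>mat_app m S y i\<bar> \<le> C" if "h y \<noteq> 0" "i < m" for y i
  proof -
    have "\<bar>mat_app m S y i\<bar> \<le> (\<Sum>j<m. \<bar>S $$ (i,j) * y j\<bar>)"
      using that by (simp add: mat_app_def sum_abs)
    also have "\<dots> \<le> (\<Sum>j<m. \<bar>S $$ (i,j)\<bar> * \<bar>R\<bar>)"
      by (intro sum_mono) (use supp[OF that(1)] in \<open>force simp: abs_mult intro!: mult_left_mono\<close>)
    also have "\<dots> \<le> C" unfolding C_def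
      using that(2) by (intro member_le_sum) (auto intro!: sum_nonneg)
    finally show ?thesis .
  qed
  thus ?thesis by blast
qed

lemma enorm_bound: "\<exists>C. \<forall>y. h y \<noteq> 0 \<longrightarrow> enorm m (mat_app m S y) \<le> C"
proof -
  obtain C where C: "\<And>y i. h y \<noteq> 0 \<Longrightarrow> i < m \<Longrightarrow> \<bar>mat_app m S y i\<bar> \<le> C" using coord_bound by blast
  have "enorm m (mat_app m S y) \<le> sqrt (real m * C\<^sup>2)" if "h y \<noteq> 0" for y
  proof -
    have "ip m (mat_app m S y) (mat_app m S y) \<le> (\<Sum>i<m. C\<^sup>2)"
      unfolding ip_def power2_eq_square[symmetric]
      by (intro sum_mono) (metis C abs_le_square_iff abs_of_nonneg abs_ge_zero order_trans lessThan_iff that)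
    thus ?thesis by (simp add: enorm_def)
  qed
  thus ?thesis by blast
qed

lemma integrable_h_mult:
  assumes "\<phi> \<in> borel_measurable (leb m)" "\<And>y. h y \<noteq> 0 \<Longrightarrow> \<bar>\<phi> y\<bar> \<le> C"
  shows "integrable (leb m) (\<lambda>y. h y * \<phi> y)"
proof (rule Bochner_Integration.integrable_bound[of _ "\<lambda>y. C * h y"])
  show "(\<lambda>y. h y * \<phi> y) \<in> borel_measurable (leb m)" using assms h_meas by measurable
  have "norm (h y * \<phi> y) \<le> norm (C * h y)" for y
  proof (cases "h y = 0")
    case False
    thus ?thesis using assms(2)[of y] by (auto simp: abs_mult mult.commute intro!: mult_left_mono)
  qed simp
  thus "AE y in leb m. norm (h y * \<phi> y) \<le> norm (C * h y)" by simp
qed (use h_integrable in simp)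

lemma mat_app_coord_measurable [measurable]: "(\<lambda>y. mat_app m S y i) \<in> borel_measurable (leb m)"
  by (rule leb_coord_measurable[OF mat_app_measurable[OF measurable_ident_sets[OF refl]]])

lemma mat_app_enorm_measurable [measurable]: "(\<lambda>y. enorm m (mat_app m S y)) \<in> borel_measurable (leb m)"
  by (rule enorm_measurable[OF mat_app_measurable[OF measurable_ident_sets[OF refl]]])

lemma moment_le_enorm: "\<bar>u i * u j / enorm m u\<bar> \<le> enorm m u" if "i < m" "j < m"
proof (cases "enorm m u = 0")
  case False
  have "\<bar>u i * u j\<bar> \<le> enorm m u * enorm m u"
    unfolding abs_mult using that by (intro mult_mono abs_coord_le_enorm) auto
  moreover have "enorm m u > 0" using False enorm_nonneg[of m u] by (simp add: less_le)
  ultimately show ?thesis by (simp add: divide_le_eq abs_divide)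
qed simp

lemma integrable_J: "integrable (leb m) (\<lambda>y. h y * enorm m (mat_app m S y))"
proof -
  obtain C where C: "\<And>y. h y \<noteq> 0 \<Longrightarrow> enorm m (mat_app m S y) \<le> C" using enorm_bound by blast
  show ?thesis by (rule integrable_h_mult[where C = C]) (use C in auto)
qed

lemma integrable_moment:
  assumes "i < m" "j < m"
  shows "integrable (leb m) (\<lambda>y. h y * (mat_app m S y i * mat_app m S y j / enorm m (mat_app m S y)))"
proof -
  obtain C where C: "\<And>y. h y \<noteq> 0 \<Longrightarrow> enorm m (mat_app m S y) \<le> C" using enorm_bound by blast
  show ?thesis
    by (rule integrable_h_mult[where C = C]) (use C moment_le_enorm[OF assms] order_trans in \<open>auto, blast\<close>)
qed

lemma J_nonneg: "0 \<le> J S"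
  unfolding J_def by (rule integral_nonneg_AE) (simp add: h_nonneg)

lemma moment_diag: "i < m \<Longrightarrow> 0 \<le> moment S i i" "i < m \<Longrightarrow> moment S i i \<le> J S" "(\<Sum>i<m. moment S i i) = J S"
proof -
  show "0 \<le> moment S i i" unfolding moment_def by (rule integral_nonneg_AE) (simp add: h_nonneg)
  show "moment S i i \<le> J S" if "i < m" unfolding moment_def J_def
    by (rule integral_mono[OF integrable_moment[OF that that] integrable_J])
       (intro mult_left_mono h_nonneg order_trans[OF abs_ge_self moment_le_enorm[OF that that]])
  have "(\<Sum>i<m. moment S i i) = (\<integral>y. (\<Sum>i<m. h y * (mat_app m S y i * mat_app m S y i / enorm m (mat_app m S y))) \<partial>leb m)"
    unfolding moment_def by (rule Bochner_Integration.integral_sum[symmetric], rule integrable_moment) simp_all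
  also have "\<dots> = J S" unfolding J_def
  proof (rule Bochner_Integration.integral_cong[OF refl])
    fix y
    let ?u = "mat_app m S y"
    have "(\<Sum>i<m. h y * (?u i * ?u i / enorm m ?u)) = h y * (ip m ?u ?u / enorm m ?u)"
      by (simp add: ip_def sum_distrib_left sum_divide_distrib)
    also have "ip m ?u ?u / enorm m ?u = enorm m ?u" by (simp add: enorm_sq[symmetric] power2_eq_square)
    finally show "(\<Sum>i<m. h y * (?u i * ?u i / enorm m ?u)) = h y * enorm m ?u" .
  qed
  finally show "(\<Sum>i<m. moment S i i) = J S" .
qed

text \<open>The tangent bound for the norm, integrated. An upper bound for the perturbed value is
  all that a comparison with the infimum requires, so \<open>J\<close> is never
  differentiated.\<close>

lemma J_perturb:
  assumes ij: "i < m" "j < m"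
    and sq: "\<And>y. ip m (mat_app m S' y) (mat_app m S' y) = ip m (mat_app m S y) (mat_app m S y)
      + a * (mat_app m S y i * mat_app m S y j) + b * (mat_app m S y i * mat_app m S y i) + c * (mat_app m S y j * mat_app m S y j)"
  shows "J S' \<le> J S + (a * moment S i j + b * moment S i i + c * moment S j j) / 2"
proof -
  let ?u = "mat_app m S"
  let ?q = "\<lambda>i j y. h y * (?u y i * ?u y j / enorm m (?u y))"
  have pt: "h y * enorm m (mat_app m S' y) \<le> h y * enorm m (?u y) + (a / 2 * ?q i j y + b / 2 * ?q i i y + c / 2 * ?q j j y)" for y
  proof -
    let ?b = "a * (?u y i * ?u y j) + b * (?u y i * ?u y i) + c * (?u y j * ?u y j)"
    have "enorm m (mat_app m S' y) \<le> enorm m (?u y) + ?b / (2 * enorm m (?u y))"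
    proof (rule enorm_le_of_sq)
      show "(enorm m (mat_app m S' y))\<^sup>2 = (enorm m (?u y))\<^sup>2 + ?b" by (simp add: enorm_sq sq)
      assume 0: "enorm m (?u y) = 0"
      hence "?u y i = 0" "?u y j = 0" using abs_coord_le_enorm[of _ m "?u y"] ij by force+
      with 0 sq[of y] show "enorm m (mat_app m S' y) = 0" by (simp add: enorm_def)
    qed simp
    from mult_left_mono[OF this h_nonneg[of y]]
    show ?thesis by (simp add: algebra_simps add_divide_distrib)
  qed
  have int: "integrable (leb m) (\<lambda>y. a / 2 * ?q i j y + b / 2 * ?q i i y + c / 2 * ?q j j y)"
    by (intro Bochner_Integration.integrable_add integrable_mult_right integrable_moment ij)
  have "J S' \<le> (\<integral>y. h y * enorm m (?u y) + (a / 2 * ?q i j y + b / 2 * ?q i i y + c / 2 * ?q j j y) \<partial>leb m)"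
    unfolding J_def by (intro integral_mono integrable_J Bochner_Integration.integrable_add int pt)
  also have "\<dots> = J S + (a / 2 * moment S i j + b / 2 * moment S i i + c / 2 * moment S j j)"
    unfolding J_def moment_def
    by (subst Bochner_Integration.integral_add, rule integrable_J, rule int,
        subst Bochner_Integration.integral_add,
        intro Bochner_Integration.integrable_add integrable_mult_right integrable_moment ij,
        intro integrable_mult_right integrable_moment ij,
        subst Bochner_Integration.integral_add, intro integrable_mult_right integrable_moment ij,
        intro integrable_mult_right integrable_moment ij, simp only: integral_mult_right_zero)
  finally show ?thesis by (simp add: field_simps)
qed

text \<open>Adding \<open>t\<close> times row \<open>j\<close> to row \<open>i\<close> keeps the
  determinant. As \<open>t\<close> may have either sign, it tests the entries of the moment matrix
  off the diagonal: for an almost minimal \<open>S\<close> they must be small.\<close>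

lemma perturb_addrow:
  assumes S: "S \<in> SL" and ij: "i < m" "j < m" "i \<noteq> j"
  shows "\<exists>S'\<in>SL. J S' \<le> J S + t * moment S i j + t\<^sup>2 / 2 * J S"
proof
  let ?S = "addrow t i j S"
  have Sc: "S \<in> carrier_mat m m" using S by (simp add: SL_def)
  show "?S \<in> SL" using S det_addrow[OF ij(2,3) Sc, of t] by (auto simp: SL_def)
  have u: "mat_app m ?S y = (mat_app m S y)(i := mat_app m S y i + t * mat_app m S y j)" for y
  proof
    fix l show "mat_app m ?S y l = ((mat_app m S y)(i := mat_app m S y i + t * mat_app m S y j)) l"
      using ij Sc by (auto simp: mat_app_def sum.distrib sum_distrib_left algebra_simps)
  qed
  have "J ?S \<le> J S + (2 * t * moment S i j + 0 * moment S i i + t\<^sup>2 * moment S j j) / 2"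
  proof (rule J_perturb[OF ij(1,2)])
    fix y
    let ?u = "mat_app m S y"
    have "ip m (mat_app m ?S y) (mat_app m ?S y) = (\<Sum>l<m. ?u l * ?u l + (if l = i then 2 * t * (?u i * ?u j) + t\<^sup>2 * (?u j * ?u j) else 0))"
      unfolding u ip_def by (intro sum.cong) (auto simp: algebra_simps power2_eq_square)
    also have "\<dots> = ip m ?u ?u + 2 * t * (?u i * ?u j) + 0 * (?u i * ?u i) + t\<^sup>2 * (?u j * ?u j)"
      using ij by (simp add: sum.distrib ip_def)
    finally show "ip m (mat_app m ?S y) (mat_app m ?S y) = ip m ?u ?u + 2 * t * (?u i * ?u j) + 0 * (?u i * ?u i) + t\<^sup>2 * (?u j * ?u j)" .
  qed
  also have "\<dots> \<le> J S + t * moment S i j + t\<^sup>2 / 2 * J S"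
    using mult_left_mono[OF moment_diag(2)[OF ij(2), of S], of "t\<^sup>2"] by simp
  finally show "J ?S \<le> J S + t * moment S i j + t\<^sup>2 / 2 * J S" .
qed

text \<open>Row \<open>i\<close> is stretched by \<open>sqrt (1 + t)\<close> and row
  \<open>j\<close> shrunk by the same factor, which keeps the determinant. This tests the difference
  of two diagonal entries of the moment matrix.\<close>

lemma perturb_multrow:
  assumes S: "S \<in> SL" and ij: "i < m" "j < m" "i \<noteq> j" and t: "t > 0"
  shows "\<exists>S'\<in>SL. J S' \<le> J S + (t * moment S i i - t / (1 + t) * moment S j j) / 2"
proof
  let ?c = "sqrt (1 + t)"
  let ?S = "multrow i ?c (multrow j (1 / ?c) S)"
  have Sc: "S \<in> carrier_mat m m" using S by (simp add: SL_def)
  have c: "?c > 0" "?c * ?c = 1 + t" using t by auto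
  have "det ?S = 1" using det_multrow[of i m "multrow j (1 / ?c) S" ?c] det_multrow[of j m S "1 / ?c"] ij Sc S c
    by (auto simp: SL_def)
  thus "?S \<in> SL" using Sc by (auto simp: SL_def)
  have u: "mat_app m ?S y = (mat_app m S y)(i := ?c * mat_app m S y i, j := mat_app m S y j / ?c)" for y
  proof
    fix l show "mat_app m ?S y l = ((mat_app m S y)(i := ?c * mat_app m S y i, j := mat_app m S y j / ?c)) l"
      using ij Sc by (auto simp: mat_app_def sum_distrib_left sum_divide_distrib algebra_simps intro!: sum.cong)
  qed
  have "J ?S \<le> J S + (0 * moment S i j + t * moment S i i + - (t / (1 + t)) * moment S j j) / 2"
  proof (rule J_perturb[OF ij(1,2)])
    fix y
    let ?u = "mat_app m S y"
    have dj: "(?u j / ?c) * (?u j / ?c) = ?u j * ?u j - t / (1 + t) * (?u j * ?u j)"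
    proof -
      have "(?u j / ?c) * (?u j / ?c) = (?u j * ?u j) / (1 + t)" unfolding times_divide_times_eq c(2) ..
      also have "\<dots> = ?u j * ?u j - t / (1 + t) * (?u j * ?u j)" using t by (simp add: field_simps)
      finally show ?thesis .
    qed
    have di: "(?c * ?u i) * (?c * ?u i) = ?u i * ?u i + t * (?u i * ?u i)"
    proof -
      have "(?c * ?u i) * (?c * ?u i) = (?c * ?c) * (?u i * ?u i)" by (simp add: algebra_simps)
      also have "\<dots> = (1 + t) * (?u i * ?u i)" unfolding c(2) ..
      finally show ?thesis by (simp add: algebra_simps)
    qed
    have "ip m (mat_app m ?S y) (mat_app m ?S y) = (\<Sum>l<m. ?u l * ?u l + (if l = i then t * (?u i * ?u i) else 0)
        + (if l = j then - (t / (1 + t)) * (?u j * ?u j) else 0))"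
      unfolding u ip_def by (intro sum.cong refl) (use ij(3) di dj in auto)
    also have "\<dots> = ip m ?u ?u + 0 * (?u i * ?u j) + t * (?u i * ?u i) + - (t / (1 + t)) * (?u j * ?u j)"
      using ij by (simp add: sum.distrib ip_def)
    finally show "ip m (mat_app m ?S y) (mat_app m ?S y) = ip m ?u ?u + 0 * (?u i * ?u j) + t * (?u i * ?u i) + - (t / (1 + t)) * (?u j * ?u j)" .
  qed
  thus "J ?S \<le> J S + (t * moment S i i - t / (1 + t) * moment S j j) / 2" by simp
qed

end

text \<open>The constant in the lower bound for the expected determinant: \<open>fact m\<close>
  counts the permutations in the expansion of the squared determinant, the denominator comes from
  the lower bound for \<open>J\<close>.\<close>

definition kappa :: "nat \<Rightarrow> real" where "kappa m = fact m / (20 ^ m * sqrt m ^ m)"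

lemma kappa_pos: "m \<ge> 1 \<Longrightarrow> kappa m > 0" by (simp add: kappa_def)

lemma mat_app_measurable_id: "mat_app m S \<in> leb m \<rightarrow>\<^sub>M leb m"
  by (rule mat_app_measurable[OF measurable_ident_sets[OF refl]])

section \<open>Near-minimisers and the expected absolute determinant\<close>

context bounded_density
begin

text \<open>Working with the infimum and with matrices that almost attain it replaces the
  compactness argument by which a minimiser would be found.\<close>

definition Jinf :: real where "Jinf = Inf (J ` SL)"

lemma one_SL: "1\<^sub>m m \<in> SL" by (simp add: SL_def)

lemma Jinf_le: "S \<in> SL \<Longrightarrow> Jinf \<le> J S"
  unfolding Jinf_def by (intro cInf_lower) (auto intro!: bdd_belowI[of _ 0] J_nonneg)

lemma Jinf_approx: "e > 0 \<Longrightarrow> \<exists>S\<in>SL. J S < Jinf + e"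
  unfolding Jinf_def using cInf_lessD[of "J ` SL" "Inf (J ` SL) + e"] one_SL by auto

lemma has_integral_gauss_mat_app:
  assumes "S \<in> SL" "a > 0"
  shows "has_bochner_integral (leb m) (\<lambda>y. exp (- a * ip m (mat_app m S y) (mat_app m S y))) (sqrt (pi / a) ^ m)"
proof (rule has_bochner_integral_nn_integral)
  have g: "(\<lambda>x. ennreal (exp (- a * ip m x x))) \<in> borel_measurable (leb m)"
  proof -
    have [measurable]: "(\<lambda>x. ip m x x) \<in> borel_measurable (leb m)"
      by (intro ip_measurable measurable_ident_sets[OF refl])
    show ?thesis by measurable
  qed
  have [measurable]: "(\<lambda>y. ip m (mat_app m S y) (mat_app m S y)) \<in> borel_measurable (leb m)"
    by (intro ip_measurable mat_app_measurable_id)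
  show "(\<lambda>y. exp (- a * ip m (mat_app m S y) (mat_app m S y))) \<in> borel_measurable (leb m)" by measurable
  show "(\<integral>\<^sup>+ y. ennreal (exp (- a * ip m (mat_app m S y) (mat_app m S y))) \<partial>leb m) = ennreal (sqrt (pi / a) ^ m)"
    using nn_integral_mat_app[of S m, OF _ _ g] assms(1) unfolding SL_def nn_integral_gauss_leb[OF assms(2)] by simp
qed (use assms in auto)

text \<open>A density bounded by \<open>M\<close> with mass \<open>L\<close> cannot concentrate near
  0, and \<open>S\<close> preserves volume. The volume of a ball is replaced by the integral of a
  Gaussian that majorises its indicator.\<close>

lemma J_lower:
  assumes S: "S \<in> SL"
  shows "L * sqrt m * (L / M) powr (1 / m) / 20 \<le> J S"
proof -
  \<comment> \<open>On the ball of radius \<open>r\<close> the function \<open>exp (m / 2)\<close>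
    times the Gaussian with parameter \<open>a\<close> is at least 1, and its integral is at most
    \<open>s ^ m = L / (2 * M)\<close>; hence the ball holds at most half of the mass. The 5 in
    \<open>r\<close> is chosen because 2 e pi is at most 25.\<close>
  define s where "s = (L / (2 * M)) powr (1 / m)"
  define r where "r = sqrt m * s / 5"
  define a where "a = m / (2 * r\<^sup>2)"
  have Lp: "L > 0" using L_pos by (simp add: L_def)
  have s: "s > 0" "s ^ m = L / (2 * M)" using Lp M_pos m by (auto simp: s_def powr_realpow[symmetric] powr_powr)
  have r: "r > 0" using s m by (simp add: r_def)
  have a: "a > 0" using r m by (simp add: a_def)
  let ?n = "\<lambda>y. enorm m (mat_app m S y)" and ?E = "\<lambda>y. exp (- a * ip m (mat_app m S y) (mat_app m S y))"
  note G = has_integral_gauss_mat_app[OF S a]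
  have pt: "r * h y - r * M * exp (m / 2) * ?E y \<le> h y * ?n y" for y
  proof (cases "?n y > r")
    case True
    have "r * h y \<le> h y * ?n y" using mult_left_mono[OF less_imp_le[OF True] h_nonneg[of y]] by (simp add: mult.commute)
    moreover have "0 \<le> r * M * exp (m / 2) * ?E y" using r M_pos by simp
    ultimately show ?thesis by linarith
  next
    case False
    have "ip m (mat_app m S y) (mat_app m S y) \<le> r\<^sup>2"
      using False enorm_sq[of m "mat_app m S y"] by (metis enorm_nonneg not_less power_mono)
    hence "a * ip m (mat_app m S y) (mat_app m S y) \<le> a * r\<^sup>2" using a by (intro mult_left_mono) auto
    also have "a * r\<^sup>2 = m / 2" using r by (simp add: a_def)
    finally have "1 \<le> exp (m / 2) * ?E y" by (simp add: exp_add[symmetric])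
    hence "r * M * 1 \<le> r * M * (exp (m / 2) * ?E y)" using r M_pos by (intro mult_left_mono) auto
    moreover have "r * h y \<le> r * M" using h_le r by (intro mult_left_mono) auto
    moreover have "0 \<le> h y * ?n y" using h_nonneg by simp
    ultimately show ?thesis by (simp add: mult.assoc)
  qed
  have int: "integrable (leb m) (\<lambda>y. r * h y - r * M * exp (m / 2) * ?E y)"
    by (intro Bochner_Integration.integrable_diff integrable_mult_right h_integrable integrable.intros[OF G])
  have "(\<integral>y. r * h y - r * M * exp (m / 2) * ?E y \<partial>leb m) \<le> J S"
    unfolding J_def by (rule integral_mono[OF int integrable_J pt])
  moreover have "(\<integral>y. r * h y - r * M * exp (m / 2) * ?E y \<partial>leb m) = r * L - r * M * exp (m / 2) * sqrt (pi / a) ^ m"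
    using G h_integrable by (subst Bochner_Integration.integral_diff)
      (auto simp: L_def has_bochner_integral_integral_eq intro: integrable.intros)
  moreover have "exp (m / 2) * sqrt (pi / a) ^ m \<le> L / (2 * M)"
  proof -
    have "sqrt (exp 1) = exp (1 / 2)"
      by (rule real_sqrt_unique) (simp_all add: power2_eq_square exp_add[symmetric])
    hence "exp (m / 2) = sqrt (exp 1) ^ m" by (simp add: exp_of_nat_mult[symmetric])
    hence "exp (m / 2) * sqrt (pi / a) ^ m = (sqrt (exp 1) * sqrt (pi / a)) ^ m" by (simp add: power_mult_distrib)
    also have "\<dots> \<le> s ^ m"
    proof (rule power_mono)
      have "exp 1 * (pi / a) = 2 * exp 1 * pi * r\<^sup>2 / m" using r m by (simp add: a_def)
      also have "\<dots> = (2 * exp 1 * pi / 25) * s\<^sup>2" using m by (simp add: r_def power_mult_distrib power_divide)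
      also have "\<dots> \<le> 1 * s\<^sup>2"
      proof (rule mult_right_mono)
        have "exp 1 * pi \<le> 3 * 4" using exp_le pi_less_4 by (intro mult_mono) auto
        thus "2 * exp 1 * pi / 25 \<le> 1" by simp
      qed simp
      finally show "sqrt (exp 1) * sqrt (pi / a) \<le> s"
        using s(1) by (simp add: real_sqrt_mult[symmetric] real_le_lsqrt real_sqrt_le_iff')
    qed (use a in simp)
    finally show ?thesis using s by simp
  qed
  hence "r * M * (exp (m / 2) * sqrt (pi / a) ^ m) \<le> r * M * (L / (2 * M))"
    using r M_pos by (intro mult_left_mono) auto
  hence "r * M * exp (m / 2) * sqrt (pi / a) ^ m \<le> r * L / 2" using M_pos by (simp add: mult.assoc)
  ultimately have "r * L / 2 \<le> J S" by simp
  \<comment> \<open>The factor 1/20 consists of 1/5 from the radius, 1/2 from the mass outside the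
    ball, and this 1/2, a crude lower bound for the m-th root of 1/2.\<close>
  moreover have "(L / M) powr (1 / m) / 2 \<le> s"
  proof -
    have "s = (L / M * (1 / 2)) powr (1 / m)" by (simp add: s_def mult.commute)
    hence "s = (L / M) powr (1 / m) * (1 / 2) powr (1 / m)"
      using Lp M_pos by (subst (asm) powr_mult) auto
    moreover have "(1 / 2 :: real) powr 1 \<le> (1 / 2) powr (1 / m)" using m by (intro powr_mono') auto
    ultimately show ?thesis using mult_left_mono[of "1/2" "(1 / 2) powr (1 / m)" "(L / M) powr (1 / m)"] by simp
  qed
  hence "L * sqrt m * ((L / M) powr (1 / m) / 2) / 10 \<le> L * sqrt m * s / 10"
    using Lp by (intro divide_right_mono mult_left_mono) auto
  hence "L * sqrt m * (L / M) powr (1 / m) / 20 \<le> r * L / 2" by (simp add: r_def mult.commute mult.left_commute)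
  ultimately show ?thesis by linarith
qed

lemma Jinf_lower: "L * sqrt m * (L / M) powr (1 / m) / 20 \<le> Jinf"
  unfolding Jinf_def by (rule cInf_greatest) (use one_SL J_lower in auto)

text \<open>A perturbation of size \<open>t\<close> changes \<open>J\<close> by a multiple of
  \<open>t\<close> times a moment, with an error of order \<open>t\<^sup>2\<close>, and cannot push
  it below \<open>Jinf\<close>. The gap \<open>t\<^sup>2\<close> between \<open>J S\<close> and
  \<open>Jinf\<close> is of the order of this error, so dividing by \<open>t\<close> leaves moments
  of order \<open>t\<close>.\<close>

lemma almost_isotropic:
  assumes S: "S \<in> SL" "J S < Jinf + t\<^sup>2" and t: "0 < t" "t \<le> 1" and ij: "i < m" "j < m"
  shows "i \<noteq> j \<Longrightarrow> \<bar>moment S i j\<bar> \<le> t * (Jinf + 3)"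
    and "\<bar>moment S i i - Jinf / m\<bar> \<le> t * (Jinf + 4)"
proof -
  have "t\<^sup>2 \<le> t" using t by (simp add: power2_eq_square mult_left_le)
  hence J1: "J S < Jinf + t" "J S \<le> Jinf + 1" using S t by auto
  have tJ: "t * J S \<le> t * (Jinf + 1)" using J1 t by simp
  show "\<bar>moment S i j\<bar> \<le> t * (Jinf + 3)" if "i \<noteq> j"
  proof -
    have "- (c * moment S i j) \<le> t * (Jinf + 3)" if c: "c = 1 \<or> c = -1" for c
    proof -
      obtain S' where "S' \<in> SL" "J S' \<le> J S + (t * c) * moment S i j + (t * c)\<^sup>2 / 2 * J S"
        using perturb_addrow[OF S(1) ij \<open>i \<noteq> j\<close>, of "t * c"] by blast
      hence "Jinf \<le> J S + t * c * moment S i j + t\<^sup>2 / 2 * J S"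
        using Jinf_le[of S'] c by (auto simp: power_mult_distrib)
      hence "- (t * c * moment S i j) \<le> t\<^sup>2 + t\<^sup>2 / 2 * J S" using S(2) by linarith
      also have "\<dots> \<le> t\<^sup>2 + t\<^sup>2 * (Jinf + 1)"
        using J1 J_nonneg[of S] mult_left_mono[of "J S / 2" "Jinf + 1" "t\<^sup>2"] by simp
      also have "\<dots> \<le> t * (t * (Jinf + 3))"
        using t by (simp add: power2_eq_square algebra_simps)
      finally have "t * (- (c * moment S i j)) \<le> t * (t * (Jinf + 3))" by (simp add: mult.assoc)
      thus ?thesis using t(1) by (simp only: mult_le_cancel_left_pos)
    qed
    from this[of 1] this[of "-1"] show ?thesis by (simp add: abs_le_iff)
  qed
  \<comment> \<open>Since \<open>a\<close> and \<open>b\<close> may be exchanged, all diagonal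
    entries agree up to order \<open>t\<close>. They sum to \<open>J S\<close>, so each is close to
    \<open>Jinf / m\<close>.\<close>
  have diff: "moment S b b - moment S a a \<le> t * (Jinf + 3)" if ab: "a < m" "b < m" for a b
  proof (cases "a = b")
    case True
    have "0 \<le> Jinf" using Jinf_def by (metis J_nonneg cINF_greatest empty_iff one_SL)
    thus ?thesis using True t by simp
  next
    case False
    obtain S' where S': "S' \<in> SL" "J S' \<le> J S + (t * moment S a a - t / (1 + t) * moment S b b) / 2"
      using perturb_multrow[OF S(1) ab False t(1)] by blast
    have "t / (1 + t) * moment S b b = t * (moment S b b / (1 + t))" by simp
    hence "t * (moment S b b / (1 + t)) - t * moment S a a \<le> 2 * t\<^sup>2"
      using Jinf_le[OF S'(1)] S(2) S'(2) by (simp add: field_simps)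
    hence "t * (moment S b b / (1 + t) - moment S a a) \<le> t * (2 * t)"
      by (simp only: right_diff_distrib power2_eq_square mult.left_commute)
    hence 1: "moment S b b / (1 + t) - moment S a a \<le> 2 * t" using t by simp
    have "moment S b b - moment S b b / (1 + t) = t / (1 + t) * moment S b b" using t by (simp add: field_simps)
    also have "\<dots> \<le> t * moment S b b" using t moment_diag(1)[OF ab(2)] by (intro mult_right_mono) (auto simp: field_simps)
    also have "\<dots> \<le> t * J S" using t moment_diag(2)[OF ab(2)] by (intro mult_left_mono) auto
    finally show ?thesis using 1 tJ by (simp add: algebra_simps)
  qed
  have avg: "real m * moment S i i - J S = (\<Sum>a<m. moment S i i - moment S a a)"
    by (simp add: sum_subtractf moment_diag(3))
  have up: "real m * moment S i i - J S \<le> real m * (t * (Jinf + 3))"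
    unfolding avg using sum_mono[of "{..<m}" "\<lambda>a. moment S i i - moment S a a" "\<lambda>_. t * (Jinf + 3)"] diff ij by simp
  have "(\<Sum>a<m. moment S a a - moment S i i) \<le> real m * (t * (Jinf + 3))"
    using sum_mono[of "{..<m}" "\<lambda>a. moment S a a - moment S i i" "\<lambda>_. t * (Jinf + 3)"] diff ij by simp
  hence lo: "J S - real m * moment S i i \<le> real m * (t * (Jinf + 3))"
    by (simp add: sum_subtractf moment_diag(3))
  have mt: "t \<le> real m * t" "0 \<le> real m * t" using m t by (auto simp: mult_le_cancel_right1)
  have "real m * (t * (Jinf + 4)) = real m * (t * (Jinf + 3)) + real m * t" by (simp add: algebra_simps)
  hence "\<bar>real m * moment S i i - Jinf\<bar> \<le> real m * (t * (Jinf + 4))"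
    using up lo J1 Jinf_le[OF S(1)] mt by linarith
  moreover have "real m * moment S i i - Jinf = real m * (moment S i i - Jinf / m)"
    using m by (simp add: right_diff_distrib)
  ultimately have "\<bar>real m * (moment S i i - Jinf / m)\<bar> \<le> real m * (t * (Jinf + 4))" by simp
  thus "\<bar>moment S i i - Jinf / m\<bar> \<le> t * (Jinf + 4)"
    using m by (simp add: abs_mult)
qed

text \<open>
  Hadamard gives |det u| >= (det u)^2 / prod |u_j|; the square of the determinant is a double sum over
  permutations, and each term integrates to a product of entries of moment S.
\<close>

lemma det_moment_lower:
  assumes S: "S \<in> SL"
  shows "ennreal (\<Sum>p\<in>{p. p permutes {..<m}}. \<Sum>q\<in>{q. q permutes {..<m}}. signof p * signof q * (\<Prod>j<m. moment S (p j) (q j)))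
    \<le> (\<integral>\<^sup>+ Z. (\<Prod>j<m. ennreal (h (Z j))) * ennreal \<bar>tuple_det m Z\<bar> \<partial>tuples m m)"
proof -
  interpret product_sigma_finite "\<lambda>_::nat. leb m" by (rule leb.product_sigma_finite)
  let ?P = "{p. p permutes {..<m}}"
  let ?u = "\<lambda>Z j. mat_app m S (Z j)"
  define \<phi> where "\<phi> a b y = h y * (mat_app m S y a * mat_app m S y b / enorm m (mat_app m S y))" for a b y
  define F where "F Z = (\<Sum>p\<in>?P. \<Sum>q\<in>?P. signof p * signof q * (\<Prod>j<m. \<phi> (p j) (q j) (Z j)))" for Z
  have Sc: "S \<in> carrier_mat m m" and S1: "det S = 1" using S by (auto simp: SL_def)
  have int\<phi>: "integrable (leb m) (\<phi> (p j) (q j))" if "p \<in> ?P" "q \<in> ?P" "j < m" for p q j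
    unfolding \<phi>_def using that permutes_in_image[of p "{..<m}" j] permutes_in_image[of q "{..<m}" j]
    by (intro integrable_moment) auto
  have intprod: "integrable (tuples m m) (\<lambda>Z. \<Prod>j<m. \<phi> (p j) (q j) (Z j))" if "p \<in> ?P" "q \<in> ?P" for p q
    by (rule product_integrable_prod) (use that int\<phi> in auto)
  have eqprod: "(\<integral>Z. (\<Prod>j<m. \<phi> (p j) (q j) (Z j)) \<partial>tuples m m) = (\<Prod>j<m. moment S (p j) (q j))" if "p \<in> ?P" "q \<in> ?P" for p q
  proof -
    have "(\<integral>Z. (\<Prod>j<m. \<phi> (p j) (q j) (Z j)) \<partial>tuples m m) = (\<Prod>j<m. (\<integral>y. \<phi> (p j) (q j) y \<partial>leb m))"
      by (rule product_integral_prod) (use that int\<phi> in auto)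
    thus ?thesis by (simp only: moment_def \<phi>_def)
  qed
  have intF: "integrable (tuples m m) F"
    unfolding F_def using intprod
    by (intro Bochner_Integration.integrable_sum integrable_mult_right) auto
  have intEq: "(\<integral>Z. F Z \<partial>tuples m m) = (\<Sum>p\<in>?P. \<Sum>q\<in>?P. signof p * signof q * (\<Prod>j<m. moment S (p j) (q j)))"
    unfolding F_def
  proof (subst Bochner_Integration.integral_sum, intro Bochner_Integration.integrable_sum integrable_mult_right intprod, assumption+,
      intro sum.cong refl, subst Bochner_Integration.integral_sum, intro integrable_mult_right intprod, assumption+, intro sum.cong refl)
    fix p q assume "p \<in> ?P" "q \<in> ?P"
    thus "(\<integral>Z. signof p * signof q * (\<Prod>j<m. \<phi> (p j) (q j) (Z j)) \<partial>tuples m m) = signof p * signof q * (\<Prod>j<m. moment S (p j) (q j))"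
      using eqprod by simp
  qed
  have F_eq: "F Z = (\<Prod>j<m. h (Z j) / enorm m (?u Z j)) * (tuple_det m (?u Z))\<^sup>2" for Z
  proof -
    have "(tuple_det m (?u Z))\<^sup>2 = (\<Sum>p\<in>?P. \<Sum>q\<in>?P. signof p * signof q * (\<Prod>j<m. ?u Z j (p j) * ?u Z j (q j)))"
      unfolding tuple_det_expand power2_eq_square sum_product prod.distrib
      by (intro sum.cong refl) (simp add: mult_ac)
    thus ?thesis unfolding F_def sum_distrib_left \<phi>_def
      by (auto simp: prod.distrib[symmetric] mult_ac sum_distrib_left intro!: sum.cong prod.cong)
  qed
  have dtu: "tuple_det m (?u Z) = tuple_det m Z" for Z
  proof -
    have "tuple_mat m (?u Z) = S * tuple_mat m Z"
      using Sc by (intro eq_matI) (auto simp: tuple_mat_def mat_app_def scalar_prod_def atLeast0LessThan)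
    thus ?thesis using S1 Sc by (simp add: tuple_det_def det_mult[of _ m])
  qed
  have F_nonneg: "0 \<le> F Z" for Z unfolding F_eq
    by (intro mult_nonneg_nonneg prod_nonneg) (auto simp: h_nonneg)
  have F_le: "F Z \<le> (\<Prod>j<m. h (Z j)) * \<bar>tuple_det m Z\<bar>" for Z
  proof (cases "\<exists>j<m. enorm m (?u Z j) = 0")
    \<comment> \<open>If some transformed column is 0, its quotient is 0 by convention and
      \<open>F Z\<close> vanishes; Hadamard's inequality is divided by the norms only in the other
      case.\<close>
    case True
    hence z: "(\<Prod>j<m. h (Z j) / enorm m (?u Z j)) = 0" by (intro prod_zero) auto
    show ?thesis unfolding F_eq z by (simp add: h_nonneg prod_nonneg)
  next
    case False
    hence pos: "enorm m (?u Z j) > 0" if "j < m" for j using enorm_nonneg[of m "?u Z j"] that by (metis less_le)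
    have had: "\<bar>tuple_det m (?u Z)\<bar> \<le> (\<Prod>j<m. enorm m (?u Z j))"
      unfolding enorm_def by (rule hadamard) simp
    have "F Z = (\<Prod>j<m. h (Z j)) * \<bar>tuple_det m Z\<bar> * (\<bar>tuple_det m (?u Z)\<bar> / (\<Prod>j<m. enorm m (?u Z j)))"
      unfolding F_eq prod_dividef by (simp add: dtu power2_eq_square)
    also have "\<dots> \<le> (\<Prod>j<m. h (Z j)) * \<bar>tuple_det m Z\<bar> * 1"
      using had pos by (intro mult_left_mono mult_nonneg_nonneg prod_nonneg) (auto simp: h_nonneg divide_le_eq prod_pos)
    finally show ?thesis by simp
  qed
  have "ennreal (\<integral>Z. F Z \<partial>tuples m m) = (\<integral>\<^sup>+ Z. ennreal (F Z) \<partial>tuples m m)"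
    by (rule nn_integral_eq_integral[symmetric, OF intF]) (simp add: F_nonneg)
  also have "\<dots> \<le> (\<integral>\<^sup>+ Z. (\<Prod>j<m. ennreal (h (Z j))) * ennreal \<bar>tuple_det m Z\<bar> \<partial>tuples m m)"
    using F_le by (intro nn_integral_mono) (simp add: prod_ennreal h_nonneg ennreal_mult[symmetric] prod_nonneg)
  finally show ?thesis unfolding intEq .
qed

text \<open>Along near-minimisers the moment matrix tends to \<open>Jinf / m\<close> times the
  identity. In the limit only the pairs of equal permutations survive in the double sum.\<close>

lemma det_integral_lower_Jinf:
  "ennreal (fact m * (Jinf / m) ^ m) \<le> (\<integral>\<^sup>+ Z. (\<Prod>j<m. ennreal (h (Z j))) * ennreal \<bar>tuple_det m Z\<bar> \<partial>tuples m m)"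
    (is "_ \<le> ?I")
proof -
  let ?P = "{p. p permutes {..<m}}"
  let ?t = "\<lambda>r. inverse (real (Suc r))"
  have "\<forall>r. \<exists>S\<in>SL. J S < Jinf + (?t r)\<^sup>2" using Jinf_approx by simp
  then obtain S where S: "\<And>r. S r \<in> SL" "\<And>r. J (S r) < Jinf + (?t r)\<^sup>2" by metis
  have t: "0 < ?t r" "?t r \<le> 1" for r by (auto simp: field_simps)
  have t0: "(\<lambda>r. ?t r * c) \<longlonglongrightarrow> 0" for c
    by (rule tendsto_mult_left_zero[OF LIMSEQ_inverse_real_of_nat])
  have lim: "(\<lambda>r. moment (S r) i j) \<longlonglongrightarrow> (if i = j then Jinf / m else 0)" if "i < m" "j < m" for i j
  proof (cases "i = j")
    case True
    have "(\<lambda>r. moment (S r) i i - Jinf / m) \<longlonglongrightarrow> 0"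
      by (rule Lim_null_comparison[OF _ t0[of "Jinf + 4"]], intro always_eventually allI, simp only: real_norm_def)
         (rule almost_isotropic(2)[OF S t that(1) that(1)])
    thus ?thesis using True by (simp add: LIM_zero_iff)
  next
    case False
    have "(\<lambda>r. moment (S r) i j) \<longlonglongrightarrow> 0"
      by (rule Lim_null_comparison[OF _ t0[of "Jinf + 3"]], intro always_eventually allI, simp only: real_norm_def)
         (rule almost_isotropic(1)[OF S t that False])
    thus ?thesis using False by simp
  qed
  let ?D = "\<lambda>N. \<Sum>p\<in>?P. \<Sum>q\<in>?P. signof p * signof q * (\<Prod>j<m. N (p j) (q j)) :: real"
  have "(\<lambda>r. ?D (moment (S r))) \<longlonglongrightarrow> ?D (\<lambda>i j. if i = j then Jinf / m else 0)"
    by (intro tendsto_sum tendsto_mult tendsto_const tendsto_prod lim) (auto dest: permutes_in_image)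
  moreover have "?D (\<lambda>i j. if i = j then Jinf / m else 0) = fact m * (Jinf / m) ^ m"
  proof -
    have "(\<Sum>q\<in>?P. signof p * signof q * (\<Prod>j<m. if p j = q j then Jinf / m else 0)) = (Jinf / m) ^ m" if p: "p \<in> ?P" for p
    proof -
      have "(\<Sum>q\<in>?P. signof p * signof q * (\<Prod>j<m. if p j = q j then Jinf / m else 0 :: real)) =
         (\<Sum>q\<in>?P. if q = p then (Jinf / m) ^ m else 0)"
      proof (rule sum.cong[OF refl])
        fix q assume q: "q \<in> ?P"
        show "signof p * signof q * (\<Prod>j<m. if p j = q j then Jinf / m else 0) = (if q = p then (Jinf / m) ^ m else 0)"
        proof (cases "q = p")
          case True
          have "signof p * signof p = (1::real)" by (simp add: sign_def)
          thus ?thesis using True by simp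
        next
          case False
          then obtain j where j: "q j \<noteq> p j" by blast
          have "j < m" using j p q by (metis lessThan_iff mem_Collect_eq permutes_def)
          hence "(\<Prod>j<m. if p j = q j then Jinf / m else 0 :: real) = 0"
            using j by (intro prod_zero) (auto intro!: bexI[of _ j])
          thus ?thesis using False by simp
        qed
      qed
      also have "\<dots> = (Jinf / m) ^ m" using p finite_permutations[of "{..<m}"] by simp
      finally show ?thesis .
    qed
    hence "?D (\<lambda>i j. if i = j then Jinf / m else 0) = (\<Sum>p\<in>?P. (Jinf / m) ^ m)" by (intro sum.cong) auto
    also have "\<dots> = fact m * (Jinf / m) ^ m" by (simp add: card_permutations[of _ m])
    finally show ?thesis .
  qed
  ultimately have "(\<lambda>r. ennreal (?D (moment (S r)))) \<longlonglongrightarrow> ennreal (fact m * (Jinf / m) ^ m)"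
    by (intro tendsto_ennrealI) simp
  thus ?thesis by (rule LIMSEQ_le_const2) (use det_moment_lower[OF S(1)] in auto)
qed

lemma det_integral_lower:
  "ennreal (kappa m * L ^ Suc m / M) \<le> (\<integral>\<^sup>+ Z. (\<Prod>j<m. ennreal (h (Z j))) * ennreal \<bar>tuple_det m Z\<bar> \<partial>tuples m m)"
proof -
  have Lp: "L > 0" using L_pos by (simp add: L_def)
  let ?b = "L * sqrt m * (L / M) powr (1 / m) / 20"
  have "?b / m = L * (L / M) powr (1 / m) / (20 * sqrt m)" using m by (simp add: field_simps)
  hence "(?b / m) ^ m = L ^ m * ((L / M) powr (1 / m)) ^ m / (20 ^ m * sqrt m ^ m)"
    by (simp add: power_mult_distrib power_divide)
  also have "((L / M) powr (1 / m)) ^ m = L / M"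
    using Lp M_pos m by (simp add: powr_realpow[symmetric] powr_powr)
  finally have eq0: "(?b / m) ^ m = L ^ m * (L / M) / (20 ^ m * sqrt m ^ m)" .
  have eq: "fact m * (?b / m) ^ m = kappa m * L ^ Suc m / M" unfolding eq0 kappa_def by (simp add: mult_ac)
  have "kappa m * L ^ Suc m / M \<le> fact m * (Jinf / m) ^ m"
    unfolding eq[symmetric] using Jinf_lower m Lp M_pos
    by (intro mult_left_mono power_mono divide_right_mono) auto
  thus ?thesis using det_integral_lower_Jinf order_trans ennreal_leI by blast
qed

lemma prod_integral: "(\<integral>\<^sup>+ Z. (\<Prod>j<m. ennreal (h (Z j))) \<partial>tuples m m) = ennreal (L ^ m)"
proof -
  have "(\<integral>\<^sup>+ Z. (\<Prod>j<m. ennreal (h (Z j))) \<partial>tuples m m) = (\<Prod>j<m. \<integral>\<^sup>+ x. ennreal (h x) \<partial>leb m)"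
    by (rule nn_integral_tuples_prod) (use h_meas in measurable)
  also have "(\<integral>\<^sup>+ x. ennreal (h x) \<partial>leb m) = ennreal L"
    unfolding L_def by (rule nn_integral_eq_integral[OF h_integrable]) (simp add: h_nonneg)
  finally show ?thesis using L_pos by (simp add: ennreal_power L_def)
qed

end

text \<open>The graph of the power function lies above its tangent at \<open>B\<close>. In this form
  Jensen's inequality applies to a measure whose mass is not 1.\<close>

lemma tangent_power_le:
  fixes x B :: real
  assumes "0 \<le> x" "0 \<le> B"
  shows "real (Suc l) * B ^ l * x \<le> x ^ Suc l + real l * B ^ Suc l"
proof (induction l)
  case (Suc l)
  have "(x ^ Suc l - B ^ Suc l) * (x - B) \<ge> 0"
  proof (cases "x \<ge> B")
    case True thus ?thesis using assms by (intro mult_nonneg_nonneg) (auto simp: power_mono simp del: power_Suc)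
  next
    case False thus ?thesis using assms by (intro mult_nonpos_nonpos) (auto simp: power_mono simp del: power_Suc)
  qed
  hence "B * x ^ Suc l + B ^ Suc l * x \<le> x ^ Suc (Suc l) + B ^ Suc (Suc l)"
    by (simp add: algebra_simps)
  moreover have "B * (real (Suc l) * B ^ l * x) \<le> B * (x ^ Suc l + real l * B ^ Suc l)"
    by (rule mult_left_mono[OF Suc assms(2)])
  ultimately show ?case by (simp add: algebra_simps)
qed simp

section \<open>From the first to the k-th power of the determinant\<close>

context bounded_density
begin

text \<open>Jensen's inequality for the k-th power. The point of tangency \<open>B\<close> is the
  known lower bound for the mean of the absolute determinant, that is,
  \<open>kappa m * L ^ Suc m / M\<close> divided by the total mass \<open>L ^ m\<close>.\<close>

lemma det_power_integral_lower_aux: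
  assumes k: "k \<ge> 1"
  shows "ennreal (kappa m ^ k * L ^ (m + k) / M ^ k) \<le>
    (\<integral>\<^sup>+ Z. (\<Prod>j<m. ennreal (h (Z j))) * ennreal (\<bar>tuple_det m Z\<bar> ^ k) \<partial>tuples m m)"
proof -
  obtain l where l: "k = Suc l" using k by (cases k) auto
  have Lp: "L > 0" using L_pos by (simp add: L_def)
  have kp: "kappa m \<ge> 0" by (simp add: kappa_def)
  define B where "B = kappa m * L / M"
  have B: "B \<ge> 0" using kp Lp M_pos by (simp add: B_def)
  let ?P = "\<lambda>Z. \<Prod>j<m. ennreal (h (Z j))"
  let ?I = "\<integral>\<^sup>+ Z. ?P Z * ennreal (\<bar>tuple_det m Z\<bar> ^ k) \<partial>tuples m m"
  have Pm: "?P \<in> borel_measurable (tuples m m)"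
    by (intro borel_measurable_prod_ennreal measurable_compose[OF tuples_coord[OF measurable_ident_sets[OF refl]] measurable_compose[OF h_meas measurable_ennreal]]) auto
  have dm [measurable]: "(\<lambda>Z. tuple_det m Z) \<in> borel_measurable (tuples m m)"
    by (rule tuple_det_measurable[OF measurable_ident_sets[OF refl]])
  note Pm [measurable]
  have "ennreal (real k * B ^ l) * ennreal (kappa m * L ^ Suc m / M) \<le>
     ennreal (real k * B ^ l) * (\<integral>\<^sup>+ Z. ?P Z * ennreal \<bar>tuple_det m Z\<bar> \<partial>tuples m m)"
    by (intro mult_left_mono det_integral_lower) simp
  also have "\<dots> = (\<integral>\<^sup>+ Z. ennreal (real k * B ^ l) * (?P Z * ennreal \<bar>tuple_det m Z\<bar>) \<partial>tuples m m)"
    by (rule nn_integral_cmult[symmetric]) measurable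
  also have "\<dots> \<le> (\<integral>\<^sup>+ Z. ?P Z * ennreal (\<bar>tuple_det m Z\<bar> ^ k) + ennreal (real l * B ^ k) * ?P Z \<partial>tuples m m)"
  proof (rule nn_integral_mono)
    fix Z
    have "ennreal (real k * B ^ l) * ennreal \<bar>tuple_det m Z\<bar> \<le> ennreal (\<bar>tuple_det m Z\<bar> ^ k) + ennreal (real l * B ^ k)"
      using tangent_power_le[of "\<bar>tuple_det m Z\<bar>" B l] B unfolding l
      by (simp add: ennreal_mult[symmetric] ennreal_plus[symmetric] del: ennreal_plus power_Suc of_nat_Suc)
    from mult_left_mono[OF this, of "?P Z"]
    show "ennreal (real k * B ^ l) * (?P Z * ennreal \<bar>tuple_det m Z\<bar>) \<le> ?P Z * ennreal (\<bar>tuple_det m Z\<bar> ^ k) + ennreal (real l * B ^ k) * ?P Z"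
      by (simp add: distrib_left mult_ac)
  qed
  also have "\<dots> = ?I + ennreal (real l * B ^ k) * (\<integral>\<^sup>+ Z. ?P Z \<partial>tuples m m)"
    by (subst nn_integral_add, measurable) (subst nn_integral_cmult, measurable)
  also have "(\<integral>\<^sup>+ Z. ?P Z \<partial>tuples m m) = ennreal (L ^ m)" by (rule prod_integral)
  also have "ennreal (real k * B ^ l) * ennreal (kappa m * L ^ Suc m / M) = ennreal (real l * B ^ k) * ennreal (L ^ m) + ennreal (B ^ k * L ^ m)"
  proof -
    have "real k * B ^ l * (kappa m * L ^ Suc m / M) = real l * B ^ k * L ^ m + B ^ k * L ^ m"
      unfolding l by (simp add: B_def algebra_simps)
    thus ?thesis using B kp Lp M_pos by (simp add: ennreal_mult[symmetric] ennreal_plus[symmetric] del: ennreal_plus)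
  qed
  finally have "ennreal (real l * B ^ k) * ennreal (L ^ m) + ennreal (B ^ k * L ^ m) \<le> ennreal (real l * B ^ k) * ennreal (L ^ m) + ?I"
    by (simp only: add.commute)
  \<comment> \<open>The constant term of the tangent has a finite integral, so it cancels in
    \<open>ennreal\<close>.\<close>
  hence "ennreal (B ^ k * L ^ m) \<le> ?I"
    unfolding ennreal_add_left_cancel_le by (simp add: ennreal_mult_eq_top_iff)
  moreover have "B ^ k * L ^ m = kappa m ^ k * L ^ (m + k) / M ^ k"
    by (simp add: B_def power_mult_distrib power_divide power_add)
  ultimately show ?thesis by simp
qed

end

text \<open>The general case follows from bounded support by monotone convergence; the integral of h may be infinite.\<close>

lemma det_power_integral_lower:
  assumes m: "m \<ge> 1" and k: "k \<ge> 1" and M: "M > 0"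
    and hm: "h \<in> borel_measurable (leb m)" and h0: "\<And>y. 0 \<le> h y" and hM: "\<And>y. h y \<le> M"
  shows "ennreal (kappa m ^ k / M ^ k) * (\<integral>\<^sup>+ y. ennreal (h y) \<partial>leb m) ^ (m + k) \<le>
    (\<integral>\<^sup>+ Z. (\<Prod>j<m. ennreal (h (Z j))) * ennreal (\<bar>tuple_det m Z\<bar> ^ k) \<partial>tuples m m)" (is "_ \<le> ?I")
proof -
  define hR where "hR R y = h y * (\<Prod>i<m. indicator {- real R..real R} (y i))" for R :: nat and y
  have hR_eq: "hR R y = (if \<forall>i<m. \<bar>y i\<bar> \<le> real R then h y else 0)" for R y
  proof (cases "\<forall>i<m. \<bar>y i\<bar> \<le> real R")
    case True
    hence "(\<Prod>i<m. indicator {- real R..real R} (y i) :: real) = (\<Prod>i<m. 1)"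
      by (intro prod.cong refl) (force simp: abs_le_iff indicator_def)
    thus ?thesis using True by (simp add: hR_def)
  next
    case False
    then obtain i where i: "i < m" "\<not> \<bar>y i\<bar> \<le> real R" by blast
    hence "(\<Prod>i<m. indicator {- real R..real R} (y i) :: real) = 0"
      by (intro prod_zero bexI[of _ i]) (auto simp: indicator_def abs_le_iff)
    thus ?thesis unfolding hR_def by (simp only: False if_False mult_zero_right)
  qed
  have cm: "(\<lambda>y. y i) \<in> borel_measurable (leb m)" for i
    by (rule leb_coord_measurable[OF measurable_ident_sets[OF refl]])
  have hRm: "hR R \<in> borel_measurable (leb m)" for R
    unfolding hR_def
    by (intro borel_measurable_times hm borel_measurable_prod measurable_compose[OF cm]) auto
  have hRm': "(\<lambda>y. ennreal (hR R y)) \<in> borel_measurable (leb m)" for R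
    by (rule measurable_compose[OF hRm measurable_ennreal])
  have hR0: "0 \<le> hR R y" "hR R y \<le> M" "hR R y \<le> h y" for R y using h0 hM M by (auto simp: hR_eq less_imp_le)
  have bound: "ennreal (kappa m ^ k / M ^ k) * (\<integral>\<^sup>+ y. ennreal (hR R y) \<partial>leb m) ^ (m + k) \<le> ?I" for R
  proof -
    \<comment> \<open>On the box the squared norm is at most \<open>m * (real R)\<^sup>2\<close>, so
      a multiple of a Gaussian dominates the truncated function and makes it integrable.\<close>
    have "hR R y \<le> M * exp (m * (real R)\<^sup>2) * exp (- 1 * ip m y y)" for y
    proof (cases "\<forall>i<m. \<bar>y i\<bar> \<le> real R")
      case True
      have "ip m y y \<le> (\<Sum>i<m. (real R)\<^sup>2)"
        unfolding ip_def power2_eq_square[symmetric] using True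
        by (intro sum_mono) (metis abs_le_square_iff abs_of_nat lessThan_iff)
      hence "1 \<le> exp (m * (real R)\<^sup>2) * exp (- 1 * ip m y y)" by (simp add: exp_add[symmetric])
      hence "M * 1 \<le> M * (exp (m * (real R)\<^sup>2) * exp (- 1 * ip m y y))" using M by (intro mult_left_mono) auto
      thus ?thesis using hR0(2)[of R y] by (simp add: mult.assoc)
    next
      case False
      show ?thesis unfolding hR_eq if_not_P[OF False] using M by simp
    qed
    hence "(\<integral>\<^sup>+ y. ennreal (hR R y) \<partial>leb m) \<le> (\<integral>\<^sup>+ y. ennreal (M * exp (m * (real R)\<^sup>2)) * ennreal (exp (- 1 * ip m y y)) \<partial>leb m)"
      using M by (intro nn_integral_mono) (simp add: ennreal_mult[symmetric])
    also have "\<dots> = ennreal (M * exp (m * (real R)\<^sup>2)) * (\<integral>\<^sup>+ y. ennreal (exp (- 1 * ip m y y)) \<partial>leb m)"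
    proof (rule nn_integral_cmult)
      have [measurable]: "(\<lambda>y. ip m y y) \<in> borel_measurable (leb m)" by (intro ip_measurable measurable_ident_sets[OF refl])
      show "(\<lambda>y. ennreal (exp (- 1 * ip m y y))) \<in> borel_measurable (leb m)" by measurable
    qed
    also have "\<dots> < \<infinity>" by (subst nn_integral_gauss_leb) (auto simp: ennreal_mult_less_top)
    finally have fin: "(\<integral>\<^sup>+ y. ennreal (hR R y) \<partial>leb m) < \<infinity>" .
    have int: "integrable (leb m) (hR R)"
      using hRm fin hR0 by (intro integrableI_nonneg) auto
    have eq: "(\<integral>\<^sup>+ y. ennreal (hR R y) \<partial>leb m) = ennreal (\<integral>y. hR R y \<partial>leb m)"
      by (rule nn_integral_eq_integral[OF int]) (simp add: hR0)
    have nn: "0 \<le> (\<integral>y. hR R y \<partial>leb m)" by (rule integral_nonneg_AE) (simp add: hR0)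
    \<comment> \<open>The locale requires positive mass; for mass 0 the left-hand side is 0.\<close>
    show ?thesis
    proof (cases "(\<integral>y. hR R y \<partial>leb m) = 0")
      case True
      have "(0::ennreal) ^ (m + k) = 0" using m by (simp add: power_0_left)
      thus ?thesis unfolding eq True by (simp del: power_eq_0_iff)
    next
      case False
      interpret bounded_density m "hR R" M "real R"
      proof unfold_locales
        show "0 < (\<integral>y. hR R y \<partial>leb m)" using nn False by (simp add: less_le)
        show "\<bar>y i\<bar> \<le> real R" if "hR R y \<noteq> 0" "i < m" for y i
          using that by (simp add: hR_eq split: if_splits)
      qed (use m M hRm hR0 in auto)
      have "ennreal (kappa m ^ k / M ^ k) * (\<integral>\<^sup>+ y. ennreal (hR R y) \<partial>leb m) ^ (m + k) = ennreal (kappa m ^ k * L ^ (m + k) / M ^ k)"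
        using nn M kappa_pos[OF m] unfolding eq L_def
        by (simp add: ennreal_power ennreal_mult[symmetric])
      also have "\<dots> \<le> (\<integral>\<^sup>+ Z. (\<Prod>j<m. ennreal (hR R (Z j))) * ennreal (\<bar>tuple_det m Z\<bar> ^ k) \<partial>tuples m m)"
        by (rule det_power_integral_lower_aux[OF k])
      also have "\<dots> \<le> ?I"
        by (intro nn_integral_mono mult_right_mono prod_mono_ennreal ennreal_leI hR0) simp
      finally show ?thesis .
    qed
  qed
  have "(\<lambda>R. \<integral>\<^sup>+ y. ennreal (hR R y) \<partial>leb m) \<longlonglongrightarrow> (\<integral>\<^sup>+ y. ennreal (h y) \<partial>leb m)"
  proof (rule nn_integral_LIMSEQ)
    show "incseq (\<lambda>R y. ennreal (hR R y))"
    proof (intro incseq_SucI le_funI ennreal_leI)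
      fix R y show "hR R y \<le> hR (Suc R) y" using h0 by (force simp: hR_eq)
    qed
    show "(\<lambda>y. ennreal (hR R y)) \<in> borel_measurable (leb m)" for R by (rule hRm')
    show "(\<lambda>R. ennreal (hR R y)) \<longlonglongrightarrow> ennreal (h y)" for y
    proof (rule tendsto_eventually)
      obtain R0 :: nat where R0: "(\<Sum>i<m. \<bar>y i\<bar>) \<le> real R0" using real_arch_simple by blast
      have "hR R y = h y" if "R \<ge> R0" for R
      proof -
        have "\<bar>y i\<bar> \<le> real R" if "i < m" for i
          using member_le_sum[of i "{..<m}" "\<lambda>i. \<bar>y i\<bar>"] that R0 \<open>R \<ge> R0\<close> by simp
        thus ?thesis by (simp add: hR_eq)
      qed
      thus "\<forall>\<^sub>F R in sequentially. ennreal (hR R y) = ennreal (h y)"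
        by (intro eventually_sequentiallyI[of R0]) simp
    qed
  qed
  moreover have "(\<lambda>R. f R ^ p) \<longlonglongrightarrow> l ^ p" if "f \<longlonglongrightarrow> l" for f :: "nat \<Rightarrow> ennreal" and l p
    using that by (induction p) (auto intro!: tendsto_mult_ennreal simp: power_eq_top_ennreal)
  ultimately have "(\<lambda>R. (\<integral>\<^sup>+ y. ennreal (hR R y) \<partial>leb m) ^ (m + k)) \<longlonglongrightarrow> (\<integral>\<^sup>+ y. ennreal (h y) \<partial>leb m) ^ (m + k)"
    by blast
  hence "(\<lambda>R. ennreal (kappa m ^ k / M ^ k) * (\<integral>\<^sup>+ y. ennreal (hR R y) \<partial>leb m) ^ (m + k)) \<longlonglongrightarrow>
     ennreal (kappa m ^ k / M ^ k) * (\<integral>\<^sup>+ y. ennreal (h y) \<partial>leb m) ^ (m + k)"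
    by (intro ennreal_tendsto_cmult) auto
  thus ?thesis by (rule LIMSEQ_le_const2) (use bound in auto)
qed

section \<open>An inequality of Blaschke--Petkantschin type\<close>

definition det_pow :: "nat \<Rightarrow> nat \<Rightarrow> (nat \<Rightarrow> nat \<Rightarrow> real) \<Rightarrow> ennreal" where
  "det_pow m p Z = ennreal (\<bar>tuple_det m Z\<bar> ^ p)"

lemma det_pow_measurable [measurable (raw)]:
  "f \<in> M \<rightarrow>\<^sub>M tuples m m \<Longrightarrow> (\<lambda>x. det_pow m p (f x)) \<in> borel_measurable M"
  unfolding det_pow_def
  by (intro measurable_compose[OF _ measurable_ennreal] borel_measurable_power borel_measurable_abs tuple_det_measurable)

lemma det_pow_mult: "det_pow m p Z * det_pow m q Z = det_pow m (p + q) Z"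
  by (simp add: det_pow_def ennreal_mult[symmetric] power_add)

lemma det_pow_tuple_mult: "det_pow m p (tuple_mult m X Z) = det_pow m p X * det_pow m p Z"
  by (simp add: det_pow_def tuple_det_tuple_mult ennreal_mult[symmetric] abs_mult power_mult_distrib)

lemma det_pow_neq_0: "tuple_det m Z \<noteq> 0 \<Longrightarrow> det_pow m p Z \<noteq> 0"
  by (simp add: det_pow_def)

lemma det_pow_neq_top: "det_pow m p Z \<noteq> top" by (simp add: det_pow_def)

lemma right_mult_det_pow:
  assumes "tuple_det m Z \<noteq> 0" "g \<in> borel_measurable (tuples n m)"
  shows "(\<integral>\<^sup>+ G. g G \<partial>tuples n m) = det_pow m n Z * (\<integral>\<^sup>+ G. g (tuple_mult m G Z) \<partial>tuples n m)"
  unfolding nn_integral_right_mult[OF assms] det_pow_def mult.assoc[symmetric]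
  using assms(1) by (simp add: ennreal_mult[symmetric])

lemma left_mult_det_pow:
  assumes "X \<in> space (tuples m m)" "tuple_det m X \<noteq> 0" "g \<in> borel_measurable (tuples m m)"
  shows "(\<integral>\<^sup>+ Z. g Z \<partial>tuples m m) = det_pow m m X * (\<integral>\<^sup>+ Z. g (tuple_mult m X Z) \<partial>tuples m m)"
  unfolding nn_integral_left_mult[OF assms] det_pow_def mult.assoc[symmetric]
  using assms(2) by (simp add: ennreal_mult[symmetric])

lemma sigma_tuples_nn_integral_measurable:
  assumes "(\<lambda>p. f (fst p) (snd p)) \<in> borel_measurable (N \<Otimes>\<^sub>M tuples n m)"
  shows "(\<lambda>x. \<integral>\<^sup>+ y. f x y \<partial>tuples n m) \<in> borel_measurable N"
  by (rule sigma_finite_measure.borel_measurable_nn_integral[OF sigma_finite_tuples]) (use assms in \<open>simp add: case_prod_beta'\<close>)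

definition gauss_det_moment :: "nat \<Rightarrow> nat \<Rightarrow> nat \<Rightarrow> (nat \<Rightarrow> nat \<Rightarrow> real) \<Rightarrow> ennreal" where
  "gauss_det_moment n m k Y = (\<integral>\<^sup>+ Z. gauss n m (tuple_mult m Y Z) * det_pow m k Z \<partial>tuples m m)"

definition det_moment :: "nat \<Rightarrow> nat \<Rightarrow> ennreal" where
  "det_moment m k = (\<integral>\<^sup>+ Z. gauss m m Z * det_pow m k Z \<partial>tuples m m)"

text \<open>
  For G of full rank this is det(G^T G)^(n/2), and it is 0 otherwise. Written as a quotient of
  integrals it is measurable, and its behaviour under G -> G S is a change of variables.
\<close>

definition gram_mat_power :: "nat \<Rightarrow> nat \<Rightarrow> nat \<Rightarrow> (nat \<Rightarrow> nat \<Rightarrow> real) \<Rightarrow> ennreal" where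
  "gram_mat_power n m k Y = det_moment m k / gauss_det_moment n m k Y"

lemma gauss_det_moment_measurable: "gauss_det_moment n m k \<in> borel_measurable (tuples n m)"
  unfolding gauss_det_moment_def by (rule sigma_tuples_nn_integral_measurable) measurable

lemma gram_mat_power_measurable [measurable (raw)]: "f \<in> M \<rightarrow>\<^sub>M tuples n m \<Longrightarrow> (\<lambda>x. gram_mat_power n m k (f x)) \<in> borel_measurable M"
proof -
  assume f: "f \<in> M \<rightarrow>\<^sub>M tuples n m"
  have "gram_mat_power n m k \<in> borel_measurable (tuples n m)" unfolding gram_mat_power_def using gauss_det_moment_measurable[of n m k] by measurable
  from measurable_compose[OF f this] show ?thesis .
qed

text \<open>Equality can fail only if the denominator is 0 or infinite, and then the product is 0 in
  \<open>ennreal\<close>. This one-sided form is the source of the inequality sign in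
  \<open>blaschke_petkantschin\<close>.\<close>

lemma gram_mat_power_gauss_det_moment_le: "gram_mat_power n m k Y * gauss_det_moment n m k Y \<le> det_moment m k"
proof (cases "gauss_det_moment n m k Y = 0 \<or> gauss_det_moment n m k Y = top")
  case True
  thus ?thesis by (auto simp: gram_mat_power_def)
next
  case False
  hence "gauss_det_moment n m k Y / gauss_det_moment n m k Y = 1" by (intro ennreal_divide_self) (auto simp: less_top)
  thus ?thesis by (simp add: gram_mat_power_def ennreal_divide_times)
qed

context
  fixes n m k :: nat
  assumes nmk: "n = m + k"
begin

text \<open>Replacing Z by S Z in the denominator gives |det S|^m from the change of variables and
  |det S|^k from the integrand; together this is the degree n = m + k.\<close>

lemma gram_mat_power_tuple_mult:
  assumes Y: "Y \<in> space (tuples n m)" and S: "S \<in> space (tuples m m)" "tuple_det m S \<noteq> 0"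
  shows "gram_mat_power n m k (tuple_mult m Y S) = det_pow m n S * gram_mat_power n m k Y"
proof -
  have "(\<lambda>Z. gauss n m (tuple_mult m Y Z) * det_pow m k Z) \<in> borel_measurable (tuples m m)" using Y by measurable
  from left_mult_det_pow[OF S this]
  have "gauss_det_moment n m k Y = det_pow m m S * (\<integral>\<^sup>+ Z. gauss n m (tuple_mult m (tuple_mult m Y S) Z) * (det_pow m k S * det_pow m k Z) \<partial>tuples m m)"
    by (simp add: gauss_det_moment_def tuple_mult_assoc det_pow_tuple_mult)
  also have "(\<integral>\<^sup>+ Z. gauss n m (tuple_mult m (tuple_mult m Y S) Z) * (det_pow m k S * det_pow m k Z) \<partial>tuples m m) =
     (\<integral>\<^sup>+ Z. det_pow m k S * (gauss n m (tuple_mult m (tuple_mult m Y S) Z) * det_pow m k Z) \<partial>tuples m m)"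
    by (simp add: mult_ac)
  also have "\<dots> = det_pow m k S * gauss_det_moment n m k (tuple_mult m Y S)"
    unfolding gauss_det_moment_def by (rule nn_integral_cmult) (use tuple_mult_space[OF Y, of S] in measurable)
  finally have eq: "gauss_det_moment n m k Y = det_pow m n S * gauss_det_moment n m k (tuple_mult m Y S)"
    by (simp add: mult.assoc[symmetric] det_pow_mult nmk)
  have "det_pow m n S * gram_mat_power n m k Y = det_pow m n S * det_moment m k / (det_pow m n S * gauss_det_moment n m k (tuple_mult m Y S))"
    by (simp add: gram_mat_power_def eq ennreal_times_divide)
  also have "\<dots> = det_moment m k / gauss_det_moment n m k (tuple_mult m Y S)"
    using divide_mult_eq[of "det_pow m n S" "det_moment m k" "gauss_det_moment n m k (tuple_mult m Y S)"] det_pow_neq_0[OF S(2)] det_pow_neq_top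
    by (simp add: mult.commute[of _ "det_pow m n S"])
  finally show ?thesis by (simp add: gram_mat_power_def)
qed

text \<open>
  Both sides are multiplied by the integral of the Gaussian weight of a further m x m matrix X; then
  X is replaced by X Z, next G by G X, and finally X Z by Z. All substitutions are linear, so the
  invariance of the Haar measure of GL(m) under inversion is not needed.
\<close>

theorem blaschke_petkantschin:
  assumes g [measurable]: "g \<in> borel_measurable (tuples n m)"
  shows "(\<integral>\<^sup>+ G. gauss n m G * gram_mat_power n m k G * (\<integral>\<^sup>+ Z. g (tuple_mult m G Z) * det_pow m k Z \<partial>tuples m m) \<partial>tuples n m) \<le> det_moment m k * (\<integral>\<^sup>+ G. g G \<partial>tuples n m)"
proof -
  let ?M = "tuples m m" and ?N = "tuples n m"
  define A where "A = (\<integral>\<^sup>+ X. gauss m m X \<partial>?M)"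
  have A: "A \<noteq> 0" "A \<noteq> top" unfolding A_def nn_integral_gauss by auto
  let ?LHS = "\<integral>\<^sup>+ G. gauss n m G * gram_mat_power n m k G * (\<integral>\<^sup>+ Z. g (tuple_mult m G Z) * det_pow m k Z \<partial>?M) \<partial>?N"
  note meas = sigma_tuples_nn_integral_measurable
  have gm [measurable (raw)]: "(\<lambda>x. g (f x)) \<in> borel_measurable N" if "f \<in> N \<rightarrow>\<^sub>M ?N" for f and N :: "'z measure"
    by (rule measurable_compose[OF that g])
  define V where "V X Z = (\<integral>\<^sup>+ G. gauss n m (tuple_mult m G X) * gram_mat_power n m k G * g (tuple_mult m G Z) \<partial>?N)" for X Z
  have Vm [measurable (raw)]: "(\<lambda>x. V (a x) (b x)) \<in> borel_measurable N" if [measurable]: "a \<in> N \<rightarrow>\<^sub>M ?M" "b \<in> N \<rightarrow>\<^sub>M ?M" for a b and N :: "'z measure"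
    unfolding V_def by (intro meas) measurable
  have "?LHS = (\<integral>\<^sup>+ G. \<integral>\<^sup>+ Z. gauss n m G * gram_mat_power n m k G * (g (tuple_mult m G Z) * det_pow m k Z) \<partial>?M \<partial>?N)"
    by (rule nn_integral_cong, rule nn_integral_cmult[symmetric]) measurable
  also have "\<dots> = (\<integral>\<^sup>+ Z. \<integral>\<^sup>+ G. gauss n m G * gram_mat_power n m k G * (g (tuple_mult m G Z) * det_pow m k Z) \<partial>?N \<partial>?M)"
    by (rule nn_integral_swap[OF sigma_finite_tuples sigma_finite_tuples]) measurable
  also have "\<dots> = (\<integral>\<^sup>+ Z. det_pow m k Z * (\<integral>\<^sup>+ G. gauss n m G * gram_mat_power n m k G * g (tuple_mult m G Z) \<partial>?N) \<partial>?M)"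
  proof (rule nn_integral_cong)
    fix Z assume Z: "Z \<in> space ?M"
    have "(\<integral>\<^sup>+ G. gauss n m G * gram_mat_power n m k G * (g (tuple_mult m G Z) * det_pow m k Z) \<partial>?N) = (\<integral>\<^sup>+ G. det_pow m k Z * (gauss n m G * gram_mat_power n m k G * g (tuple_mult m G Z)) \<partial>?N)"
      by (simp only: mult_ac)
    also have "\<dots> = det_pow m k Z * (\<integral>\<^sup>+ G. gauss n m G * gram_mat_power n m k G * g (tuple_mult m G Z) \<partial>?N)"
      by (rule nn_integral_cmult) (use Z in measurable)
    finally show "(\<integral>\<^sup>+ G. gauss n m G * gram_mat_power n m k G * (g (tuple_mult m G Z) * det_pow m k Z) \<partial>?N) = det_pow m k Z * (\<integral>\<^sup>+ G. gauss n m G * gram_mat_power n m k G * g (tuple_mult m G Z) \<partial>?N)" .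
  qed
  finally have L1: "?LHS = (\<integral>\<^sup>+ Z. det_pow m k Z * (\<integral>\<^sup>+ G. gauss n m G * gram_mat_power n m k G * g (tuple_mult m G Z) \<partial>?N) \<partial>?M)" .
  have Wm: "(\<lambda>Z. \<integral>\<^sup>+ G. gauss n m G * gram_mat_power n m k G * g (tuple_mult m G Z) \<partial>?N) \<in> borel_measurable ?M"
    by (rule meas) measurable
  have "A * ?LHS = (\<integral>\<^sup>+ Z. A * (det_pow m k Z * (\<integral>\<^sup>+ G. gauss n m G * gram_mat_power n m k G * g (tuple_mult m G Z) \<partial>?N)) \<partial>?M)"
    unfolding L1 by (rule nn_integral_cmult[symmetric]) (use Wm in measurable)
  also have "\<dots> = (\<integral>\<^sup>+ Z. \<integral>\<^sup>+ X. det_pow m n Z * gauss m m (tuple_mult m X Z) * det_pow m (2 * n) X * V X (tuple_mult m X Z) \<partial>?M \<partial>?M)"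
  proof (rule nn_integral_cong_AE, use AE_tuple_det_nonzero[of m] AE_space in eventually_elim)
    fix Z assume dZ: "tuple_det m Z \<noteq> 0" and Z: "Z \<in> space ?M"
    let ?W = "\<integral>\<^sup>+ G. gauss n m G * gram_mat_power n m k G * g (tuple_mult m G Z) \<partial>?N"
    show "A * (det_pow m k Z * ?W) = (\<integral>\<^sup>+ X. det_pow m n Z * gauss m m (tuple_mult m X Z) * det_pow m (2 * n) X * V X (tuple_mult m X Z) \<partial>?M)"
    proof -
      \<comment> \<open>\<open>G\<close> is replaced by \<open>G X\<close>. One factor |det X|^n
        comes from the measure, the second one from the homogeneity of
        \<open>gram_mat_power\<close>.\<close>
      have Wt: "?W = det_pow m (2 * n) X * V X (tuple_mult m X Z)" if X: "X \<in> space ?M" "tuple_det m X \<noteq> 0" for X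
      proof -
        have "?W = det_pow m n X * (\<integral>\<^sup>+ G. gauss n m (tuple_mult m G X) * gram_mat_power n m k (tuple_mult m G X) * g (tuple_mult m (tuple_mult m G X) Z) \<partial>?N)"
          by (rule right_mult_det_pow[OF X(2)]) (use Z in measurable)
        also have "(\<integral>\<^sup>+ G. gauss n m (tuple_mult m G X) * gram_mat_power n m k (tuple_mult m G X) * g (tuple_mult m (tuple_mult m G X) Z) \<partial>?N) =
            (\<integral>\<^sup>+ G. det_pow m n X * (gauss n m (tuple_mult m G X) * gram_mat_power n m k G * g (tuple_mult m G (tuple_mult m X Z))) \<partial>?N)"
          by (rule nn_integral_cong) (simp add: gram_mat_power_tuple_mult X tuple_mult_assoc mult_ac)
        also have "\<dots> = det_pow m n X * V X (tuple_mult m X Z)"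
          unfolding V_def by (rule nn_integral_cmult) (use X Z in measurable)
        finally show ?thesis by (simp add: mult.assoc[symmetric] det_pow_mult mult_2)
      qed
      have "A = det_pow m m Z * (\<integral>\<^sup>+ X. gauss m m (tuple_mult m X Z) \<partial>?M)"
        unfolding A_def by (rule right_mult_det_pow[OF dZ]) measurable
      hence "A * (det_pow m k Z * ?W) = (det_pow m m Z * det_pow m k Z * ?W) * (\<integral>\<^sup>+ X. gauss m m (tuple_mult m X Z) \<partial>?M)"
        by (simp add: mult_ac)
      also have "\<dots> = (\<integral>\<^sup>+ X. (det_pow m m Z * det_pow m k Z * ?W) * gauss m m (tuple_mult m X Z) \<partial>?M)"
        by (rule nn_integral_cmult[symmetric]) (use Z in measurable)
      also have "\<dots> = (\<integral>\<^sup>+ X. det_pow m n Z * gauss m m (tuple_mult m X Z) * det_pow m (2 * n) X * V X (tuple_mult m X Z) \<partial>?M)"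
      proof (rule nn_integral_cong_AE, use AE_tuple_det_nonzero[of m] AE_space in eventually_elim)
        fix X assume X: "tuple_det m X \<noteq> 0" "X \<in> space ?M"
        show "(det_pow m m Z * det_pow m k Z * ?W) * gauss m m (tuple_mult m X Z) = det_pow m n Z * gauss m m (tuple_mult m X Z) * det_pow m (2 * n) X * V X (tuple_mult m X Z)"
          unfolding Wt[OF X(2,1)] det_pow_mult nmk[symmetric] by (simp add: mult_ac)
      qed
      finally show ?thesis .
    qed
  qed
  also have "\<dots> = (\<integral>\<^sup>+ X. \<integral>\<^sup>+ Z. det_pow m n Z * gauss m m (tuple_mult m X Z) * det_pow m (2 * n) X * V X (tuple_mult m X Z) \<partial>?M \<partial>?M)"
    by (rule nn_integral_swap[OF sigma_finite_tuples sigma_finite_tuples]) measurable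
  \<comment> \<open>With \<open>X\<close> fixed, X Z is replaced by Z. Of the 2n factors |det X|, n
    are spent on turning |det Z|^n into |det (X Z)|^n and m on the substitution; k of them
    remain.\<close>
  also have "\<dots> = (\<integral>\<^sup>+ X. \<integral>\<^sup>+ Z. det_pow m n Z * gauss m m Z * (det_pow m k X * V X Z) \<partial>?M \<partial>?M)"
  proof (rule nn_integral_cong_AE, use AE_tuple_det_nonzero[of m] AE_space in eventually_elim)
    fix X assume X: "tuple_det m X \<noteq> 0" "X \<in> space ?M"
    let ?H = "\<lambda>Z. det_pow m n Z * gauss m m Z * V X Z"
    have Hm: "?H \<in> borel_measurable ?M" using X by measurable
    have Hm': "(\<lambda>Z. ?H (tuple_mult m X Z)) \<in> borel_measurable ?M" using X by measurable
    have "(\<integral>\<^sup>+ Z. det_pow m n Z * gauss m m (tuple_mult m X Z) * det_pow m (2 * n) X * V X (tuple_mult m X Z) \<partial>?M) =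
      (\<integral>\<^sup>+ Z. det_pow m n X * ?H (tuple_mult m X Z) \<partial>?M)"
    proof (rule nn_integral_cong)
      fix Z
      have 2: "det_pow m (2 * n) X = det_pow m n X * det_pow m n X" by (simp add: det_pow_mult mult_2)
      show "det_pow m n Z * gauss m m (tuple_mult m X Z) * det_pow m (2 * n) X * V X (tuple_mult m X Z) = det_pow m n X * ?H (tuple_mult m X Z)"
        unfolding 2 det_pow_tuple_mult by (simp only: mult_ac)
    qed
    also have "\<dots> = det_pow m n X * (\<integral>\<^sup>+ Z. ?H (tuple_mult m X Z) \<partial>?M)" by (rule nn_integral_cmult[OF Hm'])
    also have "\<dots> = det_pow m k X * (det_pow m m X * (\<integral>\<^sup>+ Z. ?H (tuple_mult m X Z) \<partial>?M))"
      by (simp add: nmk det_pow_mult[symmetric] mult_ac)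
    also have "det_pow m m X * (\<integral>\<^sup>+ Z. ?H (tuple_mult m X Z) \<partial>?M) = (\<integral>\<^sup>+ Z. ?H Z \<partial>?M)"
      by (rule left_mult_det_pow[OF X(2,1) Hm, symmetric])
    also have "det_pow m k X * (\<integral>\<^sup>+ Z. ?H Z \<partial>?M) = (\<integral>\<^sup>+ Z. det_pow m k X * ?H Z \<partial>?M)"
      by (rule nn_integral_cmult[OF Hm, symmetric])
    finally show "(\<integral>\<^sup>+ Z. det_pow m n Z * gauss m m (tuple_mult m X Z) * det_pow m (2 * n) X * V X (tuple_mult m X Z) \<partial>?M) =
      (\<integral>\<^sup>+ Z. det_pow m n Z * gauss m m Z * (det_pow m k X * V X Z) \<partial>?M)"
      by (simp add: mult_ac)
  qed
  also have "\<dots> = (\<integral>\<^sup>+ Z. \<integral>\<^sup>+ X. det_pow m n Z * gauss m m Z * (det_pow m k X * V X Z) \<partial>?M \<partial>?M)"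
    by (rule nn_integral_swap[OF sigma_finite_tuples sigma_finite_tuples]) measurable
  also have "\<dots> \<le> (\<integral>\<^sup>+ Z. gauss m m Z * (det_moment m k * (\<integral>\<^sup>+ G. g G \<partial>?N)) \<partial>?M)"
  proof (rule nn_integral_mono_AE, use AE_tuple_det_nonzero[of m] AE_space in eventually_elim)
    fix Z assume dZ: "tuple_det m Z \<noteq> 0" and Z: "Z \<in> space ?M"
    \<comment> \<open>The integral over \<open>X\<close>, taken before that over \<open>G\<close>,
      is \<open>gauss_det_moment n m k G\<close>, the denominator of
      \<open>gram_mat_power n m k G\<close>.\<close>
    have "(\<integral>\<^sup>+ X. det_pow m k X * V X Z \<partial>?M) = (\<integral>\<^sup>+ X. \<integral>\<^sup>+ G. det_pow m k X * (gauss n m (tuple_mult m G X) * gram_mat_power n m k G * g (tuple_mult m G Z)) \<partial>?N \<partial>?M)"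
    proof (rule nn_integral_cong)
      fix X assume X: "X \<in> space ?M"
      show "det_pow m k X * V X Z = (\<integral>\<^sup>+ G. det_pow m k X * (gauss n m (tuple_mult m G X) * gram_mat_power n m k G * g (tuple_mult m G Z)) \<partial>?N)"
        unfolding V_def by (rule nn_integral_cmult[symmetric]) (use X Z in measurable)
    qed
    also have "\<dots> = (\<integral>\<^sup>+ G. \<integral>\<^sup>+ X. det_pow m k X * (gauss n m (tuple_mult m G X) * gram_mat_power n m k G * g (tuple_mult m G Z)) \<partial>?M \<partial>?N)"
      by (rule nn_integral_swap[OF sigma_finite_tuples sigma_finite_tuples]) (use Z in measurable)
    also have "\<dots> = (\<integral>\<^sup>+ G. \<integral>\<^sup>+ X. (gram_mat_power n m k G * g (tuple_mult m G Z)) * (gauss n m (tuple_mult m G X) * det_pow m k X) \<partial>?M \<partial>?N)"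
      by (simp only: mult_ac)
    also have "\<dots> = (\<integral>\<^sup>+ G. (gram_mat_power n m k G * g (tuple_mult m G Z)) * gauss_det_moment n m k G \<partial>?N)"
    proof (rule nn_integral_cong)
      fix G assume G: "G \<in> space ?N"
      show "(\<integral>\<^sup>+ X. (gram_mat_power n m k G * g (tuple_mult m G Z)) * (gauss n m (tuple_mult m G X) * det_pow m k X) \<partial>?M) = (gram_mat_power n m k G * g (tuple_mult m G Z)) * gauss_det_moment n m k G"
        unfolding gauss_det_moment_def by (rule nn_integral_cmult) (use G in measurable)
    qed
    also have "\<dots> \<le> (\<integral>\<^sup>+ G. det_moment m k * g (tuple_mult m G Z) \<partial>?N)"
    proof (rule nn_integral_mono)
      fix G show "(gram_mat_power n m k G * g (tuple_mult m G Z)) * gauss_det_moment n m k G \<le> det_moment m k * g (tuple_mult m G Z)"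
        using mult_right_mono[OF gram_mat_power_gauss_det_moment_le[of n m k G], of "g (tuple_mult m G Z)"] by (simp add: mult_ac)
    qed
    also have "\<dots> = det_moment m k * (\<integral>\<^sup>+ G. g (tuple_mult m G Z) \<partial>?N)"
      by (rule nn_integral_cmult) (use Z in measurable)
    finally have inner: "(\<integral>\<^sup>+ X. det_pow m k X * V X Z \<partial>?M) \<le> det_moment m k * (\<integral>\<^sup>+ G. g (tuple_mult m G Z) \<partial>?N)" .
    have "(\<integral>\<^sup>+ X. det_pow m n Z * gauss m m Z * (det_pow m k X * V X Z) \<partial>?M) =
      det_pow m n Z * gauss m m Z * (\<integral>\<^sup>+ X. det_pow m k X * V X Z \<partial>?M)"
      by (rule nn_integral_cmult) (use Z in measurable)
    also have "\<dots> \<le> det_pow m n Z * gauss m m Z * (det_moment m k * (\<integral>\<^sup>+ G. g (tuple_mult m G Z) \<partial>?N))"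
      by (rule mult_left_mono[OF inner]) simp
    also have "\<dots> = gauss m m Z * (det_moment m k * (det_pow m n Z * (\<integral>\<^sup>+ G. g (tuple_mult m G Z) \<partial>?N)))" by (simp add: mult_ac)
    also have "det_pow m n Z * (\<integral>\<^sup>+ G. g (tuple_mult m G Z) \<partial>?N) = (\<integral>\<^sup>+ G. g G \<partial>?N)"
      by (rule right_mult_det_pow[OF dZ g, symmetric])
    finally show "(\<integral>\<^sup>+ X. det_pow m n Z * gauss m m Z * (det_pow m k X * V X Z) \<partial>?M) \<le> gauss m m Z * (det_moment m k * (\<integral>\<^sup>+ G. g G \<partial>?N))" .
  qed
  also have "\<dots> = A * (det_moment m k * (\<integral>\<^sup>+ G. g G \<partial>?N))"
    unfolding A_def by (rule nn_integral_multc) measurable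
  finally show ?thesis using A by (simp add: ennreal_mult_le_mult_iff)
qed

end

section \<open>Linear parametrisations and Gaussian moments of the determinant\<close>

definition lin_comb :: "nat \<Rightarrow> (nat \<Rightarrow> nat \<Rightarrow> real) \<Rightarrow> (nat \<Rightarrow> real) \<Rightarrow> nat \<Rightarrow> real" where
  "lin_comb m G z = (\<Sum>j<m. z j *\<^sub>R G j)"

lemma lin_comb_Rn: "(\<And>j. j < m \<Longrightarrow> G j \<in> Rn n) \<Longrightarrow> lin_comb m G z \<in> Rn n"
  unfolding lin_comb_def by (intro Rn_sum Rn_simps) auto

lemma lin_comb_measurable [measurable (raw)]:
  assumes f: "f \<in> M \<rightarrow>\<^sub>M tuples n m" and g: "g \<in> M \<rightarrow>\<^sub>M leb m"
  shows "(\<lambda>x. lin_comb m (f x) (g x)) \<in> M \<rightarrow>\<^sub>M leb n"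
proof (rule measurable_into_leb)
  fix x assume "x \<in> space M"
  thus "lin_comb m (f x) (g x) \<in> Rn n" using measurable_space[OF f] by (intro lin_comb_Rn tuples_Rn) auto
next
  fix a
  have "(\<lambda>x. \<Sum>j<m. g x j * f x j a) \<in> borel_measurable M"
    by (intro borel_measurable_sum borel_measurable_times tuples_entry[OF f] leb_coord_measurable[OF g]) auto
  thus "(\<lambda>x. lin_comb m (f x) (g x) a) \<in> borel_measurable M"
    by (simp add: lin_comb_def fun_sum_apply scaleR_fun_def)
qed

lemma tuple_mult_lin_comb: "j < m \<Longrightarrow> tuple_mult m G Z j = lin_comb m G (Z j)"
  by (simp add: tuple_mult_def lin_comb_def)

lemma lin_comb_apply: "lin_comb m G z a = (\<Sum>j<m. z j * G j a)"
  by (simp add: lin_comb_def fun_sum_apply scaleR_fun_def)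

lemma lin_comb_eq_mat_app:
  assumes "S \<in> space (tuples m m)"
  shows "lin_comb m S z = mat_app m (tuple_mat m S) z"
proof
  fix a
  have "S j a = 0" if "j < m" "\<not> a < m" for j using tuples_Rn[OF assms that(1)] that(2) by (auto simp: Rn_def)
  thus "lin_comb m S z a = mat_app m (tuple_mat m S) z a"
    by (cases "a < m") (auto simp: lin_comb_apply mat_app_def mult.commute)
qed

lemma lin_comb_tuple_mult: "lin_comb m (tuple_mult m G S) z = lin_comb m G (lin_comb m S z)"
proof
  fix a
  have "lin_comb m (tuple_mult m G S) z a = (\<Sum>j<m. \<Sum>i<m. z j * (S j i * G i a))"
    by (simp add: lin_comb_apply tuple_mult_lin_comb sum_distrib_left)
  also have "\<dots> = lin_comb m G (lin_comb m S z) a"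
    by (subst sum.swap) (simp add: lin_comb_apply sum_distrib_right mult.assoc)
  finally show "lin_comb m (tuple_mult m G S) z a = lin_comb m G (lin_comb m S z) a" .
qed

lemma ip_lin_comb_orthonormal:
  assumes "orthonormal n m w"
  shows "ip n (lin_comb m w z) (lin_comb m w z) = ip m z z"
proof -
  have "ip n (lin_comb m w z) (lin_comb m w z) = (\<Sum>i<m. z i * ip n (w i) (\<Sum>j<m. z j *\<^sub>R w j))"
    unfolding lin_comb_def by (subst ip_sum(1)) (simp only: ip_linear)
  also have "\<dots> = ip m z z"
    unfolding ip_def[of m] by (intro sum.cong refl) (simp add: orthonormal_coeff[OF assms])
  finally show ?thesis .
qed

lemma det_moment_pos: "det_moment m k \<noteq> 0"
proof
  assume "det_moment m k = 0"
  moreover have "(\<lambda>Z. gauss m m Z * det_pow m k Z) \<in> borel_measurable (tuples m m)" by measurable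
  ultimately have "AE Z in tuples m m. gauss m m Z * det_pow m k Z = 0"
    by (simp only: det_moment_def nn_integral_0_iff_AE)
  hence "AE Z in tuples m m. gauss m m Z = 0"
    using AE_tuple_det_nonzero[of m] by eventually_elim (use det_pow_neq_0 in auto)
  hence "(\<integral>\<^sup>+ Z. gauss m m Z \<partial>tuples m m) = 0"
    by (subst nn_integral_0_iff_AE) measurable
  thus False by (simp add: nn_integral_gauss)
qed

text \<open>By the tangent of the exponential function, |x|^k is at most sqrt(n)^k exp (k/2 (|x|^2 /
  n - 1)), which is absorbed into the Gaussian. The reference value n for |x|^2 leaves the parameter
  \<open>a = m / (2 * n)\<close>; the resulting loss (n/m)^(m/2) is at most e^(k/2), and the factor
  e^(-k/2) compensates it.\<close>

lemma nn_integral_gauss_moment: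
  assumes m: "m \<ge> 1" and n: "n = m + k"
  shows "(\<integral>\<^sup>+ x. ennreal (exp (- (1/2) * ip m x x) * enorm m x ^ k) \<partial>leb m) \<le> ennreal (sqrt (2 * pi) ^ m * sqrt n ^ k)"
proof -
  define a where "a = real m / (2 * real n)"
  have npos: "real n > 0" and a: "a > 0" using m n by (auto simp: a_def)
  have pt: "exp (- (1/2) * ip m x x) * enorm m x ^ k \<le> (sqrt n ^ k * exp (- (k / 2))) * exp (- a * ip m x x)" for x
  proof -
    let ?r = "enorm m x"
    have "?r\<^sup>2 / n \<le> exp (?r\<^sup>2 / n - 1)" using exp_ge_add_one_self[of "?r\<^sup>2 / n - 1"] by simp
    hence "?r\<^sup>2 \<le> n * exp (?r\<^sup>2 / n - 1)" using npos by (simp add: divide_le_eq mult.commute)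
    also have "\<dots> = (sqrt n * exp ((?r\<^sup>2 / n - 1) / 2))\<^sup>2"
      using npos by (simp add: power_mult_distrib power2_eq_square[of "exp _"] exp_add[symmetric])
    finally have "?r \<le> sqrt n * exp ((?r\<^sup>2 / n - 1) / 2)" by (rule power2_le_imp_le) simp
    hence "?r ^ k \<le> (sqrt n * exp ((?r\<^sup>2 / n - 1) / 2)) ^ k" by (rule power_mono) simp
    also have "\<dots> = sqrt n ^ k * exp (k * ((?r\<^sup>2 / n - 1) / 2))" by (simp only: power_mult_distrib exp_of_nat_mult)
    finally have "exp (- (1/2) * ip m x x) * ?r ^ k \<le> exp (- (1/2) * ip m x x) * (sqrt n ^ k * exp (k * ((?r\<^sup>2 / n - 1) / 2)))"
      by (rule mult_left_mono) simp
    also have "\<dots> = sqrt n ^ k * exp (- (1/2) * ip m x x + k * ((?r\<^sup>2 / n - 1) / 2))" by (simp only: exp_add mult_ac)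
    also have "- (1/2) * ip m x x + k * ((?r\<^sup>2 / n - 1) / 2) = - (k / 2) + - a * ip m x x"
      using npos unfolding enorm_sq a_def by (simp add: n field_simps)
    finally show ?thesis by (simp only: exp_add mult_ac)
  qed
  have [measurable]: "(\<lambda>y. ip m y y) \<in> borel_measurable (leb m)" by (intro ip_measurable measurable_ident_sets[OF refl])
  have "(\<integral>\<^sup>+ x. ennreal (exp (- (1/2) * ip m x x) * enorm m x ^ k) \<partial>leb m) \<le>
     (\<integral>\<^sup>+ x. ennreal (sqrt n ^ k * exp (- (k / 2))) * ennreal (exp (- a * ip m x x)) \<partial>leb m)"
    using pt by (intro nn_integral_mono) (simp add: ennreal_mult[symmetric] del: mult_minus_left)
  also have "\<dots> = ennreal (sqrt n ^ k * exp (- (k / 2))) * (\<integral>\<^sup>+ x. ennreal (exp (- a * ip m x x)) \<partial>leb m)"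
    by (rule nn_integral_cmult) measurable
  also have "\<dots> = ennreal (sqrt n ^ k * exp (- (k / 2)) * sqrt (pi / a) ^ m)"
    unfolding nn_integral_gauss_leb[OF a] using a by (simp add: ennreal_mult[symmetric])
  also have "\<dots> \<le> ennreal (sqrt (2 * pi) ^ m * sqrt n ^ k)"
  proof (rule ennreal_leI)
    have "sqrt (pi / a) = sqrt (2 * pi) * sqrt (n / m)" by (simp add: a_def real_sqrt_mult[symmetric] mult_ac)
    moreover have "sqrt (n / m) ^ m \<le> exp (k / 2)"
    proof -
      have "real n / m = 1 + real k / m" using m n by (simp add: field_simps)
      also have "\<dots> \<le> exp (real k / m)" by (rule exp_ge_add_one_self)
      finally have "sqrt (n / m) \<le> sqrt (exp (real k / m))" by simp
      also have "\<dots> = exp (real k / (2 * m))"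
        by (rule real_sqrt_unique) (simp_all add: power2_eq_square exp_add[symmetric] field_simps)
      finally have "sqrt (n / m) ^ m \<le> exp (real k / (2 * m)) ^ m" by (rule power_mono) simp
      also have "\<dots> = exp (k / 2)" using m by (simp add: exp_of_nat_mult[symmetric])
      finally show ?thesis .
    qed
    ultimately have "sqrt n ^ k * exp (- (k / 2)) * sqrt (pi / a) ^ m \<le> sqrt n ^ k * exp (- (k / 2)) * (sqrt (2 * pi) ^ m * exp (k / 2))"
      by (intro mult_left_mono) (auto simp: power_mult_distrib)
    also have "\<dots> = sqrt (2 * pi) ^ m * sqrt n ^ k" by (simp add: exp_minus field_simps)
    finally show "sqrt n ^ k * exp (- (k / 2)) * sqrt (pi / a) ^ m \<le> sqrt (2 * pi) ^ m * sqrt n ^ k" .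
  qed
  finally show ?thesis .
qed

text \<open>Hadamard's inequality reduces the moment to norms of the columns, which are independent
  under the Gaussian weight.\<close>

lemma det_moment_le:
  assumes m: "m \<ge> 1" and n: "n = m + k"
  shows "det_moment m k \<le> ennreal ((sqrt (2 * pi) ^ m * sqrt n ^ k) ^ m)"
proof -
  have "det_moment m k \<le> (\<integral>\<^sup>+ Z. (\<Prod>j<m. ennreal (exp (- (1/2) * ip m (Z j) (Z j)) * enorm m (Z j) ^ k)) \<partial>tuples m m)"
    unfolding det_moment_def
  proof (rule nn_integral_mono)
    fix Z assume Z: "Z \<in> space (tuples m m)"
    have "\<bar>tuple_det m Z\<bar> ^ k \<le> (\<Prod>j<m. enorm m (Z j)) ^ k"
      unfolding enorm_def by (intro power_mono hadamard tuples_Rn[OF Z]) auto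
    hence "\<bar>tuple_det m Z\<bar> ^ k \<le> (\<Prod>j<m. enorm m (Z j) ^ k)" by (simp only: prod_power_distrib)
    hence "gauss m m Z * det_pow m k Z \<le> (\<Prod>j<m. ennreal (exp (- (1/2) * ip m (Z j) (Z j)))) * ennreal (\<Prod>j<m. enorm m (Z j) ^ k)"
      unfolding gauss_prod det_pow_def by (intro mult_left_mono ennreal_leI) auto
    also have "\<dots> = (\<Prod>j<m. ennreal (exp (- (1/2) * ip m (Z j) (Z j)) * enorm m (Z j) ^ k))"
      by (simp add: prod_ennreal[symmetric] prod.distrib[symmetric] ennreal_mult del: mult_minus_left)
    finally show "gauss m m Z * det_pow m k Z \<le> (\<Prod>j<m. ennreal (exp (- (1/2) * ip m (Z j) (Z j)) * enorm m (Z j) ^ k))" .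
  qed
  also have "\<dots> = (\<Prod>j<m. \<integral>\<^sup>+ x. ennreal (exp (- (1/2) * ip m x x) * enorm m x ^ k) \<partial>leb m)"
  proof (rule nn_integral_tuples_prod)
    have [measurable]: "(\<lambda>y. ip m y y) \<in> borel_measurable (leb m)" by (intro ip_measurable measurable_ident_sets[OF refl])
    have [measurable]: "(\<lambda>y. enorm m y) \<in> borel_measurable (leb m)" by (intro enorm_measurable measurable_ident_sets[OF refl])
    show "(\<lambda>x. ennreal (exp (- (1/2) * ip m x x) * enorm m x ^ k)) \<in> borel_measurable (leb m)" by measurable
  qed
  also have "\<dots> \<le> (\<Prod>j<m. ennreal (sqrt (2 * pi) ^ m * sqrt n ^ k))"
    by (intro prod_mono_ennreal nn_integral_gauss_moment assms)
  finally show ?thesis by (simp add: ennreal_power)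
qed

lemma det_moment_neq_top:
  assumes "m \<ge> 1"
  shows "det_moment m k \<noteq> top"
  using det_moment_le[OF assms refl, of k] by (auto simp: top_unique)

text \<open>An isometry preserves the Gaussian weight. The numerator \<open>det_moment m k\<close>
  in the definition is the normalisation that gives the value 1 here.\<close>

lemma gram_mat_power_orthonormal:
  assumes m: "m \<ge> 1" and w: "orthonormal n m w"
  shows "gram_mat_power n m k w = 1"
proof -
  have "gauss_det_moment n m k w = det_moment m k"
    unfolding gauss_det_moment_def det_moment_def
  proof (rule nn_integral_cong)
    fix Z assume "Z \<in> space (tuples m m)"
    have "tuple_sqnorm n m (tuple_mult m w Z) = tuple_sqnorm m m Z"
      unfolding tuple_sqnorm_def by (intro sum.cong refl) (simp add: tuple_mult_lin_comb ip_lin_comb_orthonormal[OF w])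
    thus "gauss n m (tuple_mult m w Z) * det_pow m k Z = gauss m m Z * det_pow m k Z" by (simp add: gauss_def)
  qed
  thus ?thesis using det_moment_pos det_moment_neq_top[OF m] by (simp add: gram_mat_power_def less_top)
qed

section \<open>Integrals over fibres and their mean over Gaussian bases\<close>

definition fibre_integral :: "nat \<Rightarrow> ((nat \<Rightarrow> real) \<Rightarrow> real) \<Rightarrow> (nat \<Rightarrow> nat \<Rightarrow> real) \<Rightarrow> (nat \<Rightarrow> real) \<Rightarrow> ennreal" where
  "fibre_integral m f G x = (\<integral>\<^sup>+ z. ennreal (f (x + lin_comb m G z)) \<partial>leb m)"

text \<open>For an orthonormal \<open>G\<close> this is the n-th power of the marginal density at
  \<open>x\<close>. The weight makes the value invariant under a change of basis.\<close>

definition fibre_power :: "nat \<Rightarrow> nat \<Rightarrow> nat \<Rightarrow> ((nat \<Rightarrow> real) \<Rightarrow> real) \<Rightarrow> (nat \<Rightarrow> nat \<Rightarrow> real) \<Rightarrow> (nat \<Rightarrow> real) \<Rightarrow> ennreal" where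
  "fibre_power n m k f G x = gram_mat_power n m k G * fibre_integral m f G x ^ n"

lemma leb_nn_integral_measurable:
  assumes "(\<lambda>p. f (fst p) (snd p)) \<in> borel_measurable (N \<Otimes>\<^sub>M leb n)"
  shows "(\<lambda>x. \<integral>\<^sup>+ y. f x y \<partial>leb n) \<in> borel_measurable N"
  by (rule sigma_finite_measure.borel_measurable_nn_integral[OF sigma_finite_leb]) (use assms in \<open>simp add: case_prod_beta'\<close>)

lemma fibre_integral_measurable:
  assumes f: "f \<in> borel_measurable (leb n)" and [measurable]: "a \<in> N \<rightarrow>\<^sub>M tuples n m" "b \<in> N \<rightarrow>\<^sub>M leb n"
  shows "(\<lambda>x. fibre_integral m f (a x) (b x)) \<in> borel_measurable N"
proof -
  have "(\<lambda>p. b (fst p) + lin_comb m (a (fst p)) (snd p)) \<in> N \<Otimes>\<^sub>M leb m \<rightarrow>\<^sub>M leb n"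
    by (intro leb.add_measurable' lin_comb_measurable) measurable
  from measurable_compose[OF this measurable_compose[OF f measurable_ennreal]]
  show ?thesis unfolding fibre_integral_def by (intro leb_nn_integral_measurable)
qed

lemma fibre_power_measurable:
  assumes "n = m + k" "f \<in> borel_measurable (leb n)" "a \<in> N \<rightarrow>\<^sub>M tuples n m" "b \<in> N \<rightarrow>\<^sub>M leb n"
  shows "(\<lambda>x. fibre_power n m k f (a x) (b x)) \<in> borel_measurable N"
  unfolding fibre_power_def
  by (intro borel_measurable_times_ennreal borel_measurable_power_ennreal gram_mat_power_measurable assms
      fibre_integral_measurable[OF assms(2)])

text \<open>The fibre integral is divided by |det S|, and its n-th power cancels the degree n of
  \<open>gram_mat_power\<close>.\<close>

lemma fibre_power_tuple_mult:
  assumes nmk: "n = m + k" and f: "f \<in> borel_measurable (leb n)" and G: "G \<in> space (tuples n m)"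
    and S: "S \<in> space (tuples m m)" "tuple_det m S \<noteq> 0" and x: "x \<in> Rn n"
  shows "fibre_power n m k f (tuple_mult m G S) x = fibre_power n m k f G x"
proof -
  have "(\<lambda>z. x + lin_comb m G z) \<in> leb m \<rightarrow>\<^sub>M leb n"
    by (intro leb.add_measurable' lin_comb_measurable measurable_const measurable_ident_sets[OF refl]) (use G x in auto)
  from measurable_compose[OF this measurable_compose[OF f measurable_ennreal]]
  have "fibre_integral m f (tuple_mult m G S) x = ennreal (1 / \<bar>tuple_det m S\<bar>) * fibre_integral m f G x"
    using nn_integral_mat_app[of "tuple_mat m S" m "\<lambda>z. ennreal (f (x + lin_comb m G z))"] S
    by (simp add: fibre_integral_def lin_comb_tuple_mult lin_comb_eq_mat_app[OF S(1)] tuple_det_def)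
  hence "fibre_power n m k f (tuple_mult m G S) x = (det_pow m n S * ennreal (1 / \<bar>tuple_det m S\<bar>) ^ n) * fibre_power n m k f G x"
    unfolding fibre_power_def gram_mat_power_tuple_mult[OF nmk G S] by (simp only: power_mult_distrib mult_ac)
  moreover have "det_pow m n S * ennreal (1 / \<bar>tuple_det m S\<bar>) ^ n = 1"
    using S(2) by (simp add: det_pow_def ennreal_power ennreal_mult[symmetric] power_one_over)
  ultimately show ?thesis by simp
qed

text \<open>For fixed \<open>x\<close> the Blaschke--Petkantschin inequality is applied to the
  product of the functions \<open>f (x + Y j)\<close>, whose integral is 1. On each fibre the
  determinant bound supplies the n-th power of the fibre integral.\<close>

lemma fibre_power_weighted_integral_le:
  assumes nmk: "n = m + k" and m: "m \<ge> 1" and k: "k \<ge> 1" and M: "M > 0"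
    and f: "f \<in> borel_measurable (leb n)" and f0: "\<And>y. 0 \<le> f y" and fM: "\<And>y. f y \<le> M"
    and f1: "(\<integral>\<^sup>+ y. ennreal (f y) \<partial>leb n) = 1" and x: "x \<in> Rn n"
  shows "ennreal (kappa m ^ k / M ^ k) * (\<integral>\<^sup>+ G. gauss n m G * fibre_power n m k f G x \<partial>tuples n m) \<le> det_moment m k"
proof -
  define g where "g Y = (\<Prod>j<m. ennreal (f (x + Y j)))" for Y :: "nat \<Rightarrow> nat \<Rightarrow> real"
  have fx: "(\<lambda>y. ennreal (f (x + y))) \<in> borel_measurable (leb n)"
    by (intro measurable_compose[OF _ measurable_compose[OF f measurable_ennreal]] leb.add_measurable'
        measurable_const measurable_ident_sets[OF refl]) (use x in auto)
  have gm: "g \<in> borel_measurable (tuples n m)"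
    unfolding g_def
    by (intro borel_measurable_prod_ennreal measurable_compose[OF tuples_coord[OF measurable_ident_sets[OF refl]] fx]) auto
  have "(\<integral>\<^sup>+ Y. g Y \<partial>tuples n m) = (\<Prod>j<m. \<integral>\<^sup>+ y. ennreal (f (x + y)) \<partial>leb n)"
    unfolding g_def by (rule nn_integral_tuples_prod[OF fx])
  also have "(\<integral>\<^sup>+ y. ennreal (f (x + y)) \<partial>leb n) = 1"
    using leb.shift[of x n "\<lambda>y. ennreal (f y)"] x measurable_compose[OF f measurable_ennreal] f1
    by (simp add: add.commute)
  finally have g1: "(\<integral>\<^sup>+ Y. g Y \<partial>tuples n m) = 1" by simp
  have fibm: "(\<lambda>G. gauss n m G * fibre_power n m k f G x) \<in> borel_measurable (tuples n m)"
    by (intro borel_measurable_times_ennreal gauss_measurable fibre_power_measurable[OF nmk f] measurable_ident_sets[OF refl] measurable_const)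
      (use x in simp)
  have "ennreal (kappa m ^ k / M ^ k) * (\<integral>\<^sup>+ G. gauss n m G * fibre_power n m k f G x \<partial>tuples n m) =
    (\<integral>\<^sup>+ G. ennreal (kappa m ^ k / M ^ k) * (gauss n m G * fibre_power n m k f G x) \<partial>tuples n m)"
    by (rule nn_integral_cmult[symmetric, OF fibm])
  also have "\<dots> \<le> (\<integral>\<^sup>+ G. gauss n m G * gram_mat_power n m k G * (\<integral>\<^sup>+ Z. g (tuple_mult m G Z) * det_pow m k Z \<partial>tuples m m) \<partial>tuples n m)"
  proof (rule nn_integral_mono)
    fix G assume G: "G \<in> space (tuples n m)"
    have hm: "(\<lambda>z. f (x + lin_comb m G z)) \<in> borel_measurable (leb m)"
      by (intro measurable_compose[OF _ f] leb.add_measurable' lin_comb_measurable measurable_const measurable_ident_sets[OF refl])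
         (use G x in auto)
    have "ennreal (kappa m ^ k / M ^ k) * fibre_integral m f G x ^ n \<le>
       (\<integral>\<^sup>+ Z. (\<Prod>j<m. ennreal (f (x + lin_comb m G (Z j)))) * ennreal (\<bar>tuple_det m Z\<bar> ^ k) \<partial>tuples m m)"
      unfolding fibre_integral_def nmk by (rule det_power_integral_lower[OF m k M hm f0 fM])
    also have "\<dots> = (\<integral>\<^sup>+ Z. g (tuple_mult m G Z) * det_pow m k Z \<partial>tuples m m)"
      by (intro nn_integral_cong) (simp add: g_def det_pow_def tuple_mult_lin_comb)
    finally have "gauss n m G * gram_mat_power n m k G * (ennreal (kappa m ^ k / M ^ k) * fibre_integral m f G x ^ n) \<le>
      gauss n m G * gram_mat_power n m k G * (\<integral>\<^sup>+ Z. g (tuple_mult m G Z) * det_pow m k Z \<partial>tuples m m)" by (rule mult_left_mono) simp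
    thus "ennreal (kappa m ^ k / M ^ k) * (gauss n m G * fibre_power n m k f G x) \<le>
       gauss n m G * gram_mat_power n m k G * (\<integral>\<^sup>+ Z. g (tuple_mult m G Z) * det_pow m k Z \<partial>tuples m m)"
      by (simp add: fibre_power_def mult_ac)
  qed
  also have "\<dots> \<le> det_moment m k * (\<integral>\<^sup>+ Y. g Y \<partial>tuples n m)"
    by (rule blaschke_petkantschin[OF nmk gm])
  finally show ?thesis by (simp add: g1)
qed

lemma power_div_fact_le_exp: "x ^ m / fact m \<le> exp x" if "x \<ge> 0" for x :: real
proof -
  have "x ^ m / fact m = (\<Sum>i\<in>{m}. x ^ i /\<^sub>R fact i)" by (simp add: field_simps)
  also have "\<dots> \<le> (\<Sum>i. x ^ i /\<^sub>R fact i)"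
    using that by (intro sum_le_suminf summable_exp_generic) auto
  finally show ?thesis by (simp add: exp_def)
qed

text \<open>The dimensional factors cancel here: \<open>sqrt n ^ m / kappa m\<close> is at most 20^m
  n^m / m!, and a single term of the exponential series bounds n^m / m! by e^n. The remaining
  \<open>sqrt (2 * pi) ^ (n * m)\<close> is the total Gaussian mass of \<open>tuples n m\<close>,
  which is divided out at the end.\<close>

lemma constant_bound:
  assumes nmk: "n = m + k" and m: "m \<ge> 1" and k: "k \<ge> 1" and M: "M > 0"
    and X: "ennreal (kappa m ^ k / M ^ k) * X \<le> det_moment m k"
  shows "X \<le> ennreal ((20 * exp 1) ^ (n * k) * M ^ k * sqrt (2 * pi) ^ (n * m))"
proof -
  let ?a = "kappa m ^ k / M ^ k"
  have a: "?a > 0" using kappa_pos[OF m] M by simp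
  have "X = ennreal (1 / ?a) * (ennreal ?a * X)"
    unfolding mult.assoc[symmetric] using a kappa_pos[OF m] M by (simp add: ennreal_mult[symmetric])
  also have "\<dots> \<le> ennreal (1 / ?a) * ennreal ((sqrt (2 * pi) ^ m * sqrt n ^ k) ^ m)"
    by (intro mult_left_mono order_trans[OF X det_moment_le[OF m nmk]]) simp
  also have "\<dots> = ennreal ((sqrt (2 * pi) ^ m * sqrt n ^ k) ^ m * M ^ k / kappa m ^ k)"
    using kappa_pos[OF m] M by (simp add: ennreal_mult[symmetric] mult_ac)
  also have "\<dots> \<le> ennreal ((20 * exp 1) ^ (n * k) * M ^ k * sqrt (2 * pi) ^ (n * m))"
  proof (rule ennreal_leI)
    have "sqrt n ^ m / kappa m \<le> (20 * exp 1) ^ n"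
    proof -
      have "sqrt n ^ m / kappa m = 20 ^ m * ((sqrt n * sqrt m) ^ m / fact m)"
        by (simp add: kappa_def power_mult_distrib field_simps)
      also have "sqrt n * sqrt m \<le> sqrt n * sqrt n" using nmk by (intro mult_left_mono) auto
      hence "(sqrt n * sqrt m) ^ m / fact m \<le> real n ^ m / fact m"
        by (intro divide_right_mono power_mono) auto
      hence "20 ^ m * ((sqrt n * sqrt m) ^ m / fact m) \<le> 20 ^ n * exp n"
        using power_div_fact_le_exp[of "real n" m] nmk by (intro mult_mono power_increasing) auto
      also have "20 ^ n * exp n = (20 * exp 1) ^ n" using exp_of_nat_mult[of n "1::real"] by (simp add: power_mult_distrib)
      finally show ?thesis .
    qed
    hence "(sqrt n ^ m / kappa m) ^ k \<le> ((20 * exp 1) ^ n) ^ k"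
      using kappa_pos[OF m] by (intro power_mono) auto
    hence "sqrt n ^ (m * k) / kappa m ^ k \<le> (20 * exp 1) ^ (n * k)" by (simp add: power_divide power_mult)
    moreover have "sqrt (2 * pi) ^ (m * m) \<le> sqrt (2 * pi) ^ (n * m)"
      using nmk pi_ge_two by (intro power_increasing) (auto simp: real_le_rsqrt)
    ultimately have "sqrt (2 * pi) ^ (m * m) * (sqrt n ^ (m * k) / kappa m ^ k) \<le> sqrt (2 * pi) ^ (n * m) * (20 * exp 1) ^ (n * k)"
      using kappa_pos[OF m] by (intro mult_mono) auto
    hence "(sqrt (2 * pi) ^ (m * m) * (sqrt n ^ (m * k) / kappa m ^ k)) * M ^ k \<le> (sqrt (2 * pi) ^ (n * m) * (20 * exp 1) ^ (n * k)) * M ^ k"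
      using M by (intro mult_right_mono) auto
    thus "(sqrt (2 * pi) ^ m * sqrt n ^ k) ^ m * M ^ k / kappa m ^ k \<le> (20 * exp 1) ^ (n * k) * M ^ k * sqrt (2 * pi) ^ (n * m)"
      by (simp add: power_mult_distrib power_mult[symmetric] mult_ac)
  qed
  finally show ?thesis .
qed

text \<open>For each fixed \<open>z\<close>, the points \<open>x\<close> that are translated into
  the set where \<open>f\<close> and \<open>g\<close> differ form a null set. Fubini turns this into
  a statement on almost every fibre.\<close>

lemma fibre_integral_AE_eq:
  assumes f: "f \<in> borel_measurable (leb n)" and g: "g \<in> borel_measurable (leb n)"
    and eq: "AE y in leb n. f y = g y" and G: "G \<in> space (tuples n m)"
  shows "AE x in leb n. fibre_integral m f G x = fibre_integral m g G x"
proof -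
  let ?N = "{y \<in> space (leb n). f y \<noteq> g y}"
  have N: "?N \<in> sets (leb n)" using f g by (rule borel_measurable_neq)
  have N0: "emeasure (leb n) ?N = 0"
    using eq by (subst (asm) AE_iff_measurable[OF N]) auto
  have jm: "(\<lambda>p. fst p + lin_comb m G (snd p)) \<in> leb n \<Otimes>\<^sub>M leb m \<rightarrow>\<^sub>M leb n"
    by (intro leb.add_measurable' lin_comb_measurable measurable_const G) measurable
  have im: "(\<lambda>p. indicator ?N (fst p + lin_comb m G (snd p)) :: ennreal) \<in> borel_measurable (leb n \<Otimes>\<^sub>M leb m)"
    by (rule measurable_compose[OF jm borel_measurable_indicator[OF N]])
  have "(\<integral>\<^sup>+ x. \<integral>\<^sup>+ z. indicator ?N (x + lin_comb m G z) \<partial>leb m \<partial>leb n) =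
     (\<integral>\<^sup>+ z. \<integral>\<^sup>+ x. indicator ?N (x + lin_comb m G z) \<partial>leb n \<partial>leb m)"
    by (rule nn_integral_swap[OF sigma_finite_leb sigma_finite_leb im])
  also have "\<dots> = (\<integral>\<^sup>+ z. 0 \<partial>leb m)"
  proof (rule nn_integral_cong)
    fix z
    have "lin_comb m G z \<in> space (leb n)" using lin_comb_Rn tuples_Rn[OF G] by auto
    from leb.shift[OF this, of "indicator ?N"]
    show "(\<integral>\<^sup>+ x. indicator ?N (x + lin_comb m G z) \<partial>leb n) = 0" using N N0 by simp
  qed
  finally have 0: "(\<integral>\<^sup>+ x. \<integral>\<^sup>+ z. indicator ?N (x + lin_comb m G z) \<partial>leb m \<partial>leb n) = 0" by simp
  have "(\<lambda>x. \<integral>\<^sup>+ z. indicator ?N (x + lin_comb m G z) \<partial>leb m) \<in> borel_measurable (leb n)"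
    by (rule leb_nn_integral_measurable[OF im])
  from iffD1[OF nn_integral_0_iff_AE[OF this] 0]
  have ae: "AE x in leb n. (\<integral>\<^sup>+ z. indicator ?N (x + lin_comb m G z) \<partial>leb m) = 0" .
  show ?thesis using ae AE_space
  proof eventually_elim
    fix x assume x0: "(\<integral>\<^sup>+ z. indicator ?N (x + lin_comb m G z) \<partial>leb m) = 0" and x: "x \<in> space (leb n)"
    have xm: "(\<lambda>z. x + lin_comb m G z) \<in> leb m \<rightarrow>\<^sub>M leb n"
      by (intro leb.add_measurable' lin_comb_measurable measurable_const measurable_ident_sets[OF refl] G x)
    have "(\<lambda>z. indicator ?N (x + lin_comb m G z) :: ennreal) \<in> borel_measurable (leb m)"
      by (rule measurable_compose[OF xm borel_measurable_indicator[OF N]])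
    from iffD1[OF nn_integral_0_iff_AE[OF this] x0]
    have "AE z in leb m. f (x + lin_comb m G z) = g (x + lin_comb m G z)"
      using AE_space
    proof eventually_elim
      fix z assume "indicator ?N (x + lin_comb m G z) = (0::ennreal)" "z \<in> space (leb m)"
      thus "f (x + lin_comb m G z) = g (x + lin_comb m G z)"
        using measurable_space[OF xm] by (auto simp: indicator_def split: if_splits)
    qed
    thus "fibre_integral m f G x = fibre_integral m g G x" unfolding fibre_integral_def by (intro nn_integral_cong_AE) auto
  qed
qed

text \<open>
  Only the almost everywhere bound on f is available, so the estimate for fixed x is applied to a
  truncation of f and carried over after integrating in x.
\<close>

lemma fibre_power_integral_le:
  assumes nmk: "n = m + k" and m: "m \<ge> 1" and k: "k \<ge> 1" and M: "M > 0"
    and f: "f \<in> borel_measurable (leb n)" and f0: "\<And>y. y \<in> Rn n \<Longrightarrow> 0 \<le> f y" and fM: "AE y in leb n. f y \<le> M"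
    and f1: "(\<integral>\<^sup>+ y. ennreal (f y) \<partial>leb n) = 1"
  shows "(\<integral>\<^sup>+ G. gauss n m G * (\<integral>\<^sup>+ x. ennreal (f x) * fibre_power n m k f G x \<partial>leb n) \<partial>tuples n m)
    \<le> ennreal ((20 * exp 1) ^ (n * k) * M ^ k * sqrt (2 * pi) ^ (n * m))"
proof -
  \<comment> \<open>The lower cut is made because \<open>f\<close> is nonnegative on
    \<open>Rn n\<close> only, while the estimate for fixed \<open>x\<close> asks for nonnegativity
    at all sequences.\<close>
  define g where "g y = min M (max 0 (f y))" for y
  have g: "g \<in> borel_measurable (leb n)" unfolding g_def using f by measurable
  have g0: "0 \<le> g y" "g y \<le> M" for y using M by (auto simp: g_def)
  have fg: "AE y in leb n. f y = g y"
    using fM AE_space by eventually_elim (use f0 in \<open>auto simp: g_def\<close>)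
  have g1: "(\<integral>\<^sup>+ y. ennreal (g y) \<partial>leb n) = 1"
  proof -
    have "AE y in leb n. ennreal (f y) = ennreal (g y)" using fg by eventually_elim simp
    from nn_integral_cong_AE[OF this] f1 show ?thesis by simp
  qed
  let ?B = "ennreal ((20 * exp 1) ^ (n * k) * M ^ k * sqrt (2 * pi) ^ (n * m))"
  have mP: "(\<lambda>p. ennreal (f (snd p)) * (gauss n m (fst p) * fibre_power n m k g (fst p) (snd p))) \<in> borel_measurable (tuples n m \<Otimes>\<^sub>M leb n)"
    by (intro borel_measurable_times_ennreal gauss_measurable fibre_power_measurable[OF nmk g] measurable_fst measurable_snd
        measurable_compose[OF measurable_snd measurable_compose[OF f measurable_ennreal]])
  have mf: "(\<lambda>y. ennreal (f y)) \<in> borel_measurable (leb n)" by (rule measurable_compose[OF f measurable_ennreal])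
  have "(\<integral>\<^sup>+ G. gauss n m G * (\<integral>\<^sup>+ x. ennreal (f x) * fibre_power n m k f G x \<partial>leb n) \<partial>tuples n m) =
     (\<integral>\<^sup>+ G. \<integral>\<^sup>+ x. ennreal (f x) * (gauss n m G * fibre_power n m k g G x) \<partial>leb n \<partial>tuples n m)"
  proof (rule nn_integral_cong)
    fix G assume G: "G \<in> space (tuples n m)"
    have "(\<integral>\<^sup>+ x. ennreal (f x) * fibre_power n m k f G x \<partial>leb n) = (\<integral>\<^sup>+ x. ennreal (f x) * fibre_power n m k g G x \<partial>leb n)"
      using fibre_integral_AE_eq[OF f g fg G] by (intro nn_integral_cong_AE) (auto simp: fibre_power_def)
    moreover have "(\<lambda>x. ennreal (f x) * fibre_power n m k g G x) \<in> borel_measurable (leb n)"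
      by (intro borel_measurable_times_ennreal mf fibre_power_measurable[OF nmk g] measurable_const G measurable_ident_sets[OF refl])
    ultimately show "gauss n m G * (\<integral>\<^sup>+ x. ennreal (f x) * fibre_power n m k f G x \<partial>leb n) =
      (\<integral>\<^sup>+ x. ennreal (f x) * (gauss n m G * fibre_power n m k g G x) \<partial>leb n)"
      by (simp add: nn_integral_cmult[symmetric] mult_ac)
  qed
  also have "\<dots> = (\<integral>\<^sup>+ x. \<integral>\<^sup>+ G. ennreal (f x) * (gauss n m G * fibre_power n m k g G x) \<partial>tuples n m \<partial>leb n)"
    by (rule nn_integral_swap[OF sigma_finite_tuples sigma_finite_leb mP])
  also have "\<dots> \<le> (\<integral>\<^sup>+ x. ennreal (f x) * ?B \<partial>leb n)"
  proof (rule nn_integral_mono)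
    fix x assume "x \<in> space (leb n)"
    hence x: "x \<in> Rn n" by simp
    have "(\<integral>\<^sup>+ G. gauss n m G * fibre_power n m k g G x \<partial>tuples n m) \<le> ?B"
      by (rule constant_bound[OF nmk m k M fibre_power_weighted_integral_le[OF nmk m k M g g0 g1 x]])
    hence "ennreal (f x) * (\<integral>\<^sup>+ G. gauss n m G * fibre_power n m k g G x \<partial>tuples n m) \<le> ennreal (f x) * ?B"
      by (rule mult_left_mono) simp
    moreover have "(\<lambda>G. gauss n m G * fibre_power n m k g G x) \<in> borel_measurable (tuples n m)"
      by (intro borel_measurable_times_ennreal gauss_measurable fibre_power_measurable[OF nmk g] measurable_const measurable_ident_sets[OF refl])
         (use x in simp)
    ultimately show "(\<integral>\<^sup>+ G. ennreal (f x) * (gauss n m G * fibre_power n m k g G x) \<partial>tuples n m) \<le> ennreal (f x) * ?B"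
      by (simp add: nn_integral_cmult)
  qed
  also have "\<dots> = ?B" by (simp add: nn_integral_multc[OF mf] f1)
  finally show ?thesis .
qed

section \<open>Orthogonal maps and the Haar measure of the Grassmannian\<close>

lemma Rn_expansion: "x \<in> Rn n \<Longrightarrow> x = (\<Sum>i<n. x i *\<^sub>R unitv i)"
proof
  fix j assume "x \<in> Rn n"
  have "(\<Sum>i<n. x i *\<^sub>R unitv i) j = (\<Sum>i<n. if i = j then x j else 0)"
    unfolding fun_sum_apply by (intro sum.cong) (auto simp: scaleR_fun_def unitv_def)
  thus "x j = (\<Sum>i<n. x i *\<^sub>R unitv i) j" using \<open>x \<in> Rn n\<close> by (auto simp: Rn_def)
qed

lemma span_unitv: "span (unitv ` {..<n}) = Rn n"
proof
  show "span (unitv ` {..<n}) \<subseteq> Rn n"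
    by (rule span_minimal[OF _ subspace_Rn]) (auto simp: unitv_def Rn_def)
  show "Rn n \<subseteq> span (unitv ` {..<n})"
  proof
    fix x assume "x \<in> Rn n"
    hence "x = (\<Sum>i<n. x i *\<^sub>R unitv i)" by (rule Rn_expansion)
    also have "\<dots> \<in> span (unitv ` {..<n})" by (intro span_sum span_scale span_base) auto
    finally show "x \<in> span (unitv ` {..<n})" .
  qed
qed

lemma span_functional_zero:
  assumes "\<And>y. y \<in> B \<Longrightarrow> ip n b y = 0" "x \<in> span B"
  shows "ip n b x = 0"
  using assms(2)
proof (induction rule: span_induct_alt)
  case base
  show ?case by (simp only: ip_linear)
next
  case (step c x y)
  thus ?case using assms(1) by (simp only: ip_linear)
qed

lemma orthonormal_not_in_span:
  assumes w: "orthonormal n m w" and i: "i < m"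
  shows "w i \<notin> span (w ` ({..<m} - {i}))"
proof
  assume "w i \<in> span (w ` ({..<m} - {i}))"
  hence "ip n (w i) (w i) = 0"
    by (rule span_functional_zero[rotated]) (use orthonormalD(2)[OF w i] in \<open>auto split: if_splits\<close>)
  thus False using orthonormalD(2)[OF w i i] by simp
qed

lemma orthonormal_independent:
  assumes w: "orthonormal n m w"
  shows "independent (w ` {..<m})" "inj_on w {..<m}"
proof -
  show inj: "inj_on w {..<m}"
  proof (rule inj_onI)
    fix i j assume "i \<in> {..<m}" "j \<in> {..<m}" "w i = w j"
    thus "i = j" using orthonormalD(2)[OF w, of i j] orthonormalD(2)[OF w, of i i] by (auto split: if_splits)
  qed
  show "independent (w ` {..<m})"
    unfolding dependent_def
  proof safe
    fix i assume i: "i < m" and "w i \<in> span (w ` {..<m} - {w i})"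
    moreover have "w ` {..<m} - {w i} \<subseteq> w ` ({..<m} - {i})" by auto
    ultimately show False using orthonormal_not_in_span[OF w i] span_mono by blast
  qed
qed

lemma orthonormal_dim:
  assumes "orthonormal n m w"
  shows "dim (span (w ` {..<m})) = m"
  using dim_span_eq_card_independent[OF orthonormal_independent(1)[OF assms]]
    card_image[OF orthonormal_independent(2)[OF assms]] by simp

lemma orthonormal_le:
  assumes "orthonormal n m w"
  shows "m \<le> n"
proof -
  have "w ` {..<m} \<subseteq> span (unitv ` {..<n})" using assms by (auto simp: span_unitv orthonormal_def)
  from independent_span_bound[OF _ orthonormal_independent(1)[OF assms] this]
  have "card (w ` {..<m}) \<le> card (unitv ` {..<n})" by simp
  also have "\<dots> \<le> n" using card_image_le[of "{..<n}" unitv] by simp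
  finally show ?thesis using orthonormal_independent(2)[OF assms] by (simp add: card_image)
qed

lemma exists_orthonormal:
  assumes "subspace E" "E \<subseteq> Rn n"
  shows "\<exists>w. orthonormal n (dim E) w \<and> span (w ` {..<dim E}) = E"
proof -
  obtain B where B: "B \<subseteq> E" "independent B" "E \<subseteq> span B" "card B = dim E"
    by (rule basis_exists)
  have "B \<subseteq> span (unitv ` {..<n})" using B assms by (auto simp: span_unitv)
  hence "finite B" using independent_span_bound[OF _ B(2)] by blast
  then obtain a where a: "bij_betw a {..<dim E} B"
    using B(4) by (metis ex_bij_betw_nat_finite lessThan_atLeast0)
  have aR: "a i \<in> Rn n" if "i < dim E" for i
    using that a B(1) assms(2) by (auto simp: bij_betw_def)
  have ind: "a i \<notin> span (a ` {..<i})" if i: "i < dim E" for i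
  proof
    assume "a i \<in> span (a ` {..<i})"
    moreover have "a ` {..<i} \<subseteq> B - {a i}"
    proof
      fix y assume "y \<in> a ` {..<i}"
      then obtain j where j: "y = a j" "j < i" by auto
      hence "a j \<noteq> a i" using a i by (auto simp: bij_betw_def inj_on_def)
      thus "y \<in> B - {a i}" using j i a by (auto simp: bij_betw_def)
    qed
    ultimately have "a i \<in> span (B - {a i})" using span_mono by blast
    moreover have "a i \<in> B" using i a by (auto simp: bij_betw_def)
    ultimately show False using B(2) by (auto simp: dependent_def)
  qed
  have "span (a ` {..<dim E}) = E"
    using a B(1,3) assms(1) span_minimal[of B E] by (auto simp: bij_betw_def)
  thus ?thesis using gs_vec_properties[OF aR ind order_refl] by blast
qed

lemma orth_complement_subspace: "subspace (orth_complement n E)" "orth_complement n E \<subseteq> Rn n"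
  by (auto simp: orth_complement_def subspace_def Rn_simps ip_linear)

lemma orth_complement_span:
  assumes "\<And>u. u \<in> B \<Longrightarrow> ip n y u = 0" "y \<in> Rn n"
  shows "y \<in> orth_complement n (span B)"
  using assms span_functional_zero[of B n y] by (auto simp: orth_complement_def)

definition fappend :: "nat \<Rightarrow> (nat \<Rightarrow> 'b) \<Rightarrow> (nat \<Rightarrow> 'b) \<Rightarrow> nat \<Rightarrow> 'b" where
  "fappend k u w = (\<lambda>i. if i < k then u i else w (i - k))"

lemma sum_fappend: "(\<Sum>i<k + d. g (fappend k u w i)) = (\<Sum>i<k. g (u i)) + (\<Sum>i<d. g (w i))"
proof -
  have "{..<k + d} = {..<k} \<union> (\<lambda>i. i + k) ` {..<d}"
  proof (intro equalityI subsetI)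
    fix x assume "x \<in> {..<k + d}"
    thus "x \<in> {..<k} \<union> (\<lambda>i. i + k) ` {..<d}"
      by (cases "x < k") (auto intro!: image_eqI[of _ _ "x - k"])
  qed auto
  hence "(\<Sum>i<k + d. g (fappend k u w i)) = (\<Sum>i<k. g (fappend k u w i)) + (\<Sum>i\<in>(\<lambda>i. i + k) ` {..<d}. g (fappend k u w i))"
    by (simp only:) (rule sum.union_disjoint; auto)
  also have "(\<Sum>i\<in>(\<lambda>i. i + k) ` {..<d}. g (fappend k u w i)) = (\<Sum>i<d. g (w i))"
    by (subst sum.reindex) (auto simp: fappend_def inj_on_def)
  finally show ?thesis by (simp add: fappend_def)
qed

text \<open>What remains of \<open>x\<close> after removing its components along both frames lies in
  the span of \<open>w\<close> and is orthogonal to it, hence is 0. The joint family therefore spans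
  R^n, which forces \<open>k + d = n\<close>.\<close>

lemma orthonormal_append:
  assumes u: "orthonormal n k u" and w: "orthonormal n d w" "span (w ` {..<d}) = orth_complement n (span (u ` {..<k}))"
  shows "orthonormal n (k + d) (fappend k u w)" "k + d = n"
    "\<And>x. x \<in> Rn n \<Longrightarrow> x = (\<Sum>i<k. ip n x (u i) *\<^sub>R u i) + (\<Sum>i<d. ip n x (w i) *\<^sub>R w i)"
proof -
  have uw: "ip n (w j) (u i) = 0" if "i < k" "j < d" for i j
  proof -
    have "w j \<in> orth_complement n (span (u ` {..<k}))" using w(2) that by (metis imageI lessThan_iff span_base)
    thus ?thesis using that by (auto simp: orth_complement_def intro: span_base)
  qed
  show on: "orthonormal n (k + d) (fappend k u w)"
    unfolding orthonormal_def
  proof (intro conjI allI impI)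
    fix i assume "i < k + d" thus "fappend k u w i \<in> Rn n"
      using orthonormalD(1)[OF u] orthonormalD(1)[OF w(1)] by (auto simp: fappend_def)
  next
    fix i j assume "i < k + d" "j < k + d"
    thus "ip n (fappend k u w i) (fappend k u w j) = (if i = j then 1 else 0)"
      using orthonormalD(2)[OF u, of i j] orthonormalD(2)[OF w(1), of "i - k" "j - k"] uw[of i "j - k"] uw[of j "i - k"]
        ip_commute[of n "u i" "w (j - k)"]
      by (auto simp: fappend_def)
  qed
  show exp: "x = (\<Sum>i<k. ip n x (u i) *\<^sub>R u i) + (\<Sum>i<d. ip n x (w i) *\<^sub>R w i)" if x: "x \<in> Rn n" for x
  proof -
    define y where "y = x - (\<Sum>i<k. ip n x (u i) *\<^sub>R u i)"
    have yR: "y \<in> Rn n" unfolding y_def using x orthonormalD(1)[OF u] by (intro Rn_simps Rn_sum) auto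
    have "ip n y (u i) = 0" if "i < k" for i
      using orthonormal_coeff[OF u that order_refl] that by (simp add: y_def ip_linear)
    hence "y \<in> span (w ` {..<d})" unfolding w(2) using yR by (intro orth_complement_span) auto
    define z where "z = y - (\<Sum>i<d. ip n x (w i) *\<^sub>R w i)"
    have zs: "z \<in> span (w ` {..<d})" unfolding z_def
      by (intro span_diff[OF \<open>y \<in> span (w ` {..<d})\<close>] span_sum span_scale span_base) auto
    have zw: "ip n z (w j) = 0" if "j < d" for j
    proof -
      have "ip n (\<Sum>i<k. ip n x (u i) *\<^sub>R u i) (w j) = 0"
        using uw that by (simp add: ip_sum ip_linear ip_commute[of n "u _"])
      thus ?thesis using orthonormal_coeff[OF w(1) that order_refl] that
        by (simp add: z_def y_def ip_linear)
    qed
    have "ip n z z = 0" by (rule span_functional_zero[OF _ zs]) (use zw in auto)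
    moreover have "z \<in> Rn n" unfolding z_def using yR orthonormalD(1)[OF w(1)] by (intro Rn_simps Rn_sum) auto
    ultimately have "z = 0" by (simp add: ip_self_eq_0_iff)
    thus ?thesis by (simp add: z_def y_def algebra_simps)
  qed
  have "Rn n \<subseteq> span (fappend k u w ` {..<k + d})"
  proof
    fix x assume "x \<in> Rn n"
    hence "x = (\<Sum>i<k + d. ip n x (fappend k u w i) *\<^sub>R fappend k u w i)"
      using exp sum_fappend[of "\<lambda>v. ip n x v *\<^sub>R v"] by simp
    also have "\<dots> \<in> span (fappend k u w ` {..<k + d})" by (intro span_sum span_scale span_base) auto
    finally show "x \<in> span (fappend k u w ` {..<k + d})" .
  qed
  hence "unitv ` {..<n} \<subseteq> span (fappend k u w ` {..<k + d})" by (auto simp: unitv_def Rn_def)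
  from independent_span_bound[OF _ orthonormal_independent(1)[OF orthonormal_unitv[OF order_refl]] this]
  have "card (unitv ` {..<n}) \<le> card (fappend k u w ` {..<k + d})" by simp
  also have "\<dots> \<le> k + d" using card_image_le[of "{..<k + d}"] by simp
  finally have "n \<le> k + d"
    using orthonormal_independent(2)[OF orthonormal_unitv[of n n]] by (simp add: card_image)
  thus "k + d = n" using orthonormal_le[OF on] by simp
qed

lemma orthonormal_extend:
  assumes u: "orthonormal n k u"
  obtains w where "orthonormal n (n - k) w" "span (w ` {..<n - k}) = orth_complement n (span (u ` {..<k}))"
    "orthonormal n n (fappend k u w)"
    "dim (orth_complement n (span (u ` {..<k}))) = n - k"
proof -
  let ?F = "orth_complement n (span (u ` {..<k}))"
  obtain w where w: "orthonormal n (dim ?F) w" "span (w ` {..<dim ?F}) = ?F"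
    using exists_orthonormal[OF orth_complement_subspace] by blast
  note A = orthonormal_append[OF u w]
  hence "dim ?F = n - k" by simp
  thus ?thesis using that[of w] w A by simp
qed

lemma orthonormal_full_expansion:
  assumes b: "orthonormal n n b" and x: "x \<in> Rn n"
  shows "x = (\<Sum>i<n. ip n x (b i) *\<^sub>R b i)"
proof -
  obtain w where w: "orthonormal n (n - n) w" "span (w ` {..<n - n}) = orth_complement n (span (b ` {..<n}))"
    by (rule orthonormal_extend[OF b])
  show ?thesis using orthonormal_append(3)[OF b w x] by simp
qed

section \<open>Orthogonal maps acting on vectors and tuples\<close>

definition frame_map :: "nat \<Rightarrow> (nat \<Rightarrow> nat \<Rightarrow> real) \<Rightarrow> (nat \<Rightarrow> nat \<Rightarrow> real) \<Rightarrow> (nat \<Rightarrow> real) \<Rightarrow> nat \<Rightarrow> real" where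
  "frame_map n b b' x = (\<Sum>i<n. ip n x (b i) *\<^sub>R b' i)"

lemma orthogonal_frame_map:
  assumes b: "orthonormal n n b" and b': "orthonormal n n b'"
  shows "orthogonal_map n (frame_map n b b')"
  unfolding orthogonal_map_def
proof (intro conjI ballI)
  show "linear (frame_map n b b')"
    by (rule linearI)
      (simp_all add: frame_map_def ip_linear scaleR_add_left sum.distrib scaleR_sum_right)
  have R: "frame_map n b b' x \<in> Rn n" for x
    unfolding frame_map_def using orthonormalD(1)[OF b'] by (intro Rn_sum Rn_simps) auto
  have inv: "frame_map n b b' (frame_map n b' b y) = y" if "y \<in> Rn n" for y
  proof -
    have "ip n (frame_map n b' b y) (b i) = ip n y (b' i)" if "i < n" for i
      unfolding frame_map_def using orthonormal_coeff[OF b that order_refl] that by simp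
    hence "frame_map n b b' (frame_map n b' b y) = (\<Sum>i<n. ip n y (b' i) *\<^sub>R b' i)"
      unfolding frame_map_def[of n b b'] by (intro sum.cong) auto
    thus ?thesis using orthonormal_full_expansion[OF b' that] by simp
  qed
  have R': "frame_map n b' b x \<in> Rn n" for x
    unfolding frame_map_def using orthonormalD(1)[OF b] by (intro Rn_sum Rn_simps) auto
  show "frame_map n b b' ` Rn n = Rn n"
  proof (intro equalityI subsetI)
    fix y assume "y \<in> Rn n"
    thus "y \<in> frame_map n b b' ` Rn n" using inv[of y] R'[of y] by (metis imageI)
  qed (use R in auto)
  fix x y assume x: "x \<in> Rn n" and y: "y \<in> Rn n"
  have "ip n (frame_map n b b' x) (frame_map n b b' y) = (\<Sum>i<n. ip n x (b i) * ip n (b' i) (frame_map n b b' y))"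
    unfolding frame_map_def[of n b b' x] by (simp add: ip_sum ip_linear)
  also have "\<dots> = (\<Sum>i<n. ip n x (b i) * ip n y (b i))"
    using orthonormal_coeff(2)[OF b' _ order_refl] by (intro sum.cong) (auto simp: frame_map_def)
  also have "\<dots> = ip n x (\<Sum>i<n. ip n y (b i) *\<^sub>R b i)" by (simp add: ip_sum ip_linear mult.commute)
  also have "\<dots> = ip n x y" using orthonormal_full_expansion[OF b y] by simp
  finally show "ip n (frame_map n b b' x) (frame_map n b b' y) = ip n x y" .
qed

lemma frame_map_frame: "orthonormal n n b \<Longrightarrow> i < n \<Longrightarrow> frame_map n b b' (b i) = b' i"
proof -
  assume b: "orthonormal n n b" and i: "i < n"
  have "frame_map n b b' (b i) = (\<Sum>j<n. if j = i then b' i else 0)"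
    unfolding frame_map_def using orthonormalD(2)[OF b i] by (intro sum.cong) auto
  thus ?thesis using i by simp
qed

lemma orthogonal_mapD:
  assumes "orthogonal_map n U"
  shows "linear U" "x \<in> Rn n \<Longrightarrow> U x \<in> Rn n" "x \<in> Rn n \<Longrightarrow> y \<in> Rn n \<Longrightarrow> ip n (U x) (U y) = ip n x y"
    "y \<in> Rn n \<Longrightarrow> \<exists>x\<in>Rn n. U x = y"
proof -
  show "y \<in> Rn n \<Longrightarrow> \<exists>x\<in>Rn n. U x = y"
    using assms unfolding orthogonal_map_def by (metis imageE)
qed (use assms in \<open>auto simp: orthogonal_map_def\<close>)

lemma orthogonal_map_orthonormal:
  "orthogonal_map n U \<Longrightarrow> orthonormal n m w \<Longrightarrow> orthonormal n m (\<lambda>j. U (w j))"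
  by (auto simp: orthonormal_def orthogonal_mapD)

lemma orthogonal_map_lin_comb:
  assumes "orthogonal_map n U" "x \<in> Rn n"
  shows "U x = lin_comb n (\<lambda>j. U (unitv j)) x"
proof -
  have "U x = U (\<Sum>i<n. x i *\<^sub>R unitv i)" using Rn_expansion[OF assms(2)] by simp
  also have "\<dots> = (\<Sum>i<n. x i *\<^sub>R U (unitv i))"
    using orthogonal_mapD(1)[OF assms(1)] by (simp add: linear_sum linear_scale)
  finally show ?thesis by (simp add: lin_comb_def)
qed

lemma orthogonal_map_measurable:
  assumes "orthogonal_map n U"
  shows "U \<in> leb n \<rightarrow>\<^sub>M leb n"
proof -
  have "(\<lambda>j\<in>{..<n}. U (unitv j)) \<in> space (tuples n n)"
    using orthogonal_mapD(2)[OF assms] by (auto simp: space_tuples unitv_def Rn_def)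
  hence "(\<lambda>x. lin_comb n (\<lambda>j\<in>{..<n}. U (unitv j)) x) \<in> leb n \<rightarrow>\<^sub>M leb n"
    by (intro lin_comb_measurable measurable_const measurable_ident_sets[OF refl])
  moreover have "lin_comb n (\<lambda>j\<in>{..<n}. U (unitv j)) x = U x" if "x \<in> space (leb n)" for x
    using orthogonal_map_lin_comb[OF assms, of x] that by (simp add: lin_comb_def)
  moreover have "(\<lambda>x. lin_comb n (\<lambda>j\<in>{..<n}. U (unitv j)) x) \<in> leb n \<rightarrow>\<^sub>M leb n \<longleftrightarrow> U \<in> leb n \<rightarrow>\<^sub>M leb n"
    by (rule measurable_cong) fact
  ultimately show ?thesis by blast
qed

text \<open>On R^n the map agrees with the matrix of the images of the unit vectors; its columns are
  orthonormal, so its determinant is 1 or -1.\<close>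

lemma nn_integral_orthogonal_map:
  assumes U: "orthogonal_map n U" and g: "g \<in> borel_measurable (leb n)"
  shows "(\<integral>\<^sup>+ x. g (U x) \<partial>leb n) = (\<integral>\<^sup>+ x. g x \<partial>leb n)"
proof -
  let ?Z = "\<lambda>j\<in>{..<n}. U (unitv j)"
  have Z: "?Z \<in> space (tuples n n)"
    using orthogonal_mapD(2)[OF U] by (auto simp: space_tuples unitv_def Rn_def)
  have "orthonormal n n ?Z"
    using orthogonal_map_orthonormal[OF U orthonormal_unitv[OF order_refl]] by (auto simp: orthonormal_def)
  hence d: "\<bar>det (tuple_mat n ?Z)\<bar> = 1" using abs_tuple_det_orthonormal by (simp add: tuple_det_def)
  have "(\<integral>\<^sup>+ x. g (U x) \<partial>leb n) = (\<integral>\<^sup>+ x. g (mat_app n (tuple_mat n ?Z) x) \<partial>leb n)"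
  proof (rule nn_integral_cong)
    fix x assume "x \<in> space (leb n)"
    hence "U x = lin_comb n ?Z x" using orthogonal_map_lin_comb[OF U, of x] by (simp add: lin_comb_def)
    thus "g (U x) = g (mat_app n (tuple_mat n ?Z) x)" by (simp add: lin_comb_eq_mat_app[OF Z])
  qed
  also have "\<dots> = ennreal (1 / \<bar>det (tuple_mat n ?Z)\<bar>) * (\<integral>\<^sup>+ x. g x \<partial>leb n)"
    using d by (intro nn_integral_mat_app g) auto
  finally show ?thesis using d by simp
qed

definition tuple_map :: "nat \<Rightarrow> ((nat \<Rightarrow> real) \<Rightarrow> (nat \<Rightarrow> real)) \<Rightarrow> (nat \<Rightarrow> nat \<Rightarrow> real) \<Rightarrow> nat \<Rightarrow> nat \<Rightarrow> real" where
  "tuple_map m U G = (\<lambda>j\<in>{..<m}. U (G j))"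

lemma tuple_map_space: "(\<And>x. x \<in> Rn n \<Longrightarrow> U x \<in> Rn n) \<Longrightarrow> G \<in> space (tuples n m) \<Longrightarrow> tuple_map m U G \<in> space (tuples n m)"
  by (auto simp: tuple_map_def space_tuples)

lemma nn_integral_tuple_map:
  assumes U: "orthogonal_map n U" and g: "g \<in> borel_measurable (tuples n m)"
  shows "(\<integral>\<^sup>+ G. g (tuple_map m U G) \<partial>tuples n m) = (\<integral>\<^sup>+ G. g G \<partial>tuples n m)"
proof -
  have "(\<integral>\<^sup>+ G. g (\<lambda>j\<in>{..<m}. U (G j)) \<partial>tuples n m) = (\<Prod>j\<in>{..<m}. 1) * (\<integral>\<^sup>+ G. g G \<partial>tuples n m)"
    by (rule nn_integral_PiM_componentwise[where T = "\<lambda>_. U"])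
       (use U g sigma_finite_leb orthogonal_map_measurable nn_integral_orthogonal_map in auto)
  thus ?thesis by (simp add: tuple_map_def)
qed

lemma gauss_tuple_map:
  assumes "orthogonal_map n U" "G \<in> space (tuples n m)"
  shows "gauss n m (tuple_map m U G) = gauss n m G"
proof -
  have "tuple_sqnorm n m (tuple_map m U G) = tuple_sqnorm n m G"
    unfolding tuple_sqnorm_def using orthogonal_mapD(3)[OF assms(1)] tuples_Rn[OF assms(2)]
    by (intro sum.cong) (auto simp: tuple_map_def)
  thus ?thesis by (simp add: gauss_def)
qed

lemma tuple_map_tuple_mult:
  assumes "linear U"
  shows "tuple_map m U (tuple_mult m G Z) = tuple_mult m (tuple_map m U G) Z"
  using assms by (auto simp: tuple_map_def tuple_mult_def linear_sum linear_scale intro!: restrict_ext sum.cong)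

section \<open>Random rotations from the Gram--Schmidt process\<close>

lemma gs_vec_Rn: "(\<And>j. j \<le> i \<Longrightarrow> a j \<in> Rn n) \<Longrightarrow> gs_vec n a i \<in> Rn n"
proof (induction i rule: less_induct)
  case (less i)
  hence "gs_residual n a i \<in> Rn n" unfolding gs_residual_def by (intro Rn_simps Rn_sum) auto
  thus ?case unfolding gs_vec_eq by (rule Rn_simps)
qed

lemma gs_residual_Rn: "(\<And>j. j \<le> i \<Longrightarrow> a j \<in> Rn n) \<Longrightarrow> gs_residual n a i \<in> Rn n"
  unfolding gs_residual_def by (intro Rn_simps Rn_sum gs_vec_Rn) auto

lemma gs_vec_measurable:
  assumes f: "f \<in> M \<rightarrow>\<^sub>M tuples n m"
  shows "i < m \<Longrightarrow> (\<lambda>x. gs_vec n (f x) i) \<in> M \<rightarrow>\<^sub>M leb n"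
proof (induction i rule: less_induct)
  case (less i)
  have IH: "(\<lambda>x. gs_vec n (f x) j) \<in> M \<rightarrow>\<^sub>M leb n" if "j < i" for j using less that by simp
  have fi: "(\<lambda>x. f x i) \<in> M \<rightarrow>\<^sub>M leb n" by (rule tuples_coord[OF f less.prems])
  have fR: "f x j \<in> Rn n" if "x \<in> space M" "j \<le> i" for x j
    by (rule tuples_Rn[OF measurable_space[OF f that(1)]]) (use that less.prems in simp)
  have v: "(\<lambda>x. gs_residual n (f x) i) \<in> M \<rightarrow>\<^sub>M leb n"
  proof (rule measurable_into_leb)
    fix x assume "x \<in> space M"
    thus "gs_residual n (f x) i \<in> Rn n" by (intro gs_residual_Rn fR)
  next
    fix a
    have "(\<lambda>x. f x i a - (\<Sum>j<i. ip n (f x i) (gs_vec n (f x) j) * gs_vec n (f x) j a)) \<in> borel_measurable M"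
      by (intro borel_measurable_diff borel_measurable_sum borel_measurable_times ip_measurable[OF fi IH] leb_coord_measurable[OF IH]
          leb_coord_measurable[OF fi]) simp_all
    thus "(\<lambda>x. gs_residual n (f x) i a) \<in> borel_measurable M"
      by (simp add: gs_residual_def fun_sum_apply scaleR_fun_def)
  qed
  show ?case
  proof (rule measurable_into_leb)
    fix x assume "x \<in> space M"
    thus "gs_vec n (f x) i \<in> Rn n" by (intro gs_vec_Rn fR)
  next
    fix a
    have [measurable]: "(\<lambda>x. ip n (gs_residual n (f x) i) (gs_residual n (f x) i)) \<in> borel_measurable M" "(\<lambda>x. gs_residual n (f x) i a) \<in> borel_measurable M"
      by (intro ip_measurable v) (rule leb_coord_measurable[OF v])
    have "(\<lambda>x. 1 / sqrt (ip n (gs_residual n (f x) i) (gs_residual n (f x) i)) * gs_residual n (f x) i a) \<in> borel_measurable M" by measurable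
    thus "(\<lambda>x. gs_vec n (f x) i a) \<in> borel_measurable M"
      by (simp add: gs_vec_eq scaleR_fun_def)
  qed
qed

text \<open>The process is built from inner products and linear combinations, and orthogonal maps
  respect both.\<close>

lemma gs_vec_tuple_map:
  assumes U: "orthogonal_map n U" and A: "A \<in> space (tuples n m)"
  shows "i < m \<Longrightarrow> gs_vec n (tuple_map m U A) i = U (gs_vec n A i)"
proof (induction i rule: less_induct)
  case (less i)
  have AR: "A j \<in> Rn n" if "j \<le> i" for j using tuples_Rn[OF A, of j] that less.prems by simp
  have q: "gs_vec n A j \<in> Rn n" if "j \<le> i" for j using that AR by (intro gs_vec_Rn) auto
  note linU = orthogonal_mapD(1)[OF U]
  have "gs_residual n (tuple_map m U A) i = U (A i) - (\<Sum>j<i. ip n (U (A i)) (U (gs_vec n A j)) *\<^sub>R U (gs_vec n A j))"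
  proof -
    have "tuple_map m U A i = U (A i)" using less.prems by (simp add: tuple_map_def)
    moreover have "gs_vec n (tuple_map m U A) j = U (gs_vec n A j)" if "j < i" for j using less.IH[OF that] that less.prems by simp
    ultimately show ?thesis unfolding gs_residual_def by simp
  qed
  also have "\<dots> = U (A i) - (\<Sum>j<i. U (ip n (A i) (gs_vec n A j) *\<^sub>R gs_vec n A j))"
    using AR q by (simp add: orthogonal_mapD(3)[OF U] linear_scale[OF linU])
  also have "\<dots> = U (gs_residual n A i)"
    unfolding gs_residual_def by (simp add: linear_diff[OF linU] linear_sum[OF linU])
  finally have eq: "gs_residual n (tuple_map m U A) i = U (gs_residual n A i)" .
  have "gs_residual n A i \<in> Rn n" using AR by (intro gs_residual_Rn) auto
  thus ?case unfolding gs_vec_eq eq by (simp add: orthogonal_mapD(3)[OF U] linear_scale[OF linU])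
qed

text \<open>
  The orthogonal matrix whose rows are the orthonormalised rows of A. For a Gaussian matrix A its law
  is invariant under right multiplication by orthogonal matrices, see gs_rotation_tuple_map, and it takes the
  role of the Haar measure of the orthogonal group.
\<close>

definition gs_rotation :: "nat \<Rightarrow> (nat \<Rightarrow> nat \<Rightarrow> real) \<Rightarrow> (nat \<Rightarrow> real) \<Rightarrow> nat \<Rightarrow> real" where
  "gs_rotation n A = frame_map n (gs_vec n A) unitv"

lemma unitv_Rn: "i < n \<Longrightarrow> unitv i \<in> Rn n"
  by (auto simp: unitv_def Rn_def)

lemma gs_rotation_Rn: "gs_rotation n A x \<in> Rn n"
  unfolding gs_rotation_def frame_map_def by (intro Rn_sum Rn_simps unitv_Rn) auto

lemma gs_rotation_linear: "linear (gs_rotation n A)"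
  unfolding gs_rotation_def
  by (rule linearI) (simp_all add: frame_map_def ip_linear scaleR_add_left sum.distrib scaleR_sum_right)

lemma gs_rotation_measurable:
  assumes f: "f \<in> M \<rightarrow>\<^sub>M tuples n n" and g: "g \<in> M \<rightarrow>\<^sub>M leb n"
  shows "(\<lambda>x. gs_rotation n (f x) (g x)) \<in> M \<rightarrow>\<^sub>M leb n"
proof (rule measurable_into_leb)
  fix a
  have "(\<lambda>x. \<Sum>i<n. ip n (g x) (gs_vec n (f x) i) * unitv i a) \<in> borel_measurable M"
    by (intro borel_measurable_sum borel_measurable_times ip_measurable g gs_vec_measurable[OF f] borel_measurable_const) auto
  thus "(\<lambda>x. gs_rotation n (f x) (g x) a) \<in> borel_measurable M"
    by (simp add: gs_rotation_def frame_map_def fun_sum_apply scaleR_fun_def)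
qed (rule gs_rotation_Rn)

lemma AE_gs_rotation_orthogonal: "AE A in tuples n n. orthogonal_map n (gs_rotation n A)"
  using AE_gram_mat_nonsingular[OF orthonormal_unitv[of n n, OF order_refl]] AE_space
proof eventually_elim
  fix A assume d: "det (gram_mat n n unitv A) \<noteq> 0" and A: "A \<in> space (tuples n n)"
  have "orthonormal n n (gs_vec n A)"
    using gs_vec_properties[of n A n n] tuples_Rn[OF A] gram_mat_independent[OF d] by blast
  thus "orthogonal_map n (gs_rotation n A)"
    unfolding gs_rotation_def by (rule orthogonal_frame_map) (rule orthonormal_unitv[OF order_refl])
qed

text \<open>Rotating \<open>A\<close> rotates its orthonormalised frame, so \<open>U x\<close> has
  the same coordinates in the new frame as \<open>x\<close> has in the old one.\<close>

lemma gs_rotation_tuple_map: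
  assumes U: "orthogonal_map n U" and A: "A \<in> space (tuples n n)" and x: "x \<in> Rn n"
  shows "gs_rotation n (tuple_map n U A) (U x) = gs_rotation n A x"
proof -
  have "gs_vec n A i \<in> Rn n" if "i < n" for i by (rule gs_vec_Rn, rule tuples_Rn[OF A]) (use that in simp)
  thus ?thesis unfolding gs_rotation_def frame_map_def
    using gs_vec_tuple_map[OF U A] orthogonal_mapD(3)[OF U x] by (intro sum.cong) auto
qed

definition frame_coords :: "nat \<Rightarrow> nat \<Rightarrow> (nat \<Rightarrow> nat \<Rightarrow> real) \<Rightarrow> (nat \<Rightarrow> nat \<Rightarrow> real) \<Rightarrow> nat \<Rightarrow> nat \<Rightarrow> real" where
  "frame_coords n m w G = (\<lambda>j\<in>{..<m}. \<lambda>i. if i < m then ip n (w i) (G j) else 0)"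

lemma frame_coords_space: "frame_coords n m w G \<in> space (tuples m m)"
  by (auto simp: frame_coords_def space_tuples Rn_def)

lemma tuple_det_frame_coords: "tuple_det m (frame_coords n m w G) = det (gram_mat n m w G)"
  unfolding tuple_det_def by (rule arg_cong[where f = det]) (auto simp: tuple_mat_def gram_mat_def frame_coords_def intro!: eq_matI)

lemma restrict_frame_space: "orthonormal n m w \<Longrightarrow> restrict w {..<m} \<in> space (tuples n m)"
  by (auto simp: space_tuples orthonormal_def)

lemma tuple_mult_restrict [simp]: "tuple_mult m (restrict w {..<m}) Z = tuple_mult m w Z"
  by (auto simp: tuple_mult_def intro!: restrict_ext)

lemma tuple_map_restrict [simp]: "tuple_map m U (restrict w {..<m}) = tuple_map m U w"
  by (auto simp: tuple_map_def)

section \<open>Averages of functions of a basis that are invariant under a change of basis\<close>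

locale basis_invariant =
  fixes n m :: nat and \<psi> :: "(nat \<Rightarrow> nat \<Rightarrow> real) \<Rightarrow> ennreal"
  assumes mn: "m \<le> n" and psi_meas: "\<psi> \<in> borel_measurable (tuples n m)"
    and psi_inv: "\<And>G S. G \<in> space (tuples n m) \<Longrightarrow> S \<in> space (tuples m m) \<Longrightarrow> tuple_det m S \<noteq> 0 \<Longrightarrow> \<psi> (tuple_mult m G S) = \<psi> G"
begin

text \<open>The mean of \<open>\<psi>\<close> over random rotations of \<open>G\<close>. For
  \<open>G\<close> of full rank it does not depend on \<open>G\<close>, since rotations and changes
  of basis together act transitively on such tuples.\<close>

definition rotation_average :: "(nat \<Rightarrow> nat \<Rightarrow> real) \<Rightarrow> ennreal" where
  "rotation_average G = (\<integral>\<^sup>+ A. gauss n n A * \<psi> (tuple_map m (gs_rotation n A) G) \<partial>tuples n n)"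

lemma tuple_map_gs_rotation_measurable:
  assumes "f \<in> M \<rightarrow>\<^sub>M tuples n n" "g \<in> M \<rightarrow>\<^sub>M tuples n m"
  shows "(\<lambda>x. tuple_map m (gs_rotation n (f x)) (g x)) \<in> M \<rightarrow>\<^sub>M tuples n m"
  unfolding tuple_map_def by (intro measurable_restrict gs_rotation_measurable assms tuples_coord[OF assms(2)]) auto

text \<open>Replacing A by its image under \<open>U\<close> preserves the Gaussian weight, and
  \<open>gs_rotation_tuple_map\<close> then removes \<open>U\<close>.\<close>

lemma rotation_average_orthogonal:
  assumes U: "orthogonal_map n U" and G: "G \<in> space (tuples n m)"
  shows "rotation_average (tuple_map m U G) = rotation_average G"
proof -
  let ?H = "\<lambda>A. gauss n n A * \<psi> (tuple_map m (gs_rotation n A) (tuple_map m U G))"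
  have UG: "tuple_map m U G \<in> space (tuples n m)" by (rule tuple_map_space[OF orthogonal_mapD(2)[OF U] G])
  have H: "?H \<in> borel_measurable (tuples n n)"
    by (intro borel_measurable_times_ennreal gauss_measurable measurable_compose[OF _ psi_meas] tuple_map_gs_rotation_measurable
        measurable_ident_sets[OF refl] measurable_const UG)
  have "rotation_average (tuple_map m U G) = (\<integral>\<^sup>+ A. ?H (tuple_map n U A) \<partial>tuples n n)"
    unfolding rotation_average_def by (rule nn_integral_tuple_map[OF U H, symmetric])
  also have "\<dots> = rotation_average G"
    unfolding rotation_average_def
  proof (rule nn_integral_cong)
    fix A assume A: "A \<in> space (tuples n n)"
    have "tuple_map m (gs_rotation n (tuple_map n U A)) (tuple_map m U G) = tuple_map m (gs_rotation n A) G"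
      using gs_rotation_tuple_map[OF U A] tuples_Rn[OF G] by (auto simp: tuple_map_def intro!: restrict_ext)
    thus "?H (tuple_map n U A) = gauss n n A * \<psi> (tuple_map m (gs_rotation n A) G)"
      by (simp add: gauss_tuple_map[OF U A])
  qed
  finally show ?thesis .
qed

lemma rotation_average_tuple_mult:
  assumes W: "W \<in> space (tuples n m)" and Z: "Z \<in> space (tuples m m)" "tuple_det m Z \<noteq> 0"
  shows "rotation_average (tuple_mult m W Z) = rotation_average W"
  unfolding rotation_average_def tuple_map_tuple_mult[OF gs_rotation_linear]
  by (intro nn_integral_cong arg_cong2[where f = "(*)"] refl psi_inv tuple_map_space gs_rotation_Rn W Z)

text \<open>Since \<open>w\<close> extends to an orthonormal basis of R^n, some orthogonal map
  carries the first \<open>m\<close> unit vectors to \<open>w\<close>.\<close>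

lemma rotation_average_const:
  assumes w: "orthonormal n m w" and Z: "Z \<in> space (tuples m m)" "tuple_det m Z \<noteq> 0"
  shows "rotation_average (tuple_mult m w Z) = rotation_average (restrict unitv {..<m})"
proof -
  obtain v where v: "orthonormal n n (fappend m w v)" by (rule orthonormal_extend[OF w])
  let ?U = "frame_map n unitv (fappend m w v)"
  have U: "orthogonal_map n ?U" by (rule orthogonal_frame_map[OF orthonormal_unitv[OF order_refl] v])
  have eq: "tuple_map m ?U (restrict unitv {..<m}) = restrict w {..<m}"
    using frame_map_frame[OF orthonormal_unitv[OF order_refl], of _ n "fappend m w v"] mn
    by (auto simp: tuple_map_def fappend_def intro!: restrict_ext)
  have "rotation_average (tuple_mult m w Z) = rotation_average (restrict w {..<m})"
    using rotation_average_tuple_mult[OF restrict_frame_space[OF w] Z] by simp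
  also have "\<dots> = rotation_average (restrict unitv {..<m})"
    unfolding eq[symmetric] by (rule rotation_average_orthogonal[OF U restrict_frame_space[OF orthonormal_unitv[OF mn]]])
  finally show ?thesis .
qed

text \<open>By the QR decomposition almost every \<open>G\<close> is an orthonormal frame times an
  invertible matrix.\<close>

lemma AE_rotation_average_const: "AE G in tuples n m. rotation_average G = rotation_average (restrict unitv {..<m})"
  using AE_gram_mat_nonsingular[OF orthonormal_unitv[OF mn]] AE_space
proof eventually_elim
  fix G assume d: "det (gram_mat n m unitv G) \<noteq> 0" and G: "G \<in> space (tuples n m)"
  let ?q = "gs_vec n G"
  have GR: "\<And>i. i < m \<Longrightarrow> G i \<in> Rn n" by (rule tuples_Rn[OF G])
  have ind: "\<And>i. i < m \<Longrightarrow> G i \<notin> span (G ` {..<i})" by (rule gram_mat_independent[OF d])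
  have E1: "orthonormal n m ?q" using gs_vec_expansion(1)[of m G n] GR ind by blast
  have E2: "G j = (\<Sum>i<m. gram_mat n m ?q G $$ (i,j) *\<^sub>R ?q i)" if "j < m" for j
    using gs_vec_expansion(2)[of m G n j] GR ind that by blast
  have E5: "det (gram_mat n m ?q G) \<noteq> 0" using gs_vec_expansion(4)[of m G n] GR ind by blast
  have "G = tuple_mult m ?q (frame_coords n m ?q G)"
  proof
    fix j show "G j = tuple_mult m ?q (frame_coords n m ?q G) j"
    proof (cases "j < m")
      case True
      have "tuple_mult m ?q (frame_coords n m ?q G) j = (\<Sum>i<m. frame_coords n m ?q G j i *\<^sub>R ?q i)"
        using True by (simp add: tuple_mult_def)
      also have "\<dots> = (\<Sum>i<m. gram_mat n m ?q G $$ (i,j) *\<^sub>R ?q i)"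
        using True by (intro sum.cong) (auto simp: frame_coords_def)
      also have "\<dots> = G j" by (rule E2[OF True, symmetric])
      finally show ?thesis ..
    next
      case False thus ?thesis using G by (auto simp: space_tuples tuple_mult_def extensional_def)
    qed
  qed
  moreover have "tuple_det m (frame_coords n m ?q G) \<noteq> 0" using E5 by (simp add: tuple_det_frame_coords)
  ultimately show "rotation_average G = rotation_average (restrict unitv {..<m})"
    using rotation_average_const[OF E1 frame_coords_space] by metis
qed

text \<open>The double mean over \<open>A\<close> and \<open>G\<close> is computed in both orders.
  For fixed \<open>A\<close> the rotation drops out by the invariance of the Gaussian weight; for
  fixed \<open>G\<close> the inner mean is the constant value of
  \<open>rotation_average\<close>.\<close>

lemma gauss_average:
  "(\<integral>\<^sup>+ A. gauss n n A \<partial>tuples n n) * (\<integral>\<^sup>+ G. gauss n m G * \<psi> G \<partial>tuples n m) =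
   (\<integral>\<^sup>+ G. gauss n m G \<partial>tuples n m) * rotation_average (restrict unitv {..<m})"
proof -
  let ?X = "\<integral>\<^sup>+ G. gauss n m G * \<psi> G \<partial>tuples n m"
  have cm: "(\<lambda>G. gauss n m G * \<psi> G) \<in> borel_measurable (tuples n m)"
    by (intro borel_measurable_times_ennreal gauss_measurable psi_meas measurable_ident_sets[OF refl])
  have gA: "(\<lambda>A. gauss n n A) \<in> borel_measurable (tuples n n)" by (intro gauss_measurable measurable_ident_sets[OF refl])
  have gG: "(\<lambda>A. gauss n m A) \<in> borel_measurable (tuples n m)" by (intro gauss_measurable measurable_ident_sets[OF refl])
  have jm: "(\<lambda>p. gauss n n (fst p) * (gauss n m (snd p) * \<psi> (tuple_map m (gs_rotation n (fst p)) (snd p)))) \<in> borel_measurable (tuples n n \<Otimes>\<^sub>M tuples n m)"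
    by (intro borel_measurable_times_ennreal gauss_measurable measurable_compose[OF _ psi_meas] tuple_map_gs_rotation_measurable measurable_fst measurable_snd)
  have "(\<integral>\<^sup>+ A. gauss n n A \<partial>tuples n n) * ?X = (\<integral>\<^sup>+ A. gauss n n A * ?X \<partial>tuples n n)"
    by (rule nn_integral_multc[symmetric, OF gA])
  also have "\<dots> = (\<integral>\<^sup>+ A. \<integral>\<^sup>+ G. gauss n n A * (gauss n m G * \<psi> (tuple_map m (gs_rotation n A) G)) \<partial>tuples n m \<partial>tuples n n)"
  proof (rule nn_integral_cong_AE, use AE_gs_rotation_orthogonal[of n] AE_space in eventually_elim)
    fix A assume U: "orthogonal_map n (gs_rotation n A)" and A: "A \<in> space (tuples n n)"
    have m1: "(\<lambda>G. gauss n m G * \<psi> (tuple_map m (gs_rotation n A) G)) \<in> borel_measurable (tuples n m)"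
      by (intro borel_measurable_times_ennreal gauss_measurable measurable_compose[OF _ psi_meas] tuple_map_gs_rotation_measurable
          measurable_ident_sets[OF refl] measurable_const A)
    have "?X = (\<integral>\<^sup>+ G. gauss n m (tuple_map m (gs_rotation n A) G) * \<psi> (tuple_map m (gs_rotation n A) G) \<partial>tuples n m)"
      by (rule nn_integral_tuple_map[OF U cm, symmetric])
    also have "\<dots> = (\<integral>\<^sup>+ G. gauss n m G * \<psi> (tuple_map m (gs_rotation n A) G) \<partial>tuples n m)"
      by (intro nn_integral_cong) (simp add: gauss_tuple_map[OF U])
    finally show "gauss n n A * ?X = (\<integral>\<^sup>+ G. gauss n n A * (gauss n m G * \<psi> (tuple_map m (gs_rotation n A) G)) \<partial>tuples n m)"
      by (simp add: nn_integral_cmult[OF m1])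
  qed
  also have "\<dots> = (\<integral>\<^sup>+ G. \<integral>\<^sup>+ A. gauss n n A * (gauss n m G * \<psi> (tuple_map m (gs_rotation n A) G)) \<partial>tuples n n \<partial>tuples n m)"
    by (rule nn_integral_swap[OF sigma_finite_tuples sigma_finite_tuples jm])
  also have "\<dots> = (\<integral>\<^sup>+ G. gauss n m G * rotation_average (restrict unitv {..<m}) \<partial>tuples n m)"
  proof (rule nn_integral_cong_AE, use AE_rotation_average_const AE_space in eventually_elim)
    fix G assume c: "rotation_average G = rotation_average (restrict unitv {..<m})" and G: "G \<in> space (tuples n m)"
    have m2: "(\<lambda>A. gauss n n A * \<psi> (tuple_map m (gs_rotation n A) G)) \<in> borel_measurable (tuples n n)"
      by (intro borel_measurable_times_ennreal gauss_measurable measurable_compose[OF _ psi_meas] tuple_map_gs_rotation_measurable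
          measurable_ident_sets[OF refl] measurable_const G)
    have "(\<integral>\<^sup>+ A. gauss n n A * (gauss n m G * \<psi> (tuple_map m (gs_rotation n A) G)) \<partial>tuples n n) = (\<integral>\<^sup>+ A. gauss n m G * (gauss n n A * \<psi> (tuple_map m (gs_rotation n A) G)) \<partial>tuples n n)"
      by (simp only: mult_ac)
    also have "\<dots> = gauss n m G * rotation_average G" unfolding rotation_average_def by (rule nn_integral_cmult[OF m2])
    finally show "(\<integral>\<^sup>+ A. gauss n n A * (gauss n m G * \<psi> (tuple_map m (gs_rotation n A) G)) \<partial>tuples n n) = gauss n m G * rotation_average (restrict unitv {..<m})"
      by (simp add: c)
  qed
  also have "\<dots> = (\<integral>\<^sup>+ G. gauss n m G \<partial>tuples n m) * rotation_average (restrict unitv {..<m})"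
    by (rule nn_integral_multc[OF gG])
  finally show ?thesis .
qed

end

section \<open>Orthogonal projections and subspaces\<close>

lemma indicator_unitv: "(indicator {j} :: nat \<Rightarrow> real) = unitv j"
  by (auto simp: unitv_def indicator_def)

lemma grassmannian_frames:
  assumes E: "E \<in> grassmannian n k"
  obtains u w where "orthonormal n k u" "span (u ` {..<k}) = E"
    "orthonormal n (n - k) w" "span (w ` {..<n - k}) = orth_complement n E"
    "dim (orth_complement n E) = n - k" "k \<le> n"
proof -
  have *: "subspace E" "E \<subseteq> Rn n" "dim E = k" using E by (auto simp: grassmannian_def)
  obtain u where u: "orthonormal n k u" "span (u ` {..<k}) = E"
    using exists_orthonormal[OF *(1,2)] *(3) by auto
  obtain w where "orthonormal n (n - k) w" "span (w ` {..<n - k}) = orth_complement n (span (u ` {..<k}))"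
    "dim (orth_complement n (span (u ` {..<k}))) = n - k" by (rule orthonormal_extend[OF u(1)])
  thus ?thesis using that[OF u] orthonormal_le[OF u(1)] u(2) by simp
qed

lemma orth_proj_frame:
  assumes u: "orthonormal n k u" and E: "span (u ` {..<k}) = E"
  shows "orth_proj n E x = (\<Sum>j<k. ip n x (u j) *\<^sub>R u j)"
  unfolding orth_proj_def
proof (rule the_equality)
  let ?p = "\<Sum>j<k. ip n x (u j) *\<^sub>R u j"
  have pE: "?p \<in> E" unfolding E[symmetric] by (intro span_sum span_scale span_base) auto
  have pu: "ip n (x - ?p) (u i) = 0" if "i < k" for i
    using orthonormal_coeff[OF u that order_refl] that by (simp add: ip_linear)
  have pz: "ip n (x - ?p) z = 0" if "z \<in> E" for z
    by (rule span_functional_zero[of "u ` {..<k}"]) (use pu that E in auto)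
  show "?p \<in> E \<and> (\<forall>z\<in>E. ip n (x - ?p) z = 0)" using pE pz by blast
  fix y assume y: "y \<in> E \<and> (\<forall>z\<in>E. ip n (x - y) z = 0)"
  have ER: "E \<subseteq> Rn n" unfolding E[symmetric]
    by (rule span_minimal[OF _ subspace_Rn]) (use orthonormalD(1)[OF u] in auto)
  have d: "y - ?p \<in> E" using y pE unfolding E[symmetric] by (intro span_diff) auto
  have "ip n (y - ?p) (y - ?p) = ip n (x - ?p) (y - ?p) - ip n (x - y) (y - ?p)"
    by (simp add: ip_linear)
  also have "\<dots> = 0" using pz[OF d] y d by simp
  finally show "y = ?p" using ip_self_eq_0_iff[of "y - ?p" n] d ER by auto
qed

text \<open>
  The projection onto the orthogonal complement of E maps a Gaussian tuple to a basis of the complement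
  almost surely. This makes functions of bases measurable functions of E, without a choice of a basis.
\<close>

definition coproj :: "nat \<Rightarrow> (nat \<Rightarrow> real) set \<Rightarrow> (nat \<Rightarrow> real) \<Rightarrow> nat \<Rightarrow> real" where
  "coproj n E x = x - orth_proj n E x"

lemma orth_proj_Rn:
  assumes "E \<in> grassmannian n k"
  shows "orth_proj n E x \<in> E" "E \<subseteq> Rn n" "orth_proj n E x \<in> Rn n"
proof -
  obtain u where u: "orthonormal n k u" "span (u ` {..<k}) = E" by (rule grassmannian_frames[OF assms])
  show 1: "orth_proj n E x \<in> E"
    unfolding orth_proj_frame[OF u] by (subst u(2)[symmetric]) (intro span_sum span_scale span_base, auto)
  show 2: "E \<subseteq> Rn n" using assms by (simp add: grassmannian_def)
  show "orth_proj n E x \<in> Rn n" using 1 2 by blast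
qed

lemma coproj_frame:
  assumes E: "E \<in> grassmannian n k" and w: "orthonormal n (n - k) w" "span (w ` {..<n - k}) = orth_complement n E"
    and x: "x \<in> Rn n"
  shows "coproj n E x = (\<Sum>i<n - k. ip n x (w i) *\<^sub>R w i)"
proof -
  obtain u where u: "orthonormal n k u" "span (u ` {..<k}) = E" by (rule grassmannian_frames[OF E])
  show ?thesis
    using orthonormal_append(3)[OF u(1) w(1) _ x] w(2) u(2) orth_proj_frame[OF u, of x]
    by (simp add: coproj_def algebra_simps)
qed

text \<open>The coordinate matrix of the projected tuple has a Gram determinant as its determinant.
  This is nonzero for almost every \<open>G\<close>, and then the projected tuple is a basis of the
  complement.\<close>

lemma tuple_map_coproj_frame:
  assumes E: "E \<in> grassmannian n k" and w: "orthonormal n (n - k) w" "span (w ` {..<n - k}) = orth_complement n E"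
    and G: "G \<in> space (tuples n (n - k))"
  shows "tuple_map (n - k) (coproj n E) G = tuple_mult (n - k) w (frame_coords n (n - k) w G)"
proof
  fix j show "tuple_map (n - k) (coproj n E) G j = tuple_mult (n - k) w (frame_coords n (n - k) w G) j"
  proof (cases "j < n - k")
    case True
    have "coproj n E (G j) = (\<Sum>i<n - k. ip n (G j) (w i) *\<^sub>R w i)" by (rule coproj_frame[OF E w tuples_Rn[OF G True]])
    also have "\<dots> = (\<Sum>i<n - k. frame_coords n (n - k) w G j i *\<^sub>R w i)"
      using True by (intro sum.cong) (auto simp: frame_coords_def ip_commute)
    finally show ?thesis using True by (simp add: tuple_map_def tuple_mult_def)
  qed (simp add: tuple_map_def tuple_mult_def)
qed

lemma orthogonal_map_grassmannian:
  assumes U: "orthogonal_map n U" and E: "E \<in> grassmannian n k"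
  shows "U ` E \<in> grassmannian n k"
    and "x \<in> Rn n \<Longrightarrow> orth_proj n (U ` E) (U x) = U (orth_proj n E x)"
proof -
  note linU = orthogonal_mapD(1)[OF U]
  have sp: "span ((\<lambda>j. U (u j)) ` {..<k}) = U ` E" if "span (u ` {..<k}) = E" for u
    using linear_span_image[OF linU, of "u ` {..<k}"] that by (simp add: image_image)
  have fr: "orth_proj n (U ` E) y = (\<Sum>j<k. ip n y (U (u j)) *\<^sub>R U (u j))"
    if "orthonormal n k u" "span (u ` {..<k}) = E" for u y
    by (rule orth_proj_frame[OF orthogonal_map_orthonormal[OF U that(1)] sp[OF that(2)]])
  obtain u where u: "orthonormal n k u" "span (u ` {..<k}) = E" by (rule grassmannian_frames[OF E])
  have "subspace (U ` E)" "dim (U ` E) = k"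
    using sp[OF u(2)] orthonormal_dim[OF orthogonal_map_orthonormal[OF U u(1)]] subspace_span by metis+
  moreover have "U ` E \<subseteq> Rn n" using E orthogonal_mapD(2)[OF U] by (auto simp: grassmannian_def)
  ultimately show "U ` E \<in> grassmannian n k" by (simp add: grassmannian_def)
  assume x: "x \<in> Rn n"
  show "orth_proj n (U ` E) (U x) = U (orth_proj n E x)"
    unfolding fr[OF u] orth_proj_frame[OF u]
    using orthogonal_mapD(3)[OF U x orthonormalD(1)[OF u(1)]]
    by (simp add: linear_sum[OF linU] linear_scale[OF linU])
qed

text \<open>The entries on the right are the functions that generate
  \<open>grassmannian_borel\<close>; all measurability in \<open>E\<close> rests on this
  formula.\<close>

lemma orth_proj_coords:
  assumes E: "E \<in> grassmannian n k" and x: "x \<in> Rn n"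
  shows "orth_proj n E x i = (\<Sum>j<n. x j * orth_proj n E (indicator {j}) i)"
proof -
  obtain u where u: "orthonormal n k u" "span (u ` {..<k}) = E" by (rule grassmannian_frames[OF E])
  have "ip n x (u l) = (\<Sum>j<n. x j * ip n (unitv j) (u l))" for l
    by (subst Rn_expansion[OF x]) (simp add: ip_sum ip_linear)
  hence "orth_proj n E x i = (\<Sum>l<k. \<Sum>j<n. x j * (ip n (unitv j) (u l) * u l i))"
    unfolding orth_proj_frame[OF u] fun_sum_apply scaleR_fun_def by (simp add: sum_distrib_right mult.assoc)
  also have "\<dots> = (\<Sum>j<n. x j * orth_proj n E (indicator {j}) i)"
    unfolding indicator_unitv orth_proj_frame[OF u] fun_sum_apply scaleR_fun_def
    by (subst sum.swap) (simp add: sum_distrib_left)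
  finally show ?thesis .
qed

section \<open>Measurability and invariance on the Grassmannian\<close>

context
  fixes n k :: nat and \<nu> :: "(nat \<Rightarrow> real) set measure"
  assumes haar: "haar_grassmannian n k \<nu>"
begin

lemma haarD: "prob_space \<nu>" "space \<nu> = grassmannian n k" "sets \<nu> = sets (grassmannian_borel n k)"
  "orthogonal_map n U \<Longrightarrow> distr \<nu> \<nu> ((`) U) = \<nu>"
  using haar by (auto simp: haar_grassmannian_def)

lemma proj_entry_measurable: "(\<lambda>E. orth_proj n E (indicator {j}) i) \<in> borel_measurable \<nu>"
proof -
  let ?f = "\<lambda>E j i. orth_proj n E (indicator {j}) i"
  have "?f \<in> grassmannian_borel n k \<rightarrow>\<^sub>M borel"
    unfolding grassmannian_borel_def by (rule measurable_vimage_algebra1) auto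
  hence "?f \<in> \<nu> \<rightarrow>\<^sub>M borel" using measurable_cong_sets[OF haarD(3) refl] by blast
  from measurable_product_then_coordinatewise[OF measurable_product_then_coordinatewise[OF this]]
  show ?thesis .
qed

lemma coproj_measurable:
  assumes f: "f \<in> M \<rightarrow>\<^sub>M \<nu>" and g: "g \<in> M \<rightarrow>\<^sub>M leb n"
  shows "(\<lambda>x. coproj n (f x) (g x)) \<in> M \<rightarrow>\<^sub>M leb n"
proof (rule measurable_into_leb)
  fix x assume x: "x \<in> space M"
  have "f x \<in> grassmannian n k" "g x \<in> Rn n" using measurable_space[OF f x] measurable_space[OF g x] haarD(2) by auto
  thus "coproj n (f x) (g x) \<in> Rn n" unfolding coproj_def by (intro Rn_simps(4) orth_proj_Rn(3))
next
  fix i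
  have "(\<lambda>x. g x i - (\<Sum>j<n. g x j * orth_proj n (f x) (indicator {j}) i)) \<in> borel_measurable M"
    by (intro borel_measurable_diff borel_measurable_sum borel_measurable_times leb_coord_measurable[OF g]
        measurable_compose[OF f proj_entry_measurable])
  moreover have "coproj n (f x) (g x) i = g x i - (\<Sum>j<n. g x j * orth_proj n (f x) (indicator {j}) i)"
    if x: "x \<in> space M" for x
    using orth_proj_coords[of "f x" n k "g x" i] measurable_space[OF f x] measurable_space[OF g x] haarD(2)
    by (simp add: coproj_def)
  ultimately show "(\<lambda>x. coproj n (f x) (g x) i) \<in> borel_measurable M"
    by (simp cong: measurable_cong)
qed

text \<open>The projection onto the image of a subspace is the old projection conjugated by
  \<open>U\<close>, so its entries are linear in the old entries.\<close>

lemma image_measurable: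
  assumes U: "orthogonal_map n U"
  shows "(`) U \<in> \<nu> \<rightarrow>\<^sub>M \<nu>"
proof -
  have "(`) U \<in> \<nu> \<rightarrow>\<^sub>M grassmannian_borel n k"
    unfolding grassmannian_borel_def
  proof (rule measurable_vimage_algebra2)
    show "(`) U \<in> space \<nu> \<rightarrow> grassmannian n k" using orthogonal_map_grassmannian(1)[OF U] haarD(2) by auto
    show "(\<lambda>E j i. orth_proj n (U ` E) (indicator {j}) i) \<in> borel_measurable \<nu>"
    proof (intro measurable_coordinatewise_then_product)
      fix j i
      \<comment> \<open>\<open>V a\<close> is the preimage of the unit vector with index
        \<open>a\<close>. The entries are indexed by all natural numbers; those with an index from
        \<open>n\<close> on are 0 and are treated apart.\<close>
      define V where "V a = (if a < n then SOME x. x \<in> Rn n \<and> U x = unitv a else 0)" for a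
      have V: "V a \<in> Rn n" "U (V a) = unitv a" if "a < n" for a
        using someI_ex[of "\<lambda>x. x \<in> Rn n \<and> U x = unitv a"] orthogonal_mapD(4)[OF U unitv_Rn[OF that]] that
        by (auto simp: V_def)
      show "(\<lambda>E. orth_proj n (U ` E) (indicator {j}) i) \<in> borel_measurable \<nu>"
      proof (cases "j < n \<and> i < n")
        case True
        have "orth_proj n (U ` E) (indicator {j}) i = (\<Sum>a<n. (\<Sum>b<n. V j b * orth_proj n E (indicator {b}) a) * U (unitv a) i)"
          if E: "E \<in> space \<nu>" for E
        proof -
          have E': "E \<in> grassmannian n k" using E haarD(2) by simp
          have "orth_proj n (U ` E) (indicator {j}) = U (orth_proj n E (V j))"
            using orthogonal_map_grassmannian(2)[OF U E' V(1)] V(2) True by (simp add: indicator_unitv)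
          also have "\<dots> = lin_comb n (\<lambda>j. U (unitv j)) (orth_proj n E (V j))"
            by (rule orthogonal_map_lin_comb[OF U orth_proj_Rn(3)[OF E']])
          finally show ?thesis using V(1) True
            by (simp add: lin_comb_apply orth_proj_coords[OF E' V(1)])
        qed
        moreover have "(\<lambda>E. \<Sum>a<n. (\<Sum>b<n. V j b * orth_proj n E (indicator {b}) a) * U (unitv a) i) \<in> borel_measurable \<nu>"
          by (intro borel_measurable_sum borel_measurable_times borel_measurable_const proj_entry_measurable)
        ultimately show ?thesis by (simp cong: measurable_cong)
      next
        case False
        have "orth_proj n (U ` E) (indicator {j}) i = 0" if E: "E \<in> space \<nu>" for E
        proof -
          have E': "U ` E \<in> grassmannian n k" using E haarD(2) orthogonal_map_grassmannian(1)[OF U] by simp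
          show ?thesis
          proof (cases "i < n")
            case False thus ?thesis using orth_proj_Rn(3)[OF E', of "indicator {j}"] by (auto simp: Rn_def)
          next
            case True
            obtain u where u: "orthonormal n k u" "span (u ` {..<k}) = U ` E" by (rule grassmannian_frames[OF E'])
            have "ip n (unitv j) (u l) = 0" for l using False True by (auto simp: ip_def unitv_def)
            thus ?thesis unfolding orth_proj_frame[OF u] indicator_unitv by (simp add: fun_sum_apply scaleR_fun_def)
          qed
        qed
        thus ?thesis by (simp cong: measurable_cong)
      qed
    qed
  qed
  thus ?thesis using measurable_cong_sets[OF refl haarD(3)] by blast
qed

lemma nn_integral_image:
  assumes U: "orthogonal_map n U" and X: "X \<in> borel_measurable \<nu>"
  shows "(\<integral>\<^sup>+ E. X (U ` E) \<partial>\<nu>) = (\<integral>\<^sup>+ E. X E \<partial>\<nu>)"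
  using nn_integral_distr[OF image_measurable[OF U], of X] X haarD(4)[OF U] by simp

end

text \<open>For the mean over \<open>E\<close>, a Gaussian rotation \<open>A\<close> is inserted,
  which the invariance of \<open>\<nu>\<close> absorbs. With \<open>E\<close> and \<open>G\<close>
  fixed, the mean over \<open>A\<close> is for almost every \<open>G\<close> the constant that
  \<open>gauss_average\<close> relates to the mean over Gaussian tuples.\<close>

lemma (in basis_invariant) haar_average:
  assumes haar: "haar_grassmannian n k \<nu>" and m: "m = n - k"
  defines "X \<equiv> \<lambda>E. \<integral>\<^sup>+ G. gauss n m G * \<psi> (tuple_map m (coproj n E) G) \<partial>tuples n m"
  shows "X \<in> borel_measurable \<nu>"
    and "(\<integral>\<^sup>+ E. X E \<partial>\<nu>) = (\<integral>\<^sup>+ G. gauss n m G * \<psi> G \<partial>tuples n m)"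
    and "\<And>E w. E \<in> grassmannian n k \<Longrightarrow> orthonormal n m w \<Longrightarrow> span (w ` {..<m}) = orth_complement n E \<Longrightarrow>
      X E = (\<integral>\<^sup>+ G. gauss n m G \<partial>tuples n m) * \<psi> (restrict w {..<m})"
proof -
  interpret \<nu>: prob_space \<nu> by (rule haarD(1)[OF haar])
  have sp: "space \<nu> = grassmannian n k" by (rule haarD(2)[OF haar])
  have sf: "sigma_finite_measure \<nu>" by (rule \<nu>.sigma_finite_measure_axioms)
  have tm: "(\<lambda>x. tuple_map m (coproj n (f x)) (g x)) \<in> N \<rightarrow>\<^sub>M tuples n m"
    if "f \<in> N \<rightarrow>\<^sub>M \<nu>" "g \<in> N \<rightarrow>\<^sub>M tuples n m" for f g and N :: "'z measure"
    unfolding tuple_map_def by (intro measurable_restrict coproj_measurable[OF haar] that tuples_coord[OF that(2)]) auto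
  have gw': "(\<lambda>A. gauss n p A) \<in> borel_measurable (tuples n p)" for p by (intro gauss_measurable measurable_ident_sets[OF refl])
  have Rn': "coproj n E x \<in> Rn n" if "E \<in> grassmannian n k" "x \<in> Rn n" for E x
    unfolding coproj_def by (intro Rn_simps(4) that(2) orth_proj_Rn(3)[OF that(1)])
  have tsp: "tuple_map m (coproj n E) G \<in> space (tuples n m)" if "E \<in> grassmannian n k" "G \<in> space (tuples n m)" for E G
    by (rule tuple_map_space[OF Rn'[OF that(1)] that(2)])
  show Xm: "X \<in> borel_measurable \<nu>"
    unfolding X_def
    by (rule sigma_tuples_nn_integral_measurable)
       (intro borel_measurable_times_ennreal gauss_measurable measurable_snd measurable_compose[OF tm psi_meas] measurable_fst)
  show XW: "X E = (\<integral>\<^sup>+ G. gauss n m G \<partial>tuples n m) * \<psi> (restrict w {..<m})"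
    if E: "E \<in> grassmannian n k" and w: "orthonormal n m w" "span (w ` {..<m}) = orth_complement n E" for E w
  proof -
    have "X E = (\<integral>\<^sup>+ G. gauss n m G * \<psi> (restrict w {..<m}) \<partial>tuples n m)"
      unfolding X_def
    proof (rule nn_integral_cong_AE, use AE_gram_mat_nonsingular[OF w(1)] AE_space in eventually_elim)
      fix G assume d: "det (gram_mat n m w G) \<noteq> 0" and G: "G \<in> space (tuples n m)"
      have "tuple_map m (coproj n E) G = tuple_mult m (restrict w {..<m}) (frame_coords n m w G)"
        using tuple_map_coproj_frame[OF E, of w G] w G by (simp add: m)
      hence "\<psi> (tuple_map m (coproj n E) G) = \<psi> (restrict w {..<m})"
        using psi_inv[OF restrict_frame_space[OF w(1)] frame_coords_space] d by (simp add: tuple_det_frame_coords)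
      thus "gauss n m G * \<psi> (tuple_map m (coproj n E) G) = gauss n m G * \<psi> (restrict w {..<m})" by simp
    qed
    thus ?thesis by (simp add: nn_integral_multc[OF gw'])
  qed
  let ?a = "rotation_average (restrict unitv {..<m})"
  have rotation_average_coproj: "AE G in tuples n m. rotation_average (tuple_map m (coproj n E) G) = ?a" if E: "E \<in> grassmannian n k" for E
  proof -
    obtain w where w: "orthonormal n m w" "span (w ` {..<m}) = orth_complement n E"
      unfolding m by (rule grassmannian_frames[OF E])
    show ?thesis using AE_gram_mat_nonsingular[OF w(1)] AE_space
    proof eventually_elim
      fix G assume d: "det (gram_mat n m w G) \<noteq> 0" and G: "G \<in> space (tuples n m)"
      have "tuple_map m (coproj n E) G = tuple_mult m w (frame_coords n m w G)"
        using tuple_map_coproj_frame[OF E, of w G] w G by (simp add: m)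
      thus "rotation_average (tuple_map m (coproj n E) G) = ?a"
        using rotation_average_const[OF w(1) frame_coords_space] d by (simp add: tuple_det_frame_coords)
    qed
  qed
  \<comment> \<open>Projecting along the image of \<open>E\<close> amounts to rotating the
    projection, provided that the Gaussian tuple is rotated as well.\<close>
  have Xorth: "X (U ` E) = (\<integral>\<^sup>+ G. gauss n m G * \<psi> (tuple_map m U (tuple_map m (coproj n E) G)) \<partial>tuples n m)"
    if U: "orthogonal_map n U" and E: "E \<in> grassmannian n k" for U E
  proof -
    have UE: "U ` E \<in> space \<nu>" using orthogonal_map_grassmannian(1)[OF U E] sp by simp
    have "(\<lambda>G. gauss n m G * \<psi> (tuple_map m (coproj n (U ` E)) G)) \<in> borel_measurable (tuples n m)"
      by (intro borel_measurable_times_ennreal gw' measurable_compose[OF tm psi_meas] measurable_const measurable_ident_sets[OF refl] UE)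
    from nn_integral_tuple_map[OF U this]
    have "X (U ` E) = (\<integral>\<^sup>+ G. gauss n m (tuple_map m U G) * \<psi> (tuple_map m (coproj n (U ` E)) (tuple_map m U G)) \<partial>tuples n m)"
      by (simp add: X_def)
    also have "\<dots> = (\<integral>\<^sup>+ G. gauss n m G * \<psi> (tuple_map m U (tuple_map m (coproj n E) G)) \<partial>tuples n m)"
    proof (rule nn_integral_cong)
      fix G assume G: "G \<in> space (tuples n m)"
      have "tuple_map m (coproj n (U ` E)) (tuple_map m U G) = tuple_map m U (tuple_map m (coproj n E) G)"
        using orthogonal_map_grassmannian(2)[OF U E] tuples_Rn[OF G] linear_diff[OF orthogonal_mapD(1)[OF U]]
        by (auto simp: tuple_map_def coproj_def intro!: restrict_ext)
      thus "gauss n m (tuple_map m U G) * \<psi> (tuple_map m (coproj n (U ` E)) (tuple_map m U G)) = gauss n m G * \<psi> (tuple_map m U (tuple_map m (coproj n E) G))"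
        by (simp add: gauss_tuple_map[OF U G])
    qed
    finally show ?thesis .
  qed
  let ?c = "\<integral>\<^sup>+ A. gauss n n A \<partial>tuples n n"
  have jm: "(\<lambda>p. gauss n n (a p) * (gauss n m (g p) * \<psi> (tuple_map m (gs_rotation n (a p)) (tuple_map m (coproj n (e p)) (g p))))) \<in> borel_measurable N"
    if "a \<in> N \<rightarrow>\<^sub>M tuples n n" "g \<in> N \<rightarrow>\<^sub>M tuples n m" "e \<in> N \<rightarrow>\<^sub>M \<nu>" for a g e and N :: "'z measure"
    by (intro borel_measurable_times_ennreal gauss_measurable that measurable_compose[OF tuple_map_gs_rotation_measurable psi_meas] tm)
  have "?c * (\<integral>\<^sup>+ E. X E \<partial>\<nu>) = (\<integral>\<^sup>+ A. gauss n n A * (\<integral>\<^sup>+ E. X E \<partial>\<nu>) \<partial>tuples n n)"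
    by (rule nn_integral_multc[OF gw', symmetric])
  also have "\<dots> = (\<integral>\<^sup>+ A. \<integral>\<^sup>+ E. \<integral>\<^sup>+ G. gauss n n A * (gauss n m G * \<psi> (tuple_map m (gs_rotation n A) (tuple_map m (coproj n E) G))) \<partial>tuples n m \<partial>\<nu> \<partial>tuples n n)"
  proof (rule nn_integral_cong_AE, use AE_gs_rotation_orthogonal[of n] AE_space in eventually_elim)
    fix A assume U: "orthogonal_map n (gs_rotation n A)" and A: "A \<in> space (tuples n n)"
    have "gauss n n A * (\<integral>\<^sup>+ E. X E \<partial>\<nu>) = gauss n n A * (\<integral>\<^sup>+ E. X (gs_rotation n A ` E) \<partial>\<nu>)"
      by (simp add: nn_integral_image[OF haar U Xm])
    also have "\<dots> = (\<integral>\<^sup>+ E. gauss n n A * X (gs_rotation n A ` E) \<partial>\<nu>)"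
      by (rule nn_integral_cmult[symmetric, OF measurable_compose[OF image_measurable[OF haar U] Xm]])
    also have "\<dots> = (\<integral>\<^sup>+ E. \<integral>\<^sup>+ G. gauss n n A * (gauss n m G * \<psi> (tuple_map m (gs_rotation n A) (tuple_map m (coproj n E) G))) \<partial>tuples n m \<partial>\<nu>)"
    proof (rule nn_integral_cong)
      fix E assume E: "E \<in> space \<nu>"
      have "(\<lambda>G. gauss n m G * \<psi> (tuple_map m (gs_rotation n A) (tuple_map m (coproj n E) G))) \<in> borel_measurable (tuples n m)"
        by (intro borel_measurable_times_ennreal gw' measurable_compose[OF tuple_map_gs_rotation_measurable psi_meas] tm
            measurable_const measurable_ident_sets[OF refl] E A)
      thus "gauss n n A * X (gs_rotation n A ` E) = (\<integral>\<^sup>+ G. gauss n n A * (gauss n m G * \<psi> (tuple_map m (gs_rotation n A) (tuple_map m (coproj n E) G))) \<partial>tuples n m)"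
        using Xorth[OF U] E sp by (simp add: nn_integral_cmult)
    qed
    finally show "gauss n n A * (\<integral>\<^sup>+ E. X E \<partial>\<nu>) = (\<integral>\<^sup>+ E. \<integral>\<^sup>+ G. gauss n n A * (gauss n m G * \<psi> (tuple_map m (gs_rotation n A) (tuple_map m (coproj n E) G))) \<partial>tuples n m \<partial>\<nu>)" .
  qed
  also have "\<dots> = (\<integral>\<^sup>+ E. \<integral>\<^sup>+ A. \<integral>\<^sup>+ G. gauss n n A * (gauss n m G * \<psi> (tuple_map m (gs_rotation n A) (tuple_map m (coproj n E) G))) \<partial>tuples n m \<partial>tuples n n \<partial>\<nu>)"
    by (rule nn_integral_swap[OF sigma_finite_tuples sf], rule sigma_tuples_nn_integral_measurable, rule jm)
       (intro measurable_compose[OF measurable_fst measurable_fst] measurable_compose[OF measurable_fst measurable_snd] measurable_snd)+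
  also have "\<dots> = (\<integral>\<^sup>+ E. (\<integral>\<^sup>+ G. gauss n m G \<partial>tuples n m) * ?a \<partial>\<nu>)"
  proof (rule nn_integral_cong)
    fix E assume E: "E \<in> space \<nu>"
    have E': "E \<in> grassmannian n k" using E sp by simp
    have "(\<integral>\<^sup>+ A. \<integral>\<^sup>+ G. gauss n n A * (gauss n m G * \<psi> (tuple_map m (gs_rotation n A) (tuple_map m (coproj n E) G))) \<partial>tuples n m \<partial>tuples n n) =
      (\<integral>\<^sup>+ G. \<integral>\<^sup>+ A. gauss n n A * (gauss n m G * \<psi> (tuple_map m (gs_rotation n A) (tuple_map m (coproj n E) G))) \<partial>tuples n n \<partial>tuples n m)"
      by (rule nn_integral_swap[OF sigma_finite_tuples sigma_finite_tuples], rule jm) (intro measurable_fst measurable_snd measurable_const E)+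
    also have "\<dots> = (\<integral>\<^sup>+ G. gauss n m G * ?a \<partial>tuples n m)"
    proof (rule nn_integral_cong_AE, use rotation_average_coproj[OF E'] AE_space in eventually_elim)
      fix G assume c: "rotation_average (tuple_map m (coproj n E) G) = ?a" and G: "G \<in> space (tuples n m)"
      have m2: "(\<lambda>A. gauss n n A * \<psi> (tuple_map m (gs_rotation n A) (tuple_map m (coproj n E) G))) \<in> borel_measurable (tuples n n)"
        by (intro borel_measurable_times_ennreal gw' measurable_compose[OF tuple_map_gs_rotation_measurable psi_meas]
            measurable_ident_sets[OF refl] measurable_const tsp[OF E' G])
      have "(\<integral>\<^sup>+ A. gauss n n A * (gauss n m G * \<psi> (tuple_map m (gs_rotation n A) (tuple_map m (coproj n E) G))) \<partial>tuples n n) =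
        (\<integral>\<^sup>+ A. gauss n m G * (gauss n n A * \<psi> (tuple_map m (gs_rotation n A) (tuple_map m (coproj n E) G))) \<partial>tuples n n)"
        by (simp only: mult_ac)
      also have "\<dots> = gauss n m G * rotation_average (tuple_map m (coproj n E) G)" unfolding rotation_average_def by (rule nn_integral_cmult[OF m2])
      finally show "(\<integral>\<^sup>+ A. gauss n n A * (gauss n m G * \<psi> (tuple_map m (gs_rotation n A) (tuple_map m (coproj n E) G))) \<partial>tuples n n) = gauss n m G * ?a"
        by (simp add: c)
    qed
    also have "\<dots> = (\<integral>\<^sup>+ G. gauss n m G \<partial>tuples n m) * ?a" by (rule nn_integral_multc[OF gw'])
    finally show "(\<integral>\<^sup>+ A. \<integral>\<^sup>+ G. gauss n n A * (gauss n m G * \<psi> (tuple_map m (gs_rotation n A) (tuple_map m (coproj n E) G))) \<partial>tuples n m \<partial>tuples n n) = (\<integral>\<^sup>+ G. gauss n m G \<partial>tuples n m) * ?a" .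
  qed
  also have "\<dots> = (\<integral>\<^sup>+ G. gauss n m G \<partial>tuples n m) * ?a" by (simp add: \<nu>.emeasure_space_1)
  also have "\<dots> = ?c * (\<integral>\<^sup>+ G. gauss n m G * \<psi> G \<partial>tuples n m)" by (rule gauss_average[symmetric])
  finally show "(\<integral>\<^sup>+ E. X E \<partial>\<nu>) = (\<integral>\<^sup>+ G. gauss n m G * \<psi> G \<partial>tuples n m)"
    by (simp add: ennreal_mult_cancel_left nn_integral_gauss)
qed

section \<open>Marginal densities\<close>

text \<open>If the norm were 0, then \<open>f\<close> would be at most 0 almost everywhere and its
  integral could not be 1.\<close>

lemma Linf_norm_bound:
  assumes f: "f \<in> borel_measurable (leb n)" and f1: "(\<integral>\<^sup>+ y. ennreal (f y) \<partial>leb n) = 1"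
    and fin: "Linf_norm (leb n) f < \<infinity>"
  shows "real_of_ereal (Linf_norm (leb n) f) > 0" "AE y in leb n. f y \<le> real_of_ereal (Linf_norm (leb n) f)"
proof -
  let ?L = "Linf_norm (leb n) f"
  have ae: "AE y in leb n. ereal \<bar>f y\<bar> \<le> ?L"
    unfolding Linf_norm_def by (rule esssup_AE)
  have not_AE: "\<not> (AE y in leb n. f y \<le> 0)"
  proof
    assume "AE y in leb n. f y \<le> 0"
    hence "AE y in leb n. ennreal (f y) = 0" by eventually_elim (simp add: ennreal_neg)
    hence "(\<integral>\<^sup>+ y. ennreal (f y) \<partial>leb n) = (\<integral>\<^sup>+ y. 0 \<partial>leb n)" by (intro nn_integral_cong_AE) simp
    thus False using f1 by simp
  qed
  have Lpos: "?L > 0"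
  proof (rule ccontr)
    assume "\<not> ?L > 0"
    hence "?L \<le> 0" by simp
    from ae have "AE y in leb n. f y \<le> 0"
    proof eventually_elim
      fix y assume "ereal \<bar>f y\<bar> \<le> ?L"
      with \<open>?L \<le> 0\<close> have "ereal \<bar>f y\<bar> \<le> 0" by (rule order_trans[rotated])
      thus "f y \<le> 0" by simp
    qed
    thus False using not_AE by simp
  qed
  then obtain r where r: "?L = ereal r" "r > 0" using fin by (cases ?L) auto
  thus "real_of_ereal ?L > 0" by simp
  show "AE y in leb n. f y \<le> real_of_ereal ?L"
    using ae by eventually_elim (simp add: r)
qed

text \<open>For an orthonormal basis \<open>G\<close> of the complement, this is the probability
  under the density \<open>f\<close> of the points where the n-th power of the marginal density
  exceeds \<open>t\<close>.\<close>

definition bad_mass :: "nat \<Rightarrow> nat \<Rightarrow> nat \<Rightarrow> ((nat \<Rightarrow> real) \<Rightarrow> real) \<Rightarrow> ennreal \<Rightarrow> (nat \<Rightarrow> nat \<Rightarrow> real) \<Rightarrow> ennreal" where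
  "bad_mass n m k f t G = (\<integral>\<^sup>+ x. ennreal (f x) * indicator {p. t < p} (fibre_power n m k f G x) \<partial>leb n)"

lemma bad_mass_measurable:
  assumes "n = m + k" and f: "f \<in> borel_measurable (leb n)"
  shows "bad_mass n m k f t \<in> borel_measurable (tuples n m)"
proof -
  have i: "(indicator {p. t < p} :: ennreal \<Rightarrow> ennreal) \<in> borel_measurable borel" by measurable
  have "(\<lambda>p. ennreal (f (snd p)) * indicator {p. t < p} (fibre_power n m k f (fst p) (snd p)) :: ennreal)
     \<in> borel_measurable (tuples n m \<Otimes>\<^sub>M leb n)"
    by (intro borel_measurable_times_ennreal measurable_compose[OF fibre_power_measurable[OF assms measurable_fst measurable_snd] i]
        measurable_compose[OF measurable_snd measurable_compose[OF f measurable_ennreal]])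
  from leb_nn_integral_measurable[OF this] show ?thesis unfolding bad_mass_def .
qed

text \<open>This resolves the choice of a basis inside \<open>lebesgue_subspace\<close>. The
  averages have the same value at all orthonormal bases of the complement, so it does not matter
  which one was chosen.\<close>

lemma marginal_density_frame:
  assumes E: "E \<in> grassmannian n k" and n: "n = m + k"
    and f: "f \<in> borel_measurable (leb n)"
  obtains w where "orthonormal n m w" "span (w ` {..<m}) = orth_complement n E"
    "\<forall>x\<in>Rn n. marginal_density n E f x = fibre_integral m f w x"
proof -
  let ?F = "orth_complement n E"
  have d: "dim ?F = m" and ex: "\<exists>w. orthonormal_basis n ?F w"
  proof -
    obtain w where w: "orthonormal n (n - k) w" "span (w ` {..<n - k}) = ?F" "dim ?F = n - k"
      by (rule grassmannian_frames[OF E])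
    show "dim ?F = m" using w n by simp
    show "\<exists>w. orthonormal_basis n ?F w"
      using w by (intro exI[of _ w]) (auto simp: orthonormal_basis_def orthonormal_def)
  qed
  define w where "w = (SOME w. orthonormal_basis n ?F w)"
  have ob: "orthonormal_basis n ?F w" unfolding w_def by (rule someI_ex[OF ex])
  have sp: "span (w ` {..<m}) = ?F" using ob by (simp add: orthonormal_basis_def d)
  have wR: "w i \<in> Rn n" if "i < m" for i
  proof -
    have "w i \<in> ?F" unfolding sp[symmetric] using that by (intro span_base) auto
    thus ?thesis using orth_complement_subspace(2) by blast
  qed
  have on: "orthonormal n m w" using ob wR by (auto simp: orthonormal_basis_def orthonormal_def d)
  have "marginal_density n E f x = fibre_integral m f w x" if x: "x \<in> Rn n" for x
  proof -
    let ?B = "restrict_space borel (Rn n) :: (nat \<Rightarrow> real) measure"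
    have lm: "(\<lambda>c. lin_comb m w c) \<in> leb m \<rightarrow>\<^sub>M leb n"
    proof -
      have "(\<lambda>c. lin_comb m (restrict w {..<m}) c) \<in> leb m \<rightarrow>\<^sub>M leb n"
        by (intro lin_comb_measurable measurable_const measurable_ident_sets[OF refl] restrict_frame_space on)
      thus ?thesis by (simp add: lin_comb_def)
    qed
    hence lm': "(\<lambda>c. \<Sum>j<m. c j *\<^sub>R w j) \<in> leb m \<rightarrow>\<^sub>M ?B"
      unfolding lin_comb_def using measurable_cong_sets[OF refl sets_leb] by blast
    have "(\<lambda>y. ennreal (f (x + y))) \<in> borel_measurable (leb n)"
      by (intro measurable_compose[OF _ measurable_compose[OF f measurable_ennreal]] leb.add_measurable'
          measurable_const measurable_ident_sets[OF refl]) (use x in simp)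
    hence fm: "(\<lambda>y. ennreal (f (x + y))) \<in> borel_measurable ?B"
      using measurable_cong_sets[OF sets_leb refl] by blast
    have "marginal_density n E f x = (\<integral>\<^sup>+ y. ennreal (f (x + y)) \<partial>distr (leb m) ?B (\<lambda>c. \<Sum>j<m. c j *\<^sub>R w j))"
      unfolding marginal_density_def lebesgue_subspace_def Let_def d w_def[symmetric] ..
    also have "\<dots> = (\<integral>\<^sup>+ c. ennreal (f (x + (\<Sum>j<m. c j *\<^sub>R w j))) \<partial>leb m)"
      by (rule nn_integral_distr[OF lm']) (use fm in simp)
    finally show ?thesis by (simp add: fibre_integral_def lin_comb_def)
  qed
  with on sp that show ?thesis by blast
qed

text \<open>A point and its projection differ by a vector of the complement, which a translation of
  the parameter absorbs.\<close>

lemma fibre_integral_orth_proj: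
  assumes E: "E \<in> grassmannian n k" and n: "n = m + k" and f: "f \<in> borel_measurable (leb n)"
    and w: "orthonormal n m w" "span (w ` {..<m}) = orth_complement n E" and x: "x \<in> Rn n"
  shows "fibre_integral m f w (orth_proj n E x) = fibre_integral m f w x"
proof -
  have nk: "n - k = m" using n by simp
  define c where "c = (\<lambda>i. if i < m then ip n x (w i) else 0)"
  have c: "c \<in> space (leb m)" by (simp add: c_def Rn_def)
  have "coproj n E x = lin_comb m w c"
    using coproj_frame[OF E, of w x] w x unfolding nk lin_comb_def c_def by simp
  hence xp: "x = orth_proj n E x + lin_comb m w c" by (simp add: coproj_def algebra_simps)
  have add: "x + lin_comb m w z = orth_proj n E x + lin_comb m w (z + c)" for z
    by (subst xp) (simp add: lin_comb_def scaleR_add_left sum.distrib algebra_simps)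
  let ?g = "\<lambda>z. ennreal (f (orth_proj n E x + lin_comb m w z))"
  have "(\<lambda>z. orth_proj n E x + lin_comb m (restrict w {..<m}) z) \<in> leb m \<rightarrow>\<^sub>M leb n"
    by (intro leb.add_measurable' lin_comb_measurable measurable_const measurable_ident_sets[OF refl] restrict_frame_space w)
       (simp add: orth_proj_Rn(3)[OF E])
  hence "(\<lambda>z. orth_proj n E x + lin_comb m w z) \<in> leb m \<rightarrow>\<^sub>M leb n" by (simp add: lin_comb_def)
  from leb.shift[OF c measurable_compose[OF this measurable_compose[OF f measurable_ennreal]]]
  show ?thesis by (simp only: fibre_integral_def add)
qed

text \<open>The condition that defines \<open>S\<close> is constant along the fibres of the
  projection. Hence the preimage of \<open>N\<close> is exactly \<open>S\<close>, and the marginal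
  gives \<open>N\<close> the mass \<open>bad_mass\<close>.\<close>

lemma good_subspace:
  fixes n k m :: nat
  assumes E: "E \<in> grassmannian n k" and n: "n = m + k" and m: "m \<ge> 1" and k: "k \<ge> 1"
    and \<mu>: "prob_space \<mu>" "\<mu> = density (leb n) (\<lambda>x. ennreal (f x))" and f: "f \<in> borel_measurable (leb n)"
    and w: "orthonormal n m w" "span (w ` {..<m}) = orth_complement n E"
      "\<forall>x\<in>Rn n. marginal_density n E f x = fibre_integral m f w x"
    and C: "C > 0" and M: "M > 0" and s: "s > 0"
    and small: "bad_mass n m k f (ennreal (C ^ (n * k) * M ^ k)) (restrict w {..<m}) < ennreal s"
  shows "\<exists>N\<in>sets (marginal n E \<mu>). measure (marginal n E \<mu>) N < s \<and>
    (\<forall>x\<in>E - N. marginal_density n E f x < \<infinity> \<and>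
      enn2real (marginal_density n E f x) powr (1 / real k) \<le> C * M powr (1 / real n))"
proof -
  interpret \<mu>: prob_space \<mu> by fact
  let ?t = "C ^ (n * k) * M ^ k"
  let ?w = "restrict w {..<m}"
  have ER: "E \<subseteq> Rn n" using E by (simp add: grassmannian_def)
  have wsp: "?w \<in> space (tuples n m)" by (rule restrict_frame_space[OF w(1)])
  have on: "orthonormal n m ?w" using w(1) by (auto simp: orthonormal_def)
  have lw: "lin_comb m ?w z = lin_comb m w z" for z by (simp add: lin_comb_def)
  have fibre_power: "fibre_power n m k f ?w x = fibre_integral m f w x ^ n" for x
    unfolding fibre_power_def gram_mat_power_orthonormal[OF m on] by (simp add: fibre_integral_def lw)
  have Pm: "(\<lambda>x. fibre_power n m k f ?w x) \<in> borel_measurable (leb n)"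
    by (intro fibre_power_measurable[OF n f] measurable_const measurable_ident_sets[OF refl] wsp)
  define S where "S = {x \<in> space (leb n). ennreal ?t < fibre_power n m k f ?w x}"
  have S: "S \<in> sets (leb n)" unfolding S_def
    using Pm by (rule borel_measurable_less[OF measurable_const, rotated]) simp
  define N where "N = E \<inter> S"
  have setsE: "sets (marginal n E \<mu>) = sets (restrict_space borel E)" by (simp add: marginal_def)
  have NE: "N \<in> sets (restrict_space borel E)"
  proof -
    obtain B where B: "B \<in> sets borel" "S = Rn n \<inter> B"
      using S unfolding sets_leb sets_restrict_space by blast
    hence "N = E \<inter> B" using ER by (auto simp: N_def)
    thus ?thesis using B(1) by (auto simp: sets_restrict_space)
  qed
  have sp\<mu>: "space \<mu> = Rn n" "sets \<mu> = sets (leb n)" using \<mu>(2) by auto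
  have Pmeas: "orth_proj n E \<in> \<mu> \<rightarrow>\<^sub>M restrict_space borel E"
  proof (rule measurable_restrict_space2)
    show "orth_proj n E \<in> space \<mu> \<rightarrow> E" using orth_proj_Rn(1)[OF E] by auto
    have "(\<lambda>x. orth_proj n E x i) \<in> borel_measurable (leb n)" for i
    proof -
      have "(\<lambda>x. \<Sum>j<n. x j * orth_proj n E (indicator {j}) i) \<in> borel_measurable (leb n)"
        by (intro borel_measurable_sum borel_measurable_times borel_measurable_const leb_coord_measurable[OF measurable_ident_sets[OF refl]])
      moreover have "orth_proj n E x i = (\<Sum>j<n. x j * orth_proj n E (indicator {j}) i)" if "x \<in> space (leb n)" for x
        using orth_proj_coords[OF E] that by simp
      moreover have "(\<lambda>x. orth_proj n E x i) \<in> borel_measurable (leb n) \<longleftrightarrow>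
          (\<lambda>x. \<Sum>j<n. x j * orth_proj n E (indicator {j}) i) \<in> borel_measurable (leb n)"
        by (rule measurable_cong) fact
      ultimately show ?thesis by simp
    qed
    hence "orth_proj n E \<in> borel_measurable (leb n)" by (rule measurable_coordinatewise_then_product)
    thus "orth_proj n E \<in> borel_measurable \<mu>" using measurable_cong_sets[OF sp\<mu>(2) refl] by blast
  qed
  have pre: "orth_proj n E -` N \<inter> space \<mu> = S"
  proof -
    have "orth_proj n E x \<in> N \<longleftrightarrow> x \<in> S" if x: "x \<in> Rn n" for x
      using orth_proj_Rn(1)[OF E, of x] orth_proj_Rn(3)[OF E, of x] x fibre_integral_orth_proj[OF E n f w(1,2) x] by (simp add: N_def S_def fibre_power)
    moreover have "S \<subseteq> Rn n" by (auto simp: S_def)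
    ultimately show ?thesis using sp\<mu>(1) by blast
  qed
  have "emeasure \<mu> S = (\<integral>\<^sup>+ x. ennreal (f x) * indicator S x \<partial>leb n)"
    unfolding \<mu>(2) by (rule emeasure_density[OF measurable_compose[OF f measurable_ennreal] S])
  also have "\<dots> = bad_mass n m k f (ennreal ?t) ?w"
    unfolding bad_mass_def by (intro nn_integral_cong) (auto simp: S_def indicator_def)
  finally have "emeasure \<mu> S < ennreal s" using small by simp
  hence "ennreal (measure \<mu> S) < ennreal s" by (simp add: \<mu>.emeasure_eq_measure)
  hence ms: "measure (marginal n E \<mu>) N < s"
    unfolding marginal_def measure_distr[OF Pmeas NE] pre by (simp add: ennreal_less_iff)
  have "marginal_density n E f x < \<infinity> \<and> enn2real (marginal_density n E f x) powr (1 / real k) \<le> C * M powr (1 / real n)"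
    if x: "x \<in> E - N" for x
  proof -
    have xR: "x \<in> Rn n" using x ER by auto
    let ?v = "fibre_integral m f w x"
    have npos: "n > 0" using n m by simp
    have le: "?v ^ n \<le> ennreal ?t" using x xR by (auto simp: N_def S_def fibre_power not_less)
    hence "?v ^ n < \<infinity>" by (rule le_less_trans) simp
    hence fin: "?v < \<infinity>" using npos by (simp add: power_less_top_ennreal)
    define a where "a = enn2real ?v"
    have a: "a \<ge> 0" "?v = ennreal a" using fin by (auto simp: a_def)
    have an: "a ^ n \<le> ?t" using le a C M by (simp add: ennreal_power ennreal_le_iff)
    have "a powr (1 / real k) \<le> C * M powr (1 / real n)"
    proof (cases "a = 0")
      case True thus ?thesis using C by simp
    next
      case False
      hence ap: "a > 0" using a by simp
      \<comment> \<open>The threshold \<open>?t\<close> was made for this step: its root of order n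
        k is \<open>C * M powr (1 / real n)\<close>.\<close>
      have "a powr (1 / real k) = (a ^ n) powr (1 / (real n * real k))"
        using ap npos by (simp add: powr_realpow[symmetric] powr_powr)
      also have "\<dots> \<le> ?t powr (1 / (real n * real k))"
        using an ap by (intro powr_mono2) auto
      also have "\<dots> = C * M powr (1 / real n)"
        using C M npos k by (simp add: powr_mult powr_realpow[symmetric] powr_powr)
      finally show ?thesis .
    qed
    thus ?thesis using fin w(3) xR by (simp add: a_def)
  qed
  thus ?thesis using NE ms setsE by blast
qed

section \<open>Markov's inequality in the point and in the subspace\<close>

theorem marginal_density_bound:
  fixes n k :: nat
  assumes \<mu>: "prob_space \<mu>" "\<mu> = density (lebesgue_Rn n) (\<lambda>x. ennreal (f x))"
    and f: "f \<in> borel_measurable (lebesgue_Rn n)" and f0: "\<forall>x\<in>Rn n. 0 \<le> f x"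
    and Linf: "Linf_norm (lebesgue_Rn n) f < \<infinity>"
    and k: "1 \<le> k" "k \<le> n - 1" and haar: "haar_grassmannian n k \<nu>"
  shows "\<exists>\<A>\<in>sets \<nu>. measure \<nu> \<A> \<ge> 1 - exp (- (real k * real n)) \<and>
    (\<forall>E\<in>\<A>. \<exists>N\<in>sets (marginal n E \<mu>). measure (marginal n E \<mu>) N < exp (- (real k * real n)) \<and>
      (\<forall>x\<in>E - N. marginal_density n E f x < \<infinity> \<and>
        enn2real (marginal_density n E f x) powr (1 / real k)
          \<le> 20 * exp 3 * real_of_ereal (Linf_norm (lebesgue_Rn n) f) powr (1 / real n)))"
proof -
  interpret \<mu>: prob_space \<mu> by fact
  interpret \<nu>: prob_space \<nu> by (rule haarD(1)[OF haar])
  define m where "m = n - k"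
  \<comment> \<open>As \<open>k\<close> is at least 1, the bound by \<open>n - 1\<close> excludes
    \<open>n = 0\<close> in spite of truncated subtraction; so \<open>m\<close> is at least
    1.\<close>
  have n: "n = m + k" and m: "m \<ge> 1" and mn: "m \<le> n" using k by (auto simp: m_def)
  have mf: "(\<lambda>x. ennreal (f x)) \<in> borel_measurable (leb n)" by (rule measurable_compose[OF f measurable_ennreal])
  have f1: "(\<integral>\<^sup>+ y. ennreal (f y) \<partial>leb n) = 1"
  proof -
    have "emeasure \<mu> (space (leb n)) = 1" using \<mu>.emeasure_space_1 unfolding \<mu>(2) by simp
    also have "emeasure \<mu> (space (leb n)) = (\<integral>\<^sup>+ x. ennreal (f x) * indicator (space (leb n)) x \<partial>leb n)"
      unfolding \<mu>(2) by (rule emeasure_density[OF mf sets.top])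
    also have "\<dots> = (\<integral>\<^sup>+ y. ennreal (f y) \<partial>leb n)" by (intro nn_integral_cong) (simp add: indicator_def)
    finally show ?thesis .
  qed
  define M where "M = real_of_ereal (Linf_norm (leb n) f)"
  have M: "M > 0" and fM: "AE y in leb n. f y \<le> M" unfolding M_def by (rule Linf_norm_bound[OF f f1 Linf])+
  define s where "s = exp (- (real k * real n))"
  define K where "K = (20 * exp 1) ^ (n * k) * M ^ k"
  define C where "C = 20 * exp (3::real)"
  let ?t = "C ^ (n * k) * M ^ k"
  have s: "s > 0" and C: "C > 0" and K: "K > 0" using M by (auto simp: s_def C_def K_def)
  \<comment> \<open>\<open>K\<close> is the bound for the mean. The threshold \<open>?t\<close>
    exceeds it by e^(2kn), one factor e^(kn) for each use of Markov's inequality.\<close>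
  have sKt: "K = s * s * ?t"
  proof -
    have "s * s * exp 3 ^ (n * k) = exp 1 ^ (n * k)"
      by (simp add: s_def exp_of_nat_mult[symmetric] exp_add[symmetric] algebra_simps)
    thus ?thesis by (simp add: K_def C_def power_mult_distrib mult_ac)
  qed
  define b where "b = bad_mass n m k f (ennreal ?t)"
  \<comment> \<open>\<open>\<psi>\<close> marks the bases whose bad mass is at least
    \<open>s\<close>. As an indicator it makes the average \<open>X\<close> below a multiple of the
    indicator of the bad subspaces.\<close>
  define \<psi> :: "(nat \<Rightarrow> nat \<Rightarrow> real) \<Rightarrow> ennreal" where "\<psi> G = indicator {p. ennreal s \<le> p} (b G)" for G
  have bm: "b \<in> borel_measurable (tuples n m)" unfolding b_def by (rule bad_mass_measurable[OF n f])
  have \<psi>m: "\<psi> \<in> borel_measurable (tuples n m)"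
    unfolding \<psi>_def by (rule measurable_compose[OF bm]) measurable
  interpret basis_invariant n m \<psi>
  proof
    fix G S assume G: "G \<in> space (tuples n m)" and S: "S \<in> space (tuples m m)" "tuple_det m S \<noteq> 0"
    have "b (tuple_mult m G S) = b G"
      unfolding b_def bad_mass_def
      by (intro nn_integral_cong) (simp add: fibre_power_tuple_mult[OF n f G S])
    thus "\<psi> (tuple_mult m G S) = \<psi> G" by (simp add: \<psi>_def)
  qed (use mn \<psi>m in auto)
  define X where "X = (\<lambda>E. \<integral>\<^sup>+ G. gauss n m G * \<psi> (tuple_map m (coproj n E) G) \<partial>tuples n m)"
  note H = haar_average[OF haar m_def, folded X_def]
  define c where "c = sqrt (2 * pi) ^ (n * m)"
  have c: "c > 0" by (simp add: c_def)
  have gwc: "(\<integral>\<^sup>+ G. gauss n m G \<partial>tuples n m) = ennreal c" by (simp add: nn_integral_gauss c_def)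
  \<comment> \<open>Markov's inequality in \<open>x\<close>, written as a product.\<close>
  have le: "ennreal (s * ?t) * \<psi> G \<le> (\<integral>\<^sup>+ x. ennreal (f x) * fibre_power n m k f G x \<partial>leb n)" if G: "G \<in> space (tuples n m)" for G
  proof -
    have Pm: "(\<lambda>x. fibre_power n m k f G x) \<in> borel_measurable (leb n)"
      by (intro fibre_power_measurable[OF n f] measurable_const measurable_ident_sets[OF refl] G)
    have im: "(\<lambda>x. ennreal (f x) * indicator {p. ennreal ?t < p} (fibre_power n m k f G x)) \<in> borel_measurable (leb n)"
      by (intro borel_measurable_times_ennreal mf measurable_compose[OF Pm]) measurable
    have "ennreal s * \<psi> G \<le> b G" by (auto simp: \<psi>_def indicator_def)
    hence "ennreal ?t * (ennreal s * \<psi> G) \<le> ennreal ?t * b G" by (rule mult_left_mono) simp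
    also have "\<dots> = (\<integral>\<^sup>+ x. ennreal ?t * (ennreal (f x) * indicator {p. ennreal ?t < p} (fibre_power n m k f G x)) \<partial>leb n)"
      unfolding b_def bad_mass_def by (rule nn_integral_cmult[symmetric, OF im])
    also have "\<dots> \<le> (\<integral>\<^sup>+ x. ennreal (f x) * fibre_power n m k f G x \<partial>leb n)"
    proof (rule nn_integral_mono)
      fix x
      have "ennreal ?t * indicator {p. ennreal ?t < p} (fibre_power n m k f G x) \<le> fibre_power n m k f G x"
        by (auto simp: indicator_def)
      hence "ennreal (f x) * (ennreal ?t * indicator {p. ennreal ?t < p} (fibre_power n m k f G x)) \<le> ennreal (f x) * fibre_power n m k f G x"
        by (rule mult_left_mono) simp
      thus "ennreal ?t * (ennreal (f x) * indicator {p. ennreal ?t < p} (fibre_power n m k f G x)) \<le> ennreal (f x) * fibre_power n m k f G x"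
        by (simp only: mult_ac)
    qed
    finally show ?thesis using s C M by (simp add: ennreal_mult mult_ac)
  qed
  have gm: "(\<lambda>G. gauss n m G * \<psi> G) \<in> borel_measurable (tuples n m)"
    by (intro borel_measurable_times_ennreal gauss_measurable \<psi>m measurable_ident_sets[OF refl])
  have "ennreal (s * ?t) * (\<integral>\<^sup>+ E. X E \<partial>\<nu>) = (\<integral>\<^sup>+ G. ennreal (s * ?t) * (gauss n m G * \<psi> G) \<partial>tuples n m)"
    unfolding H(2) by (rule nn_integral_cmult[symmetric, OF gm])
  also have "\<dots> \<le> (\<integral>\<^sup>+ G. gauss n m G * (\<integral>\<^sup>+ x. ennreal (f x) * fibre_power n m k f G x \<partial>leb n) \<partial>tuples n m)"
  proof (rule nn_integral_mono)
    fix G assume G: "G \<in> space (tuples n m)"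
    from mult_left_mono[OF le[OF G], of "gauss n m G"]
    show "ennreal (s * ?t) * (gauss n m G * \<psi> G) \<le> gauss n m G * (\<integral>\<^sup>+ x. ennreal (f x) * fibre_power n m k f G x \<partial>leb n)"
      by (simp add: mult_ac)
  qed
  also have "\<dots> \<le> ennreal (K * c)"
    unfolding K_def c_def
    by (rule fibre_power_integral_le[OF n m k(1) M f _ fM f1]) (use f0 in auto)
  also have "K * c = (s * ?t) * (s * c)" using sKt by simp
  also have "ennreal ((s * ?t) * (s * c)) = ennreal (s * ?t) * ennreal (s * c)"
    using s c C M by (intro ennreal_mult) auto
  finally have "(\<integral>\<^sup>+ E. X E \<partial>\<nu>) \<le> ennreal (s * c)"
    using s C M by (subst (asm) ennreal_mult_le_mult_iff) auto
  hence Xle: "(\<integral>\<^sup>+ E. X E \<partial>\<nu>) \<le> ennreal c * ennreal s" using s c by (simp add: ennreal_mult mult.commute)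
  \<comment> \<open>By \<open>XE\<close> below, \<open>X\<close> takes only the values 0 and
    \<open>c\<close>. Defining \<open>Bad\<close> through \<open>X\<close> makes it
    measurable.\<close>
  define Bad where "Bad = {E \<in> space \<nu>. X E \<noteq> 0}"
  have Bad: "Bad \<in> sets \<nu>" unfolding Bad_def using H(1) by (intro borel_measurable_neq) auto
  have XE: "X E = ennreal c * \<psi> (restrict w {..<m})"
    if "E \<in> space \<nu>" "orthonormal n m w" "span (w ` {..<m}) = orth_complement n E" for E w
    using H(3)[OF _ that(2,3)] that(1) haarD(2)[OF haar] gwc by (simp add: X_def)
  \<comment> \<open>Markov's inequality in \<open>E\<close>.\<close>
  have "ennreal c * emeasure \<nu> Bad = (\<integral>\<^sup>+ E. ennreal c * indicator Bad E \<partial>\<nu>)"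
    by (rule nn_integral_cmult_indicator[symmetric, OF Bad])
  also have "\<dots> \<le> (\<integral>\<^sup>+ E. X E \<partial>\<nu>)"
  proof (rule nn_integral_mono)
    fix E assume E: "E \<in> space \<nu>"
    hence E': "E \<in> grassmannian n k" using haarD(2)[OF haar] by simp
    obtain w where w: "orthonormal n m w" "span (w ` {..<m}) = orth_complement n E"
      unfolding m_def by (rule grassmannian_frames[OF E'])
    show "ennreal c * indicator Bad E \<le> X E"
      using XE[OF E w] by (auto simp: Bad_def \<psi>_def indicator_def)
  qed
  also note Xle
  finally have "emeasure \<nu> Bad \<le> ennreal s" using c by (simp add: ennreal_mult_le_mult_iff)
  hence Bs: "measure \<nu> Bad \<le> s" using s by (simp add: \<nu>.emeasure_eq_measure)
  let ?A = "space \<nu> - Bad"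
  have "measure \<nu> ?A \<ge> 1 - s" using \<nu>.prob_compl[OF Bad] Bs by simp
  moreover have "?A \<in> sets \<nu>" using Bad by auto
  moreover have "\<exists>N\<in>sets (marginal n E \<mu>). measure (marginal n E \<mu>) N < s \<and>
      (\<forall>x\<in>E - N. marginal_density n E f x < \<infinity> \<and>
        enn2real (marginal_density n E f x) powr (1 / real k) \<le> C * M powr (1 / real n))" if EA: "E \<in> ?A" for E
  proof -
    have E: "E \<in> grassmannian n k" using EA haarD(2)[OF haar] by simp
    obtain w where w: "orthonormal n m w" "span (w ` {..<m}) = orth_complement n E"
      "\<forall>x\<in>Rn n. marginal_density n E f x = fibre_integral m f w x"
      by (rule marginal_density_frame[OF E n f])
    have "X E = 0" using EA by (auto simp: Bad_def)
    hence "\<psi> (restrict w {..<m}) = 0" using XE[OF _ w(1,2)] EA c by (simp add: ennreal_eq_0_iff)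
    hence "b (restrict w {..<m}) < ennreal s" by (auto simp: \<psi>_def indicator_def split: if_splits)
    thus ?thesis unfolding b_def by (rule good_subspace[OF E n m k(1) \<mu> f w C M s])
  qed
  ultimately show ?thesis unfolding s_def C_def M_def by blast
qed

theorem theorem1p1:
  shows "\<exists>C::real. C > 0 \<and>
    (\<forall>(n::nat) (\<mu> :: (nat \<Rightarrow> real) measure) (f :: (nat \<Rightarrow> real) \<Rightarrow> real).
       prob_space \<mu> \<longrightarrow>
       f \<in> borel_measurable (lebesgue_Rn n) \<longrightarrow>
       (\<forall>x\<in>Rn n. 0 \<le> f x) \<longrightarrow>
       \<mu> = density (lebesgue_Rn n) (\<lambda>x. ennreal (f x)) \<longrightarrow>
       Linf_norm (lebesgue_Rn n) f < \<infinity> \<longrightarrow>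
       (\<forall>(k::nat) \<nu>. 1 \<le> k \<longrightarrow> k \<le> n - 1 \<longrightarrow> haar_grassmannian n k \<nu> \<longrightarrow>
          (\<exists>\<A> \<in> sets \<nu>. measure \<nu> \<A> \<ge> 1 - 2 * exp (- (real k * real n)) \<and>
             (\<forall>E\<in>\<A>. \<exists>N \<in> sets (marginal n E \<mu>).
                measure (marginal n E \<mu>) N < exp (- (real k * real n)) \<and>
                (\<forall>x\<in>E - N.
                   marginal_density n E f x < \<infinity> \<and>
                   enn2real (marginal_density n E f x) powr (1 / real k)
                     \<le> C * real_of_ereal (Linf_norm (lebesgue_Rn n) f) powr (1 / real n))))))"
proof (intro exI[of _ "20 * exp 3"] conjI allI impI)
  fix n k :: nat and \<mu> :: "(nat \<Rightarrow> real) measure" and f \<nu>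
  assume "prob_space \<mu>" "f \<in> borel_measurable (lebesgue_Rn n)" "\<forall>x\<in>Rn n. 0 \<le> f x"
    "\<mu> = density (lebesgue_Rn n) (\<lambda>x. ennreal (f x))" "Linf_norm (lebesgue_Rn n) f < \<infinity>"
    "1 \<le> k" "k \<le> n - 1" "haar_grassmannian n k \<nu>"
  from marginal_density_bound[OF this(1,4,2,3,5-8)]
  obtain \<A> where \<A>: "\<A> \<in> sets \<nu>" "measure \<nu> \<A> \<ge> 1 - exp (- (real k * real n))"
    "\<forall>E\<in>\<A>. \<exists>N\<in>sets (marginal n E \<mu>). measure (marginal n E \<mu>) N < exp (- (real k * real n)) \<and>
      (\<forall>x\<in>E - N. marginal_density n E f x < \<infinity> \<and>
        enn2real (marginal_density n E f x) powr (1 / real k)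
          \<le> 20 * exp 3 * real_of_ereal (Linf_norm (lebesgue_Rn n) f) powr (1 / real n))" by blast
  \<comment> \<open>The measure bound obtained has a single exponential; the factor 2 is
    slack.\<close>
  have "1 - 2 * exp (- (real k * real n)) \<le> measure \<nu> \<A>"
    using \<A>(2) exp_ge_zero[of "- (real k * real n)"] by linarith
  with \<A> show "\<exists>\<A>\<in>sets \<nu>. measure \<nu> \<A> \<ge> 1 - 2 * exp (- (real k * real n)) \<and>
    (\<forall>E\<in>\<A>. \<exists>N\<in>sets (marginal n E \<mu>). measure (marginal n E \<mu>) N < exp (- (real k * real n)) \<and>
      (\<forall>x\<in>E - N. marginal_density n E f x < \<infinity> \<and>
        enn2real (marginal_density n E f x) powr (1 / real k)
          \<le> 20 * exp 3 * real_of_ereal (Linf_norm (lebesgue_Rn n) f) powr (1 / real n)))" by blast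
qed simp

end
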